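(* Let $\lambda\in I_2\cup I_4^-\cup I_4^+$ (notation of the context). For any $L\in\mathcal L_\lambda^+\cup\mathcal L_\lambda^-$, the normal bundle of $L$ in $Z$ is isomorphic to either $O(1)^{\oplus2}$ or $O\oplus O(2)$. Moreover, the latter holds if and only if $\lambda$ is a critical point of the function $$h_0(\lambda)=\frac{Q(\lambda,1)+\sqrt{Q(\lambda,1)^2-f(\lambda)}}{\sqrt{f(\lambda)}}.$$
   Context: Fix real numbers $a,b>0$ and a real quadratic form $Q(y_0,y_1)$; put $f(\lambda)=\lambda(\lambda+1)(a\lambda-b)$. Assume: there is $\lambda_0\in\mathbf R$ such that $Q(\lambda,1)^2-f(\lambda)\ge0$ for all $\lambda\in\mathbf R$ with equality iff $\lambda=\lambda_0$, and $\lambda_0$ is a root of multiplicity two; and $Q(\lambda,1)>\sqrt{f(\lambda)}$ whenever $\lambda\in\mathbf R$, $f(\lambda)\ge0$, $\lambda\ne\lambda_0$. Put $I_2=(-1,0)$, $I_4=(b/a,+\infty)$ (where $f>0$). Assume (as may be arranged by a projective transformation in $y_0,y_1$) that $\lambda_0\in I_4$, and put $I_4^-=(b/a,\lambda_0)$, $I_4^+=(\lambda_0,+\infty)$. $B\subset\mathbf{CP}^3$ is the quartic surface $(y_2y_3+Q(y_0,y_1))^2-y_0y_1(y_0+y_1)(ay_0-by_1)=0$; the real structure on $\mathbf{CP}^3$ is $\sigma(y_0:y_1:y_2:y_3)=(\overline y_0:\overline y_1:\overline y_3:\overline y_2)$. $B$ has exactly three singular points: $(0:0:0:1)$, $(0:0:1:0)$,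 $(\lambda_0:1:0:0)$. $\Phi_0:Z_0\to\mathbf{CP}^3$ is the double covering branched along $B$, $Z_0=\{z^2+(y_2y_3+Q)^2-y_0y_1(y_0+y_1)(ay_0-by_1)=0\}\subset O(2)$, with real structure $(y,z)\mapsto(\sigma(y),\overline z)$; $\mu:Z\to Z_0$ is a small resolution (with $Z$ smooth) to which the real structure lifts; $\Phi=\Phi_0\circ\mu$. $H_\lambda=\{y_0=\lambda y_1\}$ with coordinates $(y_1:y_2:y_3)$. For $\lambda\in I_2\cup I_4^-\cup I_4^+$ and $\theta\in\mathbf R$ let $C_\theta\subset H_\lambda$ be the conic $2(Q^2-f)y_1^2+\sqrt fe^{i\theta}y_2^2+2Qy_2y_3+\sqrt fe^{-i\theta}y_3^2=0$ ($Q=Q(\lambda,1)$, $f=f(\lambda)$). $\Phi^{-1}(C_\theta)$ consists of two real smooth rational curves $L_\theta^+,L_\theta^-$, labelled so that $\mathcal L_\lambda^\pm=\{L_\theta^\pm:\theta\in\mathbf R\}$ are continuous families, each being the set of real members of a pencil on the smooth surface $\Phi^{-1}(H_\lambda)$. *)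

theory Defs
  imports "HOL-Analysis.Analysis" "HOL-Computational_Algebra.Polynomial"
begin

section \<open>Complex manifolds\<close>

text \<open>Holomorphy in several variables: the real Frechet derivative is given by a complex matrix.\<close>

definition holo_on :: "(complex^'n \<Rightarrow> complex^'m) \<Rightarrow> (complex^'n) set \<Rightarrow> bool" where
  "holo_on f S \<longleftrightarrow> open S \<and>
     (\<forall>x\<in>S. \<exists>A::complex^'n^'m. (f has_derivative (\<lambda>h. A *v h)) (at x))"

text \<open>A complex manifold is given by its atlas. The underlying set is the union of the chart
  domains, and its topology is the one determined by the charts.\<close>

type_synonym ('a, 'n) chart = "'a set \<times> ('a \<Rightarrow> complex^'n)"
type_synonym ('a, 'n) atlas = "('a, 'n) chart set"

definition points :: "('a, 'n::finite) atlas \<Rightarrow> 'a set" where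
  "points M = (\<Union>C\<in>M. fst C)"

definition mtop :: "('a, 'n::finite) atlas \<Rightarrow> 'a topology" where
  "mtop M = topology (\<lambda>W. W \<subseteq> points M \<and> (\<forall>(U, c)\<in>M. open (c ` (U \<inter> W))))"

definition complex_manifold :: "('a, 'n::finite) atlas \<Rightarrow> bool" where
  "complex_manifold M \<longleftrightarrow>
     (\<forall>(U, c)\<in>M. inj_on c U \<and> open (c ` U)) \<and>
     (\<forall>(U, c)\<in>M. \<forall>(V, d)\<in>M. holo_on (d \<circ> inv_into U c) (c ` (U \<inter> V))) \<and>
     Hausdorff_space (mtop M) \<and> second_countable (mtop M)"

lemma openin_mtop:
  assumes "\<And>U c. (U, c) \<in> M \<Longrightarrow> inj_on c U" and "\<And>U c. (U, c) \<in> M \<Longrightarrow> open (c ` U)"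
  shows "openin (mtop M) W \<longleftrightarrow> W \<subseteq> points M \<and> (\<forall>(U, c)\<in>M. open (c ` (U \<inter> W)))"
proof -
  have "istopology (\<lambda>W. W \<subseteq> points M \<and> (\<forall>(U, c)\<in>M. open (c ` (U \<inter> W))))"
    unfolding istopology_def
  proof (intro conjI allI impI)
    fix S T
    assume S: "S \<subseteq> points M \<and> (\<forall>(U, c)\<in>M. open (c ` (U \<inter> S)))"
      and T: "T \<subseteq> points M \<and> (\<forall>(U, c)\<in>M. open (c ` (U \<inter> T)))"
    show "S \<inter> T \<subseteq> points M" using S by blast
    show "\<forall>(U, c)\<in>M. open (c ` (U \<inter> (S \<inter> T)))"
    proof clarify
      fix U c assume C: "(U, c) \<in> M"
      have "c ` (U \<inter> (S \<inter> T)) = c ` (U \<inter> S) \<inter> c ` (U \<inter> T)"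
        using assms(1)[OF C] by (auto simp: inj_on_def)
      then show "open (c ` (U \<inter> (S \<inter> T)))" using S T C by auto
    qed
  next
    fix K :: "'a set set"
    assume K: "\<forall>S\<in>K. S \<subseteq> points M \<and> (\<forall>(U, c)\<in>M. open (c ` (U \<inter> S)))"
    show "\<Union>K \<subseteq> points M" using K by blast
    show "\<forall>(U, c)\<in>M. open (c ` (U \<inter> \<Union>K))"
    proof clarify
      fix U c assume C: "(U, c) \<in> M"
      have "c ` (U \<inter> \<Union>K) = (\<Union>S\<in>K. c ` (U \<inter> S))" by blast
      moreover have "open (\<Union>S\<in>K. c ` (U \<inter> S))" using K C by (intro open_UN) fast
      ultimately show "open (c ` (U \<inter> \<Union>K))" by simp
    qed
  qed
  then show ?thesis unfolding mtop_def by (simp add: topology_inverse')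
qed

definition restrict_atlas :: "('a, 'n::finite) atlas \<Rightarrow> 'a set \<Rightarrow> ('a, 'n) atlas" where
  "restrict_atlas M W = (\<lambda>(U, c). (U \<inter> W, c)) ` M"

text \<open>The complex conjugate manifold; an antiholomorphic map is a holomorphic map into it.\<close>

definition conj_atlas :: "('a, 'n::finite) atlas \<Rightarrow> ('a, 'n) atlas" where
  "conj_atlas M = (\<lambda>(U, c). (U, \<lambda>p. \<chi> j. cnj (c p $ j))) ` M"

definition holomorphic_map ::
  "('a, 'n::finite) atlas \<Rightarrow> ('b, 'm::finite) atlas \<Rightarrow> ('a \<Rightarrow> 'b) \<Rightarrow> bool" where
  "holomorphic_map M N f \<longleftrightarrow> continuous_map (mtop M) (mtop N) f \<and>
     (\<forall>(U, c)\<in>M. \<forall>(V, d)\<in>N. holo_on (d \<circ> f \<circ> inv_into U c) (c ` (U \<inter> f -` V)))"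

definition real_structure :: "('a, 'n::finite) atlas \<Rightarrow> ('a \<Rightarrow> 'a) \<Rightarrow> bool" where
  "real_structure M s \<longleftrightarrow> holomorphic_map M (conj_atlas M) s \<and> (\<forall>p\<in>points M. s (s p) = p)"

text \<open>A tangent vector at \<open>p\<close> is the family of its coordinate representations, one for each chart
  around \<open>p\<close> (with value 0 at the irrelevant charts).\<close>

definition tangent_space ::
  "('a, 'n::finite) atlas \<Rightarrow> 'a \<Rightarrow> (('a, 'n) chart \<Rightarrow> complex^'n) set" where
  "tangent_space M p = {X. (\<forall>C. C \<notin> M \<or> p \<notin> fst C \<longrightarrow> X C = 0) \<and>
     (\<forall>(U, c)\<in>M. \<forall>(V, d)\<in>M. p \<in> U \<inter> V \<longrightarrow>
        X (V, d) = frechet_derivative (d \<circ> inv_into U c) (at (c p)) (X (U, c)))}"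

text \<open>The chart at the source is immaterial by the chain rule.\<close>

definition differential ::
  "('a, 'n::finite) atlas \<Rightarrow> ('b, 'm::finite) atlas \<Rightarrow> ('a \<Rightarrow> 'b) \<Rightarrow> 'a \<Rightarrow>
   (('a, 'n) chart \<Rightarrow> complex^'n) \<Rightarrow> (('b, 'm) chart \<Rightarrow> complex^'m)" where
  "differential M N f p X = (\<lambda>D.
     if D \<in> N \<and> f p \<in> fst D then
       let C = (SOME C. C \<in> M \<and> p \<in> fst C) in
         frechet_derivative (snd D \<circ> f \<circ> inv_into (fst C) (snd C)) (at (snd C p)) (X C)
     else 0)"

definition holomorphic_embedding ::
  "('a, 'n::finite) atlas \<Rightarrow> ('b, 'm::finite) atlas \<Rightarrow> ('a \<Rightarrow> 'b) \<Rightarrow> bool" where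
  "holomorphic_embedding M N f \<longleftrightarrow> holomorphic_map M N f \<and> embedding_map (mtop M) (mtop N) f \<and>
     (\<forall>p\<in>points M. inj_on (differential M N f p) (tangent_space M p))"


section \<open>Holomorphic vector bundles\<close>

text \<open>A bundle is given by its fibres and a set of local trivialisations over open sets; the linear
  structure of the fibres is the one transported by the trivialisations.\<close>

record ('a, 'e, 'r) vbundle =
  fibre :: "'a \<Rightarrow> 'e set"
  trivs :: "('a set \<times> ('a \<Rightarrow> 'e \<Rightarrow> complex^'r)) set"

definition holo_matrix_on ::
  "('a, 'n::finite) atlas \<Rightarrow> 'a set \<Rightarrow> ('a \<Rightarrow> complex^'s^'r) \<Rightarrow> bool" where
  "holo_matrix_on M W G \<longleftrightarrow>
     (\<forall>(U, c)\<in>M. \<forall>i. holo_on (\<lambda>x. G (inv_into U c x) $ i) (c ` (U \<inter> W)))"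

definition vector_bundle :: "('a, 'n::finite) atlas \<Rightarrow> ('a, 'e, 'r::finite) vbundle \<Rightarrow> bool" where
  "vector_bundle M E \<longleftrightarrow>
     (\<Union>(fst ` trivs E) = points M) \<and>
     (\<forall>(W, t)\<in>trivs E. openin (mtop M) W \<and> (\<forall>p\<in>W. bij_betw (t p) (fibre E p) UNIV)) \<and>
     (\<forall>(W, t)\<in>trivs E. \<forall>(W', t')\<in>trivs E. \<exists>G::'a \<Rightarrow> complex^'r^'r.
        holo_matrix_on M (W \<inter> W') G \<and>
        (\<forall>p\<in>W \<inter> W'. \<forall>e\<in>fibre E p. t' p e = G p *v t p e))"

definition vb_isomorphic ::
  "('a, 'n::finite) atlas \<Rightarrow> ('a, 'e, 'r::finite) vbundle \<Rightarrow> ('a, 'e2, 'r) vbundle \<Rightarrow> bool" where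
  "vb_isomorphic M E E' \<longleftrightarrow> vector_bundle M E \<and> vector_bundle M E' \<and>
     (\<exists>F. (\<forall>p\<in>points M. bij_betw (F p) (fibre E p) (fibre E' p)) \<and>
        (\<forall>(W, t)\<in>trivs E. \<forall>(W', t')\<in>trivs E'. \<exists>G::'a \<Rightarrow> complex^'r^'r.
           holo_matrix_on M (W \<inter> W') G \<and>
           (\<forall>p\<in>W \<inter> W'. \<forall>e\<in>fibre E p. t' p (F p e) = G p *v t p e)))"

definition vb_sum ::
  "('a, 'e, 'r::finite) vbundle \<Rightarrow> ('a, 'e2, 's::finite) vbundle \<Rightarrow> ('a, 'e \<times> 'e2, 'r + 's) vbundle" where
  "vb_sum E E' = \<lparr>
     fibre = (\<lambda>p. fibre E p \<times> fibre E' p),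
     trivs = {(W \<inter> W', \<lambda>p (e, e'). \<chi> k. case k of Inl i \<Rightarrow> t p e $ i | Inr j \<Rightarrow> t' p e' $ j)
               | W t W' t'. (W, t) \<in> trivs E \<and> (W', t') \<in> trivs E'}\<rparr>"

text \<open>Normal bundle of an immersion \<open>f\<close> from \<open>M\<close> to \<open>N\<close>: the fibre at \<open>p\<close> is the quotient of the
  tangent space of \<open>N\<close> at \<open>f p\<close> by the image of the tangent space of \<open>M\<close> at \<open>p\<close>. Its holomorphic
  structure is the quotient one: a trivialisation is admitted iff its composition with the quotient
  map is a holomorphic matrix in the coordinates of \<open>N\<close>.\<close>

definition normal_class ::
  "('a, 'n::finite) atlas \<Rightarrow> ('b, 'm::finite) atlas \<Rightarrow> ('a \<Rightarrow> 'b) \<Rightarrow> 'a \<Rightarrow>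
   (('b, 'm) chart \<Rightarrow> complex^'m) \<Rightarrow> (('b, 'm) chart \<Rightarrow> complex^'m) set" where
  "normal_class M N f p X = {(\<lambda>D. X D + Y D) | Y. Y \<in> differential M N f p ` tangent_space M p}"

definition normal_bundle ::
  "('a, 'n::finite) atlas \<Rightarrow> ('b, 'm::finite) atlas \<Rightarrow> ('a \<Rightarrow> 'b) \<Rightarrow>
   ('a, (('b, 'm) chart \<Rightarrow> complex^'m) set, 'r::finite) vbundle" where
  "normal_bundle M N f = \<lparr>
     fibre = (\<lambda>p. normal_class M N f p ` tangent_space N (f p)),
     trivs = {(W, t). openin (mtop M) W \<and>
       (\<forall>p\<in>W. bij_betw (t p) (normal_class M N f p ` tangent_space N (f p)) UNIV) \<and>
       (\<forall>D\<in>N. \<exists>G::'a \<Rightarrow> complex^'m^'r.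
          holo_matrix_on M (W \<inter> f -` fst D) G \<and>
          (\<forall>p\<in>W \<inter> f -` fst D. \<forall>X\<in>tangent_space N (f p).
             t p (normal_class M N f p X) = G p *v X D))}\<rparr>"


section \<open>Projective spaces and the bundles O(k)\<close>

text \<open>Points of projective space are the punctured lines in \<open>complex^'m\<close>.\<close>

definition pt :: "complex^'m \<Rightarrow> (complex^'m) set" where
  "pt y = {c *s y | c. c \<noteq> 0}"

text \<open>In type \<open>2\<close> we have \<open>1 + 1 = 0\<close>, so \<open>i + 1\<close> is the index different from \<open>i\<close>.\<close>

definition CP1 :: "((complex^2) set, 1) atlas" where
  "CP1 = {({pt y | y. y $ i \<noteq> 0}, \<lambda>l. \<chi> _. let y = (SOME y. y \<in> l) in y $ (i + 1) / y $ i) | i. True}"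

text \<open>The total space of O(k): classes of \<open>(y, z)\<close> with \<open>y \<noteq> 0\<close> modulo
  \<open>(y, z) \<sim> (c y, c^k z)\<close>; the projection to projective space is \<open>image fst\<close>.\<close>

definition tw :: "nat \<Rightarrow> complex^'m \<Rightarrow> complex \<Rightarrow> ((complex^'m) \<times> complex) set" where
  "tw k y z = {(c *s y, c ^ k * z) | c. c \<noteq> 0}"

text \<open>The chart over \<open>y_i \<noteq> 0\<close> has the affine coordinates \<open>y_j / y_i\<close> for \<open>j \<noteq> i\<close>, and the fibre
  coordinate \<open>z / y_i^k\<close> stored at the free index \<open>i\<close>.\<close>

definition tw_atlas :: "nat \<Rightarrow> (((complex^'m) \<times> complex) set, 'm::finite) atlas" where
  "tw_atlas k = {({tw k y z | y z. y $ i \<noteq> 0},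
     \<lambda>e. let (y, z) = (SOME p. p \<in> e) in \<chi> j. if j = i then z / (y $ i) ^ k else y $ j / y $ i) | i. True}"

definition O_bundle :: "nat \<Rightarrow> ((complex^'m::finite) set, ((complex^'m) \<times> complex) set, 1) vbundle" where
  "O_bundle k = \<lparr>
     fibre = (\<lambda>l. {tw k y z | y z. y \<in> l}),
     trivs = {({pt y | y. y $ i \<noteq> 0},
       \<lambda>l e. \<chi> _. let (y, z) = (SOME p. p \<in> e) in z / (y $ i) ^ k) | i. True}\<rparr>"

definition smooth_rational_curve :: "('z, 'n::finite) atlas \<Rightarrow> 'z set \<Rightarrow> bool" where
  "smooth_rational_curve Z L \<longleftrightarrow> (\<exists>\<phi>. holomorphic_embedding CP1 Z \<phi> \<and> \<phi> ` points CP1 = L)"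

text \<open>The normal bundle of the smooth rational curve \<open>L\<close> in \<open>Z\<close> is isomorphic to O(k) + O(l). The
  identification of \<open>L\<close> with the projective line is immaterial, since automorphisms of the
  projective line preserve O(k).\<close>

definition normal_bundle_iso :: "('z, 3) atlas \<Rightarrow> 'z set \<Rightarrow> nat \<Rightarrow> nat \<Rightarrow> bool" where
  "normal_bundle_iso Z L k l \<longleftrightarrow>
     (\<exists>\<phi>. holomorphic_embedding CP1 Z \<phi> \<and> \<phi> ` points CP1 = L \<and>
        vb_isomorphic CP1 (normal_bundle CP1 Z \<phi>) (vb_sum (O_bundle k) (O_bundle l)))"


section \<open>Small resolutions\<close>

text \<open>\<open>Z0\<close> is a three-dimensional subvariety of the manifold \<open>X\<close> with singular locus \<open>S\<close>. The map
  \<open>\<mu>\<close> is a proper modification, biholomorphic over the regular locus (a submanifold of \<open>X\<close>), and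
  small: the fibres over singular points have dimension at most one, the dimension of an analytic
  set being the largest dimension of a complex submanifold contained in it.\<close>

definition small_resolution ::
  "('z, 3) atlas \<Rightarrow> ('b, 'm::finite) atlas \<Rightarrow> 'b set \<Rightarrow> 'b set \<Rightarrow> ('z \<Rightarrow> 'b) \<Rightarrow> bool" where
  "small_resolution Z X Z0 S \<mu> \<longleftrightarrow>
     complex_manifold Z \<and> holomorphic_map Z X \<mu> \<and> \<mu> ` points Z = Z0 \<and>
     proper_map (mtop Z) (subtopology (mtop X) Z0) \<mu> \<and>
     holomorphic_embedding (restrict_atlas Z (points Z \<inter> \<mu> -` (Z0 - S))) X \<mu> \<and>
     (\<forall>p\<in>S. \<not> (\<exists>(U::(complex^2) set) g. open U \<and> U \<noteq> {} \<and>
        holomorphic_embedding {(U, \<lambda>x. x)} Z g \<and> g ` U \<subseteq> \<mu> -` {p}))"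


section \<open>The double solid\<close>

definition quad :: "real \<Rightarrow> real \<Rightarrow> real \<Rightarrow> 'a::real_field \<Rightarrow> 'a \<Rightarrow> 'a" where
  "quad q0 q1 q2 y0 y1 = of_real q0 * y0\<^sup>2 + of_real q1 * y0 * y1 + of_real q2 * y1\<^sup>2"

definition cubic :: "real \<Rightarrow> real \<Rightarrow> real \<Rightarrow> real" where
  "cubic a b x = x * (x + 1) * (a * x - b)"

definition branch_quartic :: "real \<Rightarrow> real \<Rightarrow> real \<Rightarrow> real \<Rightarrow> real \<Rightarrow> complex^4 \<Rightarrow> complex" where
  "branch_quartic a b q0 q1 q2 y =
     (y $ 2 * y $ 3 + quad q0 q1 q2 (y $ 0) (y $ 1))\<^sup>2
     - y $ 0 * y $ 1 * (y $ 0 + y $ 1) * (of_real a * y $ 0 - of_real b * y $ 1)"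

definition double_eq ::
  "real \<Rightarrow> real \<Rightarrow> real \<Rightarrow> real \<Rightarrow> real \<Rightarrow> (complex^4) \<times> complex \<Rightarrow> complex" where
  "double_eq a b q0 q1 q2 = (\<lambda>(y, z). z\<^sup>2 + branch_quartic a b q0 q1 q2 y)"

definition Z0 :: "real \<Rightarrow> real \<Rightarrow> real \<Rightarrow> real \<Rightarrow> real \<Rightarrow> ((complex^4) \<times> complex) set set" where
  "Z0 a b q0 q1 q2 = {tw 2 y z | y z. y \<noteq> 0 \<and> double_eq a b q0 q1 q2 (y, z) = 0}"

text \<open>Jacobian criterion in homogeneous coordinates.\<close>

definition Z0_sing :: "real \<Rightarrow> real \<Rightarrow> real \<Rightarrow> real \<Rightarrow> real \<Rightarrow> ((complex^4) \<times> complex) set set" where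
  "Z0_sing a b q0 q1 q2 = {tw 2 y z | y z. y \<noteq> 0 \<and> double_eq a b q0 q1 q2 (y, z) = 0 \<and>
     (double_eq a b q0 q1 q2 has_derivative (\<lambda>_. 0)) (at (y, z))}"

definition sigma_CP3 :: "complex^4 \<Rightarrow> complex^4" where
  "sigma_CP3 y = (\<chi> j. cnj (y $ (if j = 2 then 3 else if j = 3 then 2 else j)))"

definition sigma_Z0 :: "((complex^4) \<times> complex) set \<Rightarrow> ((complex^4) \<times> complex) set" where
  "sigma_Z0 e = (\<lambda>(y, z). (sigma_CP3 y, cnj z)) ` e"

text \<open>\<open>\<mu>\<close> followed by the double covering, which is the bundle projection.\<close>

definition Phi :: "('z \<Rightarrow> ((complex^4) \<times> complex) set) \<Rightarrow> 'z \<Rightarrow> (complex^4) set" where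
  "Phi \<mu> x = fst ` \<mu> x"

definition plane :: "real \<Rightarrow> (complex^4) set set" where
  "plane lam = {pt y | y. y \<noteq> 0 \<and> y $ 0 = of_real lam * y $ 1}"

definition conic ::
  "real \<Rightarrow> real \<Rightarrow> real \<Rightarrow> real \<Rightarrow> real \<Rightarrow> real \<Rightarrow> real \<Rightarrow> (complex^4) set set" where
  "conic a b q0 q1 q2 lam \<theta> =
    (let Q = quad q0 q1 q2 lam 1; f = cubic a b lam in
     {pt y | y. y \<noteq> 0 \<and> y $ 0 = of_real lam * y $ 1 \<and>
       of_real (2 * (Q\<^sup>2 - f)) * (y $ 1)\<^sup>2 + of_real (sqrt f) * cis \<theta> * (y $ 2)\<^sup>2
       + of_real (2 * Q) * y $ 2 * y $ 3 + of_real (sqrt f) * cis (- \<theta>) * (y $ 3)\<^sup>2 = 0})"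

definition h0 :: "real \<Rightarrow> real \<Rightarrow> real \<Rightarrow> real \<Rightarrow> real \<Rightarrow> real \<Rightarrow> real" where
  "h0 a b q0 q1 q2 x =
     (quad q0 q1 q2 x 1 + sqrt ((quad q0 q1 q2 x 1)\<^sup>2 - cubic a b x)) / sqrt (cubic a b x)"


section \<open>The families of real curves\<close>

text \<open>Continuity for the Vietoris topology on subsets.\<close>

definition continuous_family :: "'z topology \<Rightarrow> (real \<Rightarrow> 'z set) \<Rightarrow> bool" where
  "continuous_family T L \<longleftrightarrow> (\<forall>\<theta> W. openin T W \<longrightarrow>
     (L \<theta> \<subseteq> W \<longrightarrow> (\<forall>\<^sub>F t in at \<theta>. L t \<subseteq> W)) \<and>
     (L \<theta> \<inter> W \<noteq> {} \<longrightarrow> (\<forall>\<^sub>F t in at \<theta>. L t \<inter> W \<noteq> {})))"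

text \<open>A pencil without fixed components on a surface \<open>S\<close> in \<open>Z\<close>: a map onto the projective line,
  defined and holomorphic (i.e. locally the restriction of a holomorphic map on \<open>Z\<close>) off the finite
  base locus \<open>Bs\<close>. Its members are the fibres together with the base points.\<close>

definition is_pencil ::
  "('z, 3) atlas \<Rightarrow> 'z set \<Rightarrow> 'z set \<Rightarrow> ('z \<Rightarrow> (complex^2) set) \<Rightarrow> bool" where
  "is_pencil Z S Bs \<pi> \<longleftrightarrow> finite Bs \<and> Bs \<subseteq> S \<and> \<pi> ` (S - Bs) = points CP1 \<and>
     (\<forall>p\<in>S - Bs. \<exists>W g. openin (mtop Z) W \<and> p \<in> W \<and>
        holomorphic_map (restrict_atlas Z W) CP1 g \<and> (\<forall>x\<in>W \<inter> (S - Bs). \<pi> x = g x))"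

definition pencil_members :: "'z set \<Rightarrow> 'z set \<Rightarrow> ('z \<Rightarrow> (complex^2) set) \<Rightarrow> 'z set set" where
  "pencil_members S Bs \<pi> = {{x \<in> S - Bs. \<pi> x = l} \<union> Bs | l. l \<in> points CP1}"

definition real_members_of_pencil ::
  "('z, 3) atlas \<Rightarrow> ('z \<Rightarrow> 'z) \<Rightarrow> 'z set \<Rightarrow> 'z set set \<Rightarrow> bool" where
  "real_members_of_pencil Z s S \<L> \<longleftrightarrow>
     (\<exists>Bs \<pi>. is_pencil Z S Bs \<pi> \<and> \<L> = {D \<in> pencil_members S Bs \<pi>. s ` D = D})"

definition labelled_families ::
  "real \<Rightarrow> real \<Rightarrow> real \<Rightarrow> real \<Rightarrow> real \<Rightarrow> ('z, 3) atlas \<Rightarrow> ('z \<Rightarrow> ((complex^4) \<times> complex) set) \<Rightarrow>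
   ('z \<Rightarrow> 'z) \<Rightarrow> real \<Rightarrow> (real \<Rightarrow> 'z set) \<Rightarrow> (real \<Rightarrow> 'z set) \<Rightarrow> bool" where
  "labelled_families a b q0 q1 q2 Z \<mu> s lam Lp Lm \<longleftrightarrow>
     (\<forall>\<theta>. Lp \<theta> \<union> Lm \<theta> = {x \<in> points Z. Phi \<mu> x \<in> conic a b q0 q1 q2 lam \<theta>} \<and> Lp \<theta> \<noteq> Lm \<theta>) \<and>
     (\<forall>\<theta>. \<forall>L\<in>{Lp \<theta>, Lm \<theta>}. smooth_rational_curve Z L \<and> s ` L = L) \<and>
     continuous_family (mtop Z) Lp \<and> continuous_family (mtop Z) Lm \<and>
     real_members_of_pencil Z s {x \<in> points Z. Phi \<mu> x \<in> plane lam} (range Lp) \<and>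
     real_members_of_pencil Z s {x \<in> points Z. Phi \<mu> x \<in> plane lam} (range Lm)"

end

theory Submission
  imports Defs "HOL-Complex_Analysis.Cauchy_Integral_Formula"
begin

text \<open>Put \<open>r = sqrt f\<close> and \<open>w = y\<^sub>2 y\<^sub>3 + Q\<close>, so that the double solid is
  \<open>(w + iz)(w - iz) = y\<^sub>0 y\<^sub>1 (y\<^sub>0 + y\<^sub>1) (a y\<^sub>0 - b y\<^sub>1)\<close>. In suitable coordinates on the plane the conic is
  \<open>(s : t) \<mapsto> (\<lambda>st : st : s\<^sup>2 : t\<^sup>2)\<close>, and on its two lifts \<open>w \<plusminus> iz\<close> become \<open>- r s\<^sup>4\<close> and \<open>- r t\<^sup>4\<close>, up to the
  order. The lifts avoid the singular points, and a smooth rational curve contained in their union is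
  one of them, because they meet in four points only.

  The normal bundle \<open>N\<close> of a lift is an extension of \<open>O(2)\<close> by \<open>O(0)\<close>: the form \<open>eta = dy\<^sub>0 - \<lambda> dy\<^sub>1\<close> maps \<open>N\<close>
  onto \<open>O(2)\<close>, and over each of the two affine charts a polynomial covector \<open>kappa\<close> splits it.
  With \<open>x = t / s\<close>, the two splittings satisfy \<open>kappa\<^sub>0 + kappa\<^sub>1 = (C / x) eta\<^sub>0\<close>, where
  \<open>C = 2 Q' - Q f' / f\<close> represents the extension class. If \<open>C = 0\<close> the sequence splits; otherwise the
  matrices \<open>[[x, - C], [1, 0]]\<close> and \<open>[[- 1, 0], [- 1 / x, C]]\<close> turn the frames into those of
  \<open>O(1) + O(1)\<close>. Finally \<open>h\<^sub>0 = g (Q / r)\<close> with \<open>g p = p + sqrt (p\<^sup>2 - 1)\<close>, and \<open>(Q / r)' = C / (2 r)\<close>.\<close>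

section \<open>Complex differentiability\<close>

text \<open>Charts are complex differentiable to first order, and the inverse of an embedding is
  known to be continuous only. Two analytic facts make up for this. A continuous lift through an
  immersion is holomorphic: this carries the lifted conics from the double solid to \<open>Z\<close>
  and compares two parametrisations of one curve. The Jacobian of a holomorphic map is again
  holomorphic along a curve: this makes the frames of the normal bundle holomorphic. The charts of
  \<open>Z\<close> are arbitrary, so the computations use four functions on \<open>Z\<close>
  instead, which have an injective Jacobian and satisfy one polynomial relation. A tangent vector of
  \<open>Z\<close> then becomes a solution of the linearised relation, and the tangent line of the
  curve is cut out by two further forms. A splitting type is an existence statement over all
  parametrisations of the curve. Excluding \<open>O(0) + O(2)\<close> therefore has to deal with a
  parametrisation that is unrelated to the given one, and it cannot compare transition matrices
  directly; the zeros of a section are what survives the change of parameter.\<close>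

definition cdf :: "(complex^'n \<Rightarrow> complex) \<Rightarrow> complex^'n \<Rightarrow> bool" where
  "cdf g x \<longleftrightarrow> (\<exists>D. (g has_derivative D) (at x) \<and> (\<forall>c h. D (c *s h) = c * D h))"

definition cdiff :: "(complex^'n \<Rightarrow> complex^'m) \<Rightarrow> complex^'n \<Rightarrow> bool" where
  "cdiff f x \<longleftrightarrow> (\<forall>i. cdf (\<lambda>y. f y $ i) x)"

definition jac :: "(complex^'n \<Rightarrow> complex^'m) \<Rightarrow> complex^'n \<Rightarrow> complex^'n^'m" where
  "jac f x = matrix (frechet_derivative f (at x))"

lemma cdf_const [simp, intro]: "cdf (\<lambda>x. c) x"
  unfolding cdf_def by (intro exI[of _ "\<lambda>_. 0"]) auto

lemma cdf_nth [simp, intro]: "cdf (\<lambda>x. x $ i) x"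
  unfolding cdf_def by (intro exI[of _ "\<lambda>h. h $ i"]) (auto intro: bounded_linear_imp_has_derivative)

lemma cdf_add [intro]: "cdf f x \<Longrightarrow> cdf g x \<Longrightarrow> cdf (\<lambda>x. f x + g x) x"
  unfolding cdf_def
proof safe
  fix D E assume a: "(f has_derivative D) (at x)" "\<forall>c h. D (c *s h) = c * D h"
    "(g has_derivative E) (at x)" "\<forall>c h. E (c *s h) = c * E h"
  then show "\<exists>D. ((\<lambda>x. f x + g x) has_derivative D) (at x) \<and> (\<forall>c h. D (c *s h) = c * D h)"
    by (intro exI[of _ "\<lambda>h. D h + E h"]) (auto intro!: derivative_intros simp: algebra_simps)
qed

lemma cdf_mult [intro]: "cdf f x \<Longrightarrow> cdf g x \<Longrightarrow> cdf (\<lambda>x. f x * g x) x"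
  unfolding cdf_def
proof safe
  fix D E assume a: "(f has_derivative D) (at x)" "\<forall>c h. D (c *s h) = c * D h"
    "(g has_derivative E) (at x)" "\<forall>c h. E (c *s h) = c * E h"
  then show "\<exists>D. ((\<lambda>x. f x * g x) has_derivative D) (at x) \<and> (\<forall>c h. D (c *s h) = c * D h)"
    by (intro exI[of _ "\<lambda>h. f x * E h + D h * g x"] conjI has_derivative_mult) (simp_all add: distrib_left)
qed

lemma cdf_minus [intro]: "cdf f x \<Longrightarrow> cdf (\<lambda>x. - f x) x"
  using cdf_mult[of "\<lambda>_. -1" x f] by simp

lemma cdf_diff [intro]: "cdf f x \<Longrightarrow> cdf g x \<Longrightarrow> cdf (\<lambda>x. f x - g x) x"
  using cdf_add[of f x "\<lambda>x. - g x"] cdf_minus[of g x] by simp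

lemma cdf_power [intro]: "cdf f x \<Longrightarrow> cdf (\<lambda>x. f x ^ n) x"
  by (induction n) auto

lemma cdf_inverse [intro]: "cdf f x \<Longrightarrow> f x \<noteq> 0 \<Longrightarrow> cdf (\<lambda>x. inverse (f x)) x"
  unfolding cdf_def
proof safe
  fix D assume a: "(f has_derivative D) (at x)" "\<forall>c h. D (c *s h) = c * D h" "f x \<noteq> 0"
  then show "\<exists>D. ((\<lambda>x. inverse (f x)) has_derivative D) (at x) \<and> (\<forall>c h. D (c *s h) = c * D h)"
    by (intro exI[of _ "\<lambda>h. - (inverse (f x) * D h * inverse (f x))"] conjI Deriv.has_derivative_inverse) simp_all
qed

lemma cdf_divide [intro]: "cdf f x \<Longrightarrow> cdf g x \<Longrightarrow> g x \<noteq> 0 \<Longrightarrow> cdf (\<lambda>x. f x / g x) x"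
  unfolding divide_inverse by (intro cdf_mult cdf_inverse)

lemma cdf_isCont: "cdf f x \<Longrightarrow> isCont f x"
  unfolding cdf_def using has_derivative_continuous by blast

lemma cdf_cong_ev:
  assumes "eventually (\<lambda>y. f y = g y) (nhds x)" shows "cdf f x \<longleftrightarrow> cdf g x"
proof -
  obtain S where S: "open S" "x \<in> S" "\<And>y. y \<in> S \<Longrightarrow> f y = g y"
    using assms unfolding eventually_nhds by blast
  have "(f has_derivative D) (at x) \<longleftrightarrow> (g has_derivative D) (at x)" for D
    using has_derivative_transform_within_open[OF _ S(1,2)] S(3) by metis
  then show ?thesis unfolding cdf_def by simp
qed

lemma cdf_cong_open:
  assumes "open S" "x \<in> S" "\<And>y. y \<in> S \<Longrightarrow> f y = g y" shows "cdf f x \<longleftrightarrow> cdf g x"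
  using assms by (intro cdf_cong_ev) (auto simp: eventually_nhds)

lemma matrix_vector_scale: "A *v (c *s h) = c *s (A *v h)" for A :: "complex^'n^'m"
  by (simp add: vec_eq_iff matrix_vector_mult_def sum_distrib_left algebra_simps)

lemma clinear_matrix:
  fixes D :: "complex^'n \<Rightarrow> complex^'m"
  assumes "linear D" "\<And>c h. D (c *s h) = c *s D h"
  shows "D = (\<lambda>h. matrix D *v h)"
proof -
  have "Vector_Spaces.linear (*s) (*s) D"
    using assms by unfold_locales (auto simp: linear_add)
  from matrix_works[OF this] show ?thesis by auto
qed

lemma has_derivative_vec:
  fixes f :: "'a::real_normed_vector \<Rightarrow> complex^'m"
  assumes "\<And>i. ((\<lambda>y. f y $ i) has_derivative D i) (at x)"
  shows "(f has_derivative (\<lambda>h. \<chi> i. D i h)) (at x)"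
proof -
  have *: "(\<chi> i. g i) = (\<Sum>i\<in>UNIV. axis i (g i :: complex))" for g :: "'m \<Rightarrow> complex"
    by (simp add: vec_eq_iff axis_def if_distrib cong: if_cong)
  have bl: "bounded_linear (axis i :: complex \<Rightarrow> complex^'m)" for i
    by (intro linear_conv_bounded_linear[THEN iffD1] linearI) (auto simp: axis_def vec_eq_iff)
  have "((\<lambda>y. \<Sum>i\<in>UNIV. axis i (f y $ i)) has_derivative (\<lambda>h. \<Sum>i\<in>UNIV. axis i (D i h))) (at x)"
    by (intro has_derivative_sum bounded_linear.has_derivative[OF bl] assms)
  then show ?thesis by (simp add: *[symmetric])
qed

text \<open>A real-linear map that commutes with complex scalars is given by a complex matrix, so
  the componentwise notion agrees with the one in \<open>holo_on\<close>. Closure under arithmetic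
  is proved for scalar functions and transferred through this equivalence.\<close>

lemma cdiff_iff: "cdiff f x \<longleftrightarrow> (\<exists>A. (f has_derivative (\<lambda>h. A *v h)) (at x))"
proof
  assume "cdiff f x"
  then obtain D where D: "\<And>i. ((\<lambda>y. f y $ i) has_derivative D i) (at x)" "\<And>i c h. D i (c *s h) = c * D i h"
    unfolding cdiff_def cdf_def by metis
  define E where "E = (\<lambda>h. \<chi> i. D i h)"
  have E: "(f has_derivative E) (at x)" unfolding E_def by (rule has_derivative_vec[OF D(1)])
  have "E = (\<lambda>h. matrix E *v h)"
    using E by (intro clinear_matrix) (auto simp: has_derivative_linear E_def D(2) vec_eq_iff)
  then show "\<exists>A. (f has_derivative (\<lambda>h. A *v h)) (at x)" using E by metis
next
  assume "\<exists>A. (f has_derivative (\<lambda>h. A *v h)) (at x)"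
  then obtain A where A: "(f has_derivative (\<lambda>h. A *v h)) (at x)" by blast
  show "cdiff f x" unfolding cdiff_def cdf_def
  proof
    fix i
    show "\<exists>D. ((\<lambda>y. f y $ i) has_derivative D) (at x) \<and> (\<forall>c h. D (c *s h) = c * D h)"
      by (intro exI[of _ "\<lambda>h. (A *v h) $ i"] conjI bounded_linear.has_derivative[OF bounded_linear_vec_nth A])
        (simp add: matrix_vector_scale)
  qed
qed

lemma holo_on_iff: "holo_on f S \<longleftrightarrow> open S \<and> (\<forall>x\<in>S. cdiff f x)"
  unfolding holo_on_def cdiff_iff ..

lemma cdiff_has_derivative:
  assumes "cdiff f x" shows "(f has_derivative (\<lambda>h. jac f x *v h)) (at x)"
proof -
  obtain A where A: "(f has_derivative (\<lambda>h. A *v h)) (at x)" using assms cdiff_iff by blast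
  then have "frechet_derivative f (at x) = (\<lambda>h. A *v h)" by (metis frechet_derivative_at)
  then have "jac f x = A" unfolding jac_def by (simp add: matrix_of_matrix_vector_mul)
  then show ?thesis using A by simp
qed

lemma cdiff_frechet: "cdiff f x \<Longrightarrow> frechet_derivative f (at x) = (\<lambda>h. jac f x *v h)"
  using cdiff_has_derivative frechet_derivative_at by metis

lemma jac_unique: "(f has_derivative (\<lambda>h. A *v h)) (at x) \<Longrightarrow> jac f x = A"
  unfolding jac_def by (metis frechet_derivative_at matrix_of_matrix_vector_mul)

lemma cdiff_isCont: "cdiff f x \<Longrightarrow> isCont f x"
  using cdiff_has_derivative has_derivative_continuous by blast

lemma cdf_comp:
  assumes "cdf g (f x)" "cdiff f x" shows "cdf (\<lambda>y. g (f y)) x"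
proof -
  obtain D where D: "(g has_derivative D) (at (f x))" "\<And>c h. D (c *s h) = c * D h"
    using assms(1) unfolding cdf_def by blast
  have "((\<lambda>y. g (f y)) has_derivative (\<lambda>h. D (jac f x *v h))) (at x)"
    using has_derivative_compose[OF cdiff_has_derivative[OF assms(2)] D(1)] .
  moreover have "D (jac f x *v (c *s h)) = c * D (jac f x *v h)" for c h
    by (simp add: matrix_vector_scale D(2))
  ultimately show ?thesis unfolding cdf_def by blast
qed

lemma jac_comp:
  assumes "cdiff g (f x)" "cdiff f x" shows "jac (\<lambda>y. g (f y)) x = jac g (f x) ** jac f x"
  by (rule jac_unique)
    (use has_derivative_compose[OF cdiff_has_derivative[OF assms(2)] cdiff_has_derivative[OF assms(1)]]
      in \<open>simp add: matrix_vector_mul_assoc\<close>)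

lemma cdiff_cong_open:
  assumes "open S" "x \<in> S" "\<And>y. y \<in> S \<Longrightarrow> f y = g y" shows "cdiff f x \<longleftrightarrow> cdiff g x"
  unfolding cdiff_def using cdf_cong_open[OF assms(1,2)] assms(3) by (metis (no_types, lifting))

lemma jac_cong_open:
  assumes "open S" "x \<in> S" "\<And>y. y \<in> S \<Longrightarrow> f y = g y" shows "jac f x = jac g x"
proof -
  have "(f has_derivative D) (at x) \<longleftrightarrow> (g has_derivative D) (at x)" for D
    using has_derivative_transform_within_open[OF _ assms(1,2)] assms(3) by metis
  then show ?thesis unfolding jac_def frechet_derivative_def by simp
qed

lemma jac_id: "jac (\<lambda>x. x) x = mat 1"
  by (rule jac_unique) (simp add: has_derivative_ident)

text \<open>Passes from \<open>complex^1\<close> to functions of one complex variable, where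
  Cauchy's estimate and Liouville's theorem are available.\<close>

lemma cdf_vec_1:
  assumes "cdf g (vec t :: complex^1)"
  shows "(\<lambda>z. g (vec z)) field_differentiable at t"
proof -
  obtain D where D: "(g has_derivative D) (at (vec t))" "\<And>c h. D (c *s h) = c * D h"
    using assms unfolding cdf_def by blast
  have bl: "bounded_linear (vec :: complex \<Rightarrow> complex^1)"
    by (rule bounded_linear_intro[where K=1]) (auto simp: vec_eq_iff norm_vec_def L2_set_def UNIV_1)
  have "((\<lambda>z. g (vec z)) has_derivative (\<lambda>h. D (vec h))) (at t)"
    using has_derivative_compose[OF bounded_linear_imp_has_derivative[OF bl] D(1)] .
  moreover have "D (vec h) = D (vec 1) * h" for h
  proof -
    have "vec h = h *s (vec 1 :: complex^1)" by (simp add: vec_eq_iff)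
    then show ?thesis by (metis D(2) mult.commute)
  qed
  ultimately show ?thesis
    unfolding field_differentiable_def has_field_derivative_def by (intro exI[of _ "D (vec 1)"]) (auto simp: )
qed

lemma field_differentiable_cdf:
  fixes x :: "complex^'n"
  assumes "g field_differentiable at (h x)" "cdf h x" shows "cdf (\<lambda>y. g (h y)) x"
proof -
  obtain d where d: "(g has_derivative (*) d) (at (h x))"
    using assms(1) unfolding field_differentiable_def has_field_derivative_def by blast
  obtain D where D: "(h has_derivative D) (at x)" "\<And>c h. D (c *s h) = c * D h"
    using assms(2) unfolding cdf_def by blast
  show ?thesis unfolding cdf_def
    by (intro exI[of _ "\<lambda>h. d * D h"]) (use has_derivative_compose[OF D(1) d] D(2) in auto)
qed

text \<open>A left inverse \<open>B\<close> of the Jacobian turns \<open>F\<close> into a map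
  \<open>u\<close> whose derivative at \<open>h x\<close> is the identity. The increments of
  \<open>h\<close> and of \<open>u\<close> composed with \<open>h\<close> therefore agree to first
  order; continuity of \<open>h\<close> keeps \<open>h y\<close> in the range of this
  approximation.\<close>

lemma cdiff_lift:
  fixes F :: "complex^'k \<Rightarrow> complex^'m" and h :: "complex^'n \<Rightarrow> complex^'k"
  assumes F: "cdiff F (h x)" and inj: "inj (\<lambda>v. jac F (h x) *v v)"
    and h: "isCont h x" and Fh: "cdiff (\<lambda>y. F (h y)) x"
  shows "cdiff h x"
proof -
  obtain B where B: "B ** jac F (h x) = mat 1"
    using inj matrix_left_invertible_injective by blast
  define u where "u = (\<lambda>y. B *v F y)"
  have blB: "bounded_linear (\<lambda>y. B *v y)"
    using linear_conv_bounded_linear matrix_vector_mul_linear by blast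
  have u: "(u has_derivative (\<lambda>k. k)) (at (h x))"
    unfolding u_def
    using bounded_linear.has_derivative[OF blB cdiff_has_derivative[OF F]] B
    by (simp add: matrix_vector_mul_assoc)
  define A where "A = B ** jac (\<lambda>y. F (h y)) x"
  define v where "v = (\<lambda>y. u (h y))"
  have v: "(v has_derivative (\<lambda>k. A *v k)) (at x)"
    unfolding v_def u_def A_def
    using bounded_linear.has_derivative[OF blB cdiff_has_derivative[OF Fh]]
    by (simp add: matrix_vector_mul_assoc)
  have blA: "bounded_linear (\<lambda>y. A *v y)"
    using linear_conv_bounded_linear matrix_vector_mul_linear by blast
  obtain K where K: "K > 0" "\<And>k. norm (A *v k) \<le> norm k * K" using bounded_linear.pos_bounded[OF blA] by blast
  have "(h has_derivative (\<lambda>k. A *v k)) (at x)"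
    unfolding has_derivative_at_alt
  proof (intro conjI blA allI impI)
    fix e :: real assume e: "e > 0"
    \<comment> \<open>The bound 1/2 lets \<open>norm w\<close> be absorbed into the left-hand side,
      which gives \<open>norm w \<le> 2 * (K+1) * n\<close>; the other bound turns this into an
      error of at most \<open>e / 2\<close> times \<open>n\<close>.\<close>
    define e1 where "e1 = min (1/2) (e / (4 * (K + 1)))"
    have e1: "e1 > 0" "e1 \<le> 1/2" "e1 * (4 * (K+1)) \<le> e"
      using e K(1) unfolding e1_def
      by (auto simp: min_def divide_simps)
    obtain d1 where d1: "d1 > 0" "\<And>y. norm (y - h x) < d1 \<Longrightarrow> norm (u y - u (h x) - (y - h x)) \<le> e1 * norm (y - h x)"
      using u e1(1) unfolding has_derivative_at_alt by blast
    obtain d2 where d2: "d2 > 0" "\<And>y. norm (y - x) < d2 \<Longrightarrow> norm (h y - h x) < d1"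
      using h d1(1) unfolding continuous_at_eps_delta dist_norm by blast
    \<comment> \<open>The bound 1 yields a Lipschitz estimate for \<open>v\<close> with constant
      \<open>K + 1\<close>; the bound \<open>e/2\<close> supplies the second half of the
      error.\<close>
    define e2 where "e2 = min 1 (e/2)"
    have e2: "e2 > 0" "e2 \<le> 1" "e2 \<le> e/2" using e unfolding e2_def by auto
    obtain d3 where d3: "d3 > 0" "\<And>y. norm (y - x) < d3 \<Longrightarrow> norm (v y - v x - (A *v (y - x))) \<le> e2 * norm (y - x)"
      using v e2(1) unfolding has_derivative_at_alt by blast
    show "\<exists>d>0. \<forall>y. norm (y - x) < d \<longrightarrow> norm (h y - h x - A *v (y - x)) \<le> e * norm (y - x)"
    proof (intro exI[of _ "min d2 d3"] conjI allI impI)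
      show "min d2 d3 > 0" using d2 d3 by simp
      fix y assume y: "norm (y - x) < min d2 d3"
      define w where "w = h y - h x"
      define n where "n = norm (y - x)"
      have 1: "norm (v y - v x - w) \<le> e1 * norm w"
        using d1(2)[of "h y"] d2(2)[of y] y unfolding v_def w_def by simp
      have 2: "norm (v y - v x - A *v (y - x)) \<le> e2 * n" using d3(2)[of y] y n_def by simp
      have 3: "norm (v y - v x) \<le> (K + 1) * n"
      proof -
        have "norm (v y - v x) \<le> norm (v y - v x - A *v (y - x)) + norm (A *v (y - x))"
          by norm
        also have "\<dots> \<le> 1 * n + n * K"
          using 2 K(2)[of "y - x"] e2(2) mult_right_mono[OF e2(2), of n] unfolding n_def by auto
        finally show ?thesis by (simp add: algebra_simps)
      qed
      have "norm w \<le> norm (v y - v x) + norm (v y - v x - w)" by norm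
      also have "\<dots> \<le> (K+1) * n + 1/2 * norm w"
        using 1 3 mult_right_mono[OF e1(2), of "norm w"] by auto
      finally have 4: "norm w \<le> 2 * (K+1) * n" by (simp add: algebra_simps)
      have "norm (w - A *v (y - x)) \<le> norm (v y - v x - w) + norm (v y - v x - A *v (y - x))" by norm
      also have "\<dots> \<le> e1 * (2 * (K+1) * n) + (e/2) * n"
      proof -
        have "e1 * norm w \<le> e1 * (2 * (K+1) * n)" using mult_left_mono[OF 4, of e1] e1(1) by simp
        moreover have "e2 * n \<le> (e/2) * n" using mult_right_mono[OF e2(3), of n] n_def by simp
        ultimately show ?thesis using 1 2 by linarith
      qed
      also have "\<dots> \<le> e * n"
      proof -
        have "e1 * (4 * (K+1)) * n \<le> e * n" using e1(3) n_def by (intro mult_right_mono) auto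
        then show ?thesis by (simp add: algebra_simps)
      qed
      finally show "norm (h y - h x - A *v (y - x)) \<le> e * norm (y - x)" unfolding w_def n_def .
    qed
  qed
  then show ?thesis using cdiff_iff by blast
qed

lemma norm_vector_scale: "norm (c *s v) = norm c * norm v" for v :: "complex^'n"
  by (simp add: norm_vec_def norm_mult L2_set_right_distrib)

lemma cdf_curve:
  assumes "cdf g (\<gamma> t)" "\<And>i. (\<lambda>s. \<gamma> s $ i) field_differentiable at t"
  shows "(\<lambda>s. g (\<gamma> s)) field_differentiable at t"
proof -
  have "cdiff (\<lambda>x::complex^1. \<gamma> (x $ 1)) (vec t)"
    unfolding cdiff_def
  proof
    fix i show "cdf (\<lambda>x::complex^1. \<gamma> (x $ 1) $ i) (vec t)"
      using field_differentiable_cdf[of "\<lambda>s. \<gamma> s $ i" "\<lambda>x::complex^1. x $ 1" "vec t"] assms(2) by simp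
  qed
  then have "cdf (\<lambda>x::complex^1. g (\<gamma> (x $ 1))) (vec t)" 
    using assms(1) cdf_comp[of g "\<lambda>x::complex^1. \<gamma> (x $ 1)" "vec t"] by simp
  from cdf_vec_1[OF this] show ?thesis by simp
qed

text \<open>The derivative is the uniform limit of difference quotients, by Cauchy's estimate for the
  second derivative in the direction \<open>v\<close>.\<close>

lemma deriv_along_curve:
  fixes g :: "complex^'n \<Rightarrow> complex"
  assumes S: "open S" "\<And>y. y \<in> S \<Longrightarrow> cdf g y" and T: "open T" "t0 \<in> T" "\<And>t. t \<in> T \<Longrightarrow> \<gamma> t \<in> S"
    and hol: "\<And>i. (\<lambda>t. \<gamma> t $ i) holomorphic_on T"
  shows "(\<lambda>t. frechet_derivative g (at (\<gamma> t)) v) field_differentiable (at t0)"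
proof -
  define D where "D = (\<lambda>t. frechet_derivative g (at (\<gamma> t)) v)"
  have contg: "continuous_on S g" using S(2) cdf_isCont by (blast intro: continuous_at_imp_continuous_on)
  have "continuous_on T (\<lambda>t. \<chi> i. \<gamma> t $ i)"
    using hol by (intro continuous_on_vec_lambda holomorphic_on_imp_continuous_on)
  then have cont\<gamma>: "continuous_on T \<gamma>" by (simp add: vec_lambda_eta)
  obtain e where e: "e > 0" "cball (\<gamma> t0) e \<subseteq> S" using S(1) T(2,3) open_contains_cball by blast
  obtain B where B: "\<And>y. y \<in> cball (\<gamma> t0) e \<Longrightarrow> norm (g y) \<le> B"
  proof -
    have "compact (g ` cball (\<gamma> t0) e)" by (intro compact_continuous_image continuous_on_subset[OF contg e(2)]) auto
    then have "bounded (g ` cball (\<gamma> t0) e)" by (rule compact_imp_bounded)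
    then obtain B where "\<forall>z\<in>g ` cball (\<gamma> t0) e. norm z \<le> B" unfolding bounded_iff by blast
    then show ?thesis by (intro that[of B]) blast
  qed
  have "isCont \<gamma> t0" using cont\<gamma> T(1,2) by (simp add: continuous_on_eq_continuous_at)
  then obtain d1 where d1: "d1 > 0" "\<And>t. dist t t0 < d1 \<Longrightarrow> dist (\<gamma> t) (\<gamma> t0) < e/2"
    using e(1) unfolding continuous_at_eps_delta by (meson half_gt_zero)
  obtain d2 where d2: "d2 > 0" "ball t0 d2 \<subseteq> T" using T(1,2) open_contains_ball by blast
  define d where "d = min d1 d2"
  have d: "d > 0" "ball t0 d \<subseteq> T" "\<And>t. t \<in> ball t0 d \<Longrightarrow> dist (\<gamma> t) (\<gamma> t0) < e/2"
    using d1 d2 unfolding d_def by (auto simp: dist_commute)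
  \<comment> \<open>Half of the radius \<open>e\<close> is reserved for the motion of
    \<open>\<gamma> t\<close>, the other half for the displacement along \<open>v\<close>; the
    summand 1 covers \<open>v = 0\<close>.\<close>
  define \<rho> where "\<rho> = e / (2 * (norm v + 1))"
  have nv: "norm v + 1 > 0" by (smt (verit) norm_ge_zero)
  have \<rho>: "\<rho> > 0" "\<rho> * norm v < e/2"
    using e(1) nv unfolding \<rho>_def by (auto simp: divide_simps)
  have inb: "\<gamma> t + w *s v \<in> cball (\<gamma> t0) e" if "t \<in> ball t0 d" "norm w \<le> \<rho>" for t w
  proof -
    have "norm (w *s v) \<le> \<rho> * norm v" using that(2) by (simp add: norm_vector_scale mult_right_mono)
    moreover have "norm (\<gamma> t - \<gamma> t0) < e/2" using d(3)[OF that(1)] by (simp add: dist_norm)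
    ultimately have "norm (\<gamma> t + w *s v - \<gamma> t0) \<le> e"
      using norm_triangle_ineq[of "\<gamma> t - \<gamma> t0" "w *s v"] \<rho>(2) by (simp add: algebra_simps)
    then show ?thesis by (simp add: dist_norm norm_minus_commute)
  qed
  have cd: "cdf g (\<gamma> t + w *s v)" if "t \<in> ball t0 d" "norm w \<le> \<rho>" for t w
    using inb[OF that] e(2) S(2) by blast
  \<comment> \<open>The directional derivative at \<open>\<gamma> t\<close> is the derivative of
    \<open>G t\<close> at 0, and \<open>G\<close> is holomorphic in each of its two
    variables.\<close>
  define G where "G = (\<lambda>t w. g (\<gamma> t + w *s v))"
  have fdt: "(\<lambda>t. \<gamma> t $ i) field_differentiable at t" if "t \<in> ball t0 d" for i t
    using hol that d(2) T(1) holomorphic_on_imp_differentiable_at by blast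
  have Gt: "(\<lambda>t. G t w) field_differentiable at t" if "t \<in> ball t0 d" "norm w \<le> \<rho>" for t w
  proof -
    have "(\<lambda>s. (\<gamma> s + w *s v) $ i) field_differentiable at t" for i
      using fdt[OF that(1), of i] by (simp add: field_differentiable_add)
    then show ?thesis unfolding G_def
      using cdf_curve[of g "\<lambda>t. \<gamma> t + w *s v" t] cd[OF that] by blast
  qed
  have Gw: "G t field_differentiable at w" if "t \<in> ball t0 d" "norm w \<le> \<rho>" for t w
  proof -
    have "(\<lambda>s. (\<gamma> t + s *s v) $ i) field_differentiable at w" for i
      by (simp add: field_differentiable_add field_differentiable_mult)
    then show ?thesis unfolding G_def
      using cdf_curve[of g "\<lambda>s. \<gamma> t + s *s v" w] cd[OF that] by blast
  qed
  have GB: "norm (G t w) \<le> B" if "t \<in> ball t0 d" "norm w \<le> \<rho>" for t w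
    unfolding G_def using B inb[OF that] by blast
  have Gholo: "G t holomorphic_on cball 0 \<rho>" if "t \<in> ball t0 d" for t
    unfolding holomorphic_on_def using Gw[OF that] by (auto intro: field_differentiable_at_within)
  have D0: "(G t has_field_derivative D t) (at 0)" if t: "t \<in> ball t0 d" for t
  proof -
    obtain E where E: "(g has_derivative E) (at (\<gamma> t))" "\<And>c h. E (c *s h) = c * E h"
      using cd[OF t, of 0] \<rho>(1) unfolding cdf_def by auto
    have DE: "D t = E v" unfolding D_def using frechet_derivative_at[OF E(1)] by simp
    have "((\<lambda>w. \<gamma> t + w *s v) has_derivative (\<lambda>w. w *s v)) (at 0)"
    proof -
      have "bounded_linear (\<lambda>w. w *s v)"
        by (intro linear_conv_bounded_linear[THEN iffD1] linearI) (auto simp: vec_eq_iff algebra_simps)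
      from bounded_linear_imp_has_derivative[OF this, of "at 0"] show ?thesis
        using has_derivative_add[OF has_derivative_const[of "\<gamma> t"]] by fastforce
    qed
    from has_derivative_compose[OF this, of g E] E(1)
    have "(G t has_derivative (\<lambda>w. E (w *s v))) (at 0)" unfolding G_def by simp
    then show ?thesis unfolding has_field_derivative_def DE by (simp add: E(2) mult_commute_abs)
  qed
  \<comment> \<open>Cauchy's estimate on discs of radius \<open>\<rho>/2\<close> around points of
    the smaller disc, which stay inside radius \<open>\<rho>\<close>. The bound is the same for all
    \<open>t\<close>.\<close>
  define M where "M = fact 2 * B / (\<rho>/2)^2"
  have M: "norm ((deriv ^^ 2) (G t) w) \<le> M" if "t \<in> ball t0 d" "norm w \<le> \<rho>/2" for t w
    unfolding M_def
  proof (rule Cauchy_inequality)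
    have sub: "cball w (\<rho>/2) \<subseteq> cball 0 \<rho>"
    proof
      fix x assume "x \<in> cball w (\<rho>/2)"
      then have "norm (x - w) \<le> \<rho>/2" by (simp add: dist_norm norm_minus_commute)
      then show "x \<in> cball 0 \<rho>" using that(2) norm_triangle_ineq[of "x - w" w] by simp
    qed
    show "G t holomorphic_on ball w (\<rho>/2)" using Gholo[OF that(1)] sub holomorphic_on_subset ball_subset_cball by blast
    show "continuous_on (cball w (\<rho>/2)) (G t)"
      using Gholo[OF that(1)] sub holomorphic_on_subset holomorphic_on_imp_continuous_on by blast
    show "0 < \<rho>/2" using \<rho> by simp
    fix x assume "cmod (w - x) = \<rho>/2"
    then have "x \<in> cball w (\<rho>/2)" by (simp add: dist_norm)
    then show "cmod (G t x) \<le> B" using GB[OF that(1), of x] sub by auto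
  qed
  have T2: "norm (G t w - (G t 0 + D t * w)) \<le> M * norm w ^ 2" if "t \<in> ball t0 d" "norm w \<le> \<rho>/2" for t w
  proof -
    have "norm ((\<lambda>i. (deriv ^^ i) (G t)) 0 w - (\<Sum>i\<le>1. (\<lambda>i. (deriv ^^ i) (G t)) i 0 * (w - 0)^i / fact i)) \<le> M * norm (w - 0)^(Suc 1) / fact 1"
    proof (rule field_Taylor[where S="cball 0 (\<rho>/2)"])
      fix x and i :: nat assume x: "x \<in> cball (0::complex) (\<rho>/2)" "i \<le> 1"
      have "(deriv ^^ i) (G t) holomorphic_on ball 0 \<rho>"
        using Gholo[OF that(1)] by (intro holomorphic_higher_deriv) (auto intro: holomorphic_on_subset)
      moreover have "x \<in> ball 0 \<rho>" using x(1) \<rho>(1) by auto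
      ultimately have "((deriv ^^ i) (G t) has_field_derivative deriv ((deriv ^^ i) (G t)) x) (at x)"
        using holomorphic_derivI open_ball by blast
      then show "((deriv ^^ i) (G t) has_field_derivative (deriv ^^ (Suc i)) (G t) x) (at x within cball 0 (\<rho>/2))"
        by (auto intro: has_field_derivative_at_within)
    next
      fix x assume "x \<in> cball (0::complex) (\<rho>/2)"
      then show "norm ((deriv ^^ (Suc 1)) (G t) x) \<le> M" using M[OF that(1), of x] by (simp add: numeral_2_eq_2)
    qed (use that \<rho> in auto)
    moreover have "deriv (G t) 0 = D t" using D0[OF that(1)] by (rule DERIV_imp_deriv)
    ultimately show ?thesis by (simp add: numeral_2_eq_2)
  qed
  \<comment> \<open>Step lengths tending to 0. The difference quotients with these steps are
    holomorphic in \<open>t\<close>, and by the Taylor estimate \<open>T2\<close> their distance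
    from \<open>D\<close> is at most \<open>M\<close> times the step, uniformly in
    \<open>t\<close>.\<close>
  define w where "w = (\<lambda>n. of_real (\<rho> / (2 * real (Suc n))) :: complex)"
  have w: "w n \<noteq> 0" "norm (w n) \<le> \<rho>/2" for n
    unfolding w_def using \<rho>(1) by (auto simp: norm_divide norm_mult divide_simps simp del: of_nat_Suc)
  have wlim: "(\<lambda>n. M * norm (w n)) \<longlonglongrightarrow> 0"
  proof -
    have "(\<lambda>n. M * (\<rho>/2) * inverse (real (Suc n))) \<longlonglongrightarrow> M * (\<rho>/2) * 0"
      by (intro tendsto_mult tendsto_const LIMSEQ_inverse_real_of_nat)
    then show ?thesis unfolding w_def using \<rho>(1) by (simp add: norm_divide norm_mult field_simps del: of_nat_Suc)
  qed
  define f where "f = (\<lambda>n t. (G t (w n) - G t 0) / w n)"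
  have fD: "norm (f n t - D t) \<le> M * norm (w n)" if "t \<in> ball t0 d" for n t
  proof -
    have "f n t - D t = (G t (w n) - (G t 0 + D t * w n)) / w n"
      unfolding f_def using w(1)[of n] by (simp add: field_simps)
    then have "norm (f n t - D t) = norm (G t (w n) - (G t 0 + D t * w n)) / norm (w n)" by (simp add: norm_divide)
    also have "\<dots> \<le> M * norm (w n) ^ 2 / norm (w n)" using T2[OF that w(2)] by (intro divide_right_mono) auto
    finally show ?thesis using w(1)[of n] by (simp add: power2_eq_square)
  qed
  have "D holomorphic_on ball t0 d"
  proof (rule holomorphic_uniform_sequence[OF open_ball])
    fix n show "f n holomorphic_on ball t0 d"
    proof -
      have "(\<lambda>t. G t c) holomorphic_on ball t0 d" if "norm c \<le> \<rho>" for c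
        unfolding holomorphic_on_def using Gt[OF _ that] field_differentiable_at_within by blast
      moreover have "norm (w n) \<le> \<rho>" "norm (0::complex) \<le> \<rho>" using w(2)[of n] \<rho>(1) by auto
      ultimately have "(\<lambda>t. G t (w n)) holomorphic_on ball t0 d" "(\<lambda>t. G t 0) holomorphic_on ball t0 d" by blast+
      then show ?thesis unfolding f_def by (intro holomorphic_intros) (use w(1) in auto)
    qed
  next
    fix x' assume "x' \<in> ball t0 d"
    then obtain k where k: "k > 0" "cball x' k \<subseteq> ball t0 d" using open_contains_cball open_ball by blast
    have "uniform_limit (cball x' k) f D sequentially"
    proof (rule uniform_limitI)
      fix \<epsilon> :: real assume "\<epsilon> > 0"
      then have "\<forall>\<^sub>F n in sequentially. M * norm (w n) < \<epsilon>" using wlim order_tendstoD(2) by blast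
      then show "\<forall>\<^sub>F n in sequentially. \<forall>x\<in>cball x' k. dist (f n x) (D x) < \<epsilon>"
      proof eventually_elim
        case (elim n)
        show ?case
        proof
          fix x assume "x \<in> cball x' k"
          then have "x \<in> ball t0 d" using k(2) by blast
          from fD[OF this, of n] show "dist (f n x) (D x) < \<epsilon>" using elim unfolding dist_norm by linarith
        qed
      qed
    qed
    then show "\<exists>k>0. cball x' k \<subseteq> ball t0 d \<and> uniform_limit (cball x' k) f D sequentially" using k by blast
  qed
  then show ?thesis unfolding D_def[symmetric] using d(1) holomorphic_on_imp_differentiable_at open_ball
    by (metis centre_in_ball)
qed

section \<open>Atlases\<close>

text \<open>The conditions on charts alone, so that the projective line, the total space of
  \<open>O(2)\<close> and open restrictions can be handled without verifying separation and
  countability axioms for them.\<close>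

definition atlas_ok :: "('a, 'n::finite) atlas \<Rightarrow> bool" where
  "atlas_ok M \<longleftrightarrow> (\<forall>(U, c)\<in>M. inj_on c U \<and> open (c ` U)) \<and>
     (\<forall>(U, c)\<in>M. \<forall>(V, d)\<in>M. holo_on (d \<circ> inv_into U c) (c ` (U \<inter> V)))"

lemma complex_manifold_atlas_ok: "complex_manifold M \<Longrightarrow> atlas_ok M"
  unfolding complex_manifold_def atlas_ok_def by blast

context
  fixes M :: "('a, 'n::finite) atlas"
  assumes M: "atlas_ok M"
begin

lemma chart_inj: "(U, c) \<in> M \<Longrightarrow> inj_on c U"
  using M unfolding atlas_ok_def by blast

lemma chart_open: "(U, c) \<in> M \<Longrightarrow> open (c ` U)"
  using M unfolding atlas_ok_def by blast

lemma chart_inv: "(U, c) \<in> M \<Longrightarrow> p \<in> U \<Longrightarrow> inv_into U c (c p) = p"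
  using chart_inj inv_into_f_f by metis

lemma chart_holo: "(U, c) \<in> M \<Longrightarrow> (V, d) \<in> M \<Longrightarrow> holo_on (d \<circ> inv_into U c) (c ` (U \<inter> V))"
  using M unfolding atlas_ok_def by fast

lemma chart_overlap_open: "(U, c) \<in> M \<Longrightarrow> (V, d) \<in> M \<Longrightarrow> open (c ` (U \<inter> V))"
  using chart_holo holo_on_iff by blast

lemma chart_cdiff:
  "(U, c) \<in> M \<Longrightarrow> (V, d) \<in> M \<Longrightarrow> p \<in> U \<Longrightarrow> p \<in> V \<Longrightarrow> cdiff (\<lambda>x. d (inv_into U c x)) (c p)"
  using chart_holo unfolding holo_on_iff o_def by blast

lemma openin_mtop_iff: "openin (mtop M) W \<longleftrightarrow> W \<subseteq> points M \<and> (\<forall>(U, c)\<in>M. open (c ` (U \<inter> W)))"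
  by (rule openin_mtop) (use chart_inj chart_open in auto)

lemma topspace_mtop: "topspace (mtop M) = points M"
proof -
  have "openin (mtop M) (points M)"
    unfolding openin_mtop_iff
  proof safe
    fix U c assume C: "(U, c) \<in> M"
    then have "U \<inter> points M = U" unfolding points_def by force
    then show "open (c ` (U \<inter> points M))" using chart_open C by simp
  qed
  then show ?thesis using openin_subset openin_mtop_iff openin_topspace by (metis subset_antisym)
qed

lemma chart_subset: "(U, c) \<in> M \<Longrightarrow> U \<subseteq> points M"
  unfolding points_def by force

lemma chart_point: "p \<in> points M \<Longrightarrow> \<exists>U c. (U, c) \<in> M \<and> p \<in> U"
  unfolding points_def by force

lemma openin_chart_preimage:
  assumes C: "(U, c) \<in> M" and S: "open S"
  shows "openin (mtop M) {p \<in> U. c p \<in> S}"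
  unfolding openin_mtop_iff
proof safe
  fix x assume "x \<in> U" then show "x \<in> points M" using chart_subset C by blast
next
  fix V d assume D: "(V, d) \<in> M"
  have "d ` (V \<inter> {p \<in> U. c p \<in> S}) = d ` (V \<inter> U) \<inter> (c \<circ> inv_into V d) -` S"
    using chart_inv[OF D] by force
  moreover have "continuous_on (d ` (V \<inter> U)) (c \<circ> inv_into V d)"
    using chart_cdiff[OF D C] cdiff_isCont unfolding o_def by (intro continuous_at_imp_continuous_on) auto
  ultimately show "open (d ` (V \<inter> {p \<in> U. c p \<in> S}))"
    using continuous_open_preimage chart_overlap_open[OF D C] S by metis
qed

lemma openin_chart: "(U, c) \<in> M \<Longrightarrow> openin (mtop M) U"
  using openin_chart_preimage[of U c UNIV] by simp

lemma openin_chart_image: "openin (mtop M) W \<Longrightarrow> (U, c) \<in> M \<Longrightarrow> open (c ` (U \<inter> W))"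
  unfolding openin_mtop_iff by blast

end

section \<open>Holomorphic functions and maps at a point\<close>

definition hol_at :: "('a, 'n::finite) atlas \<Rightarrow> ('a \<Rightarrow> complex) \<Rightarrow> 'a \<Rightarrow> bool" where
  "hol_at M g p \<longleftrightarrow> (\<forall>(U, c)\<in>M. p \<in> U \<longrightarrow> cdf (\<lambda>x. g (inv_into U c x)) (c p))"

text \<open>Only the coordinate functions are tested. Continuity is kept as a separate hypothesis;
  it makes the preimages of target charts open, so that coordinate expressions are meaningful near
  the point.\<close>

definition hmap_at :: "('a, 'n::finite) atlas \<Rightarrow> ('b, 'm::finite) atlas \<Rightarrow> ('a \<Rightarrow> 'b) \<Rightarrow> 'a \<Rightarrow> bool" where
  "hmap_at M N f p \<longleftrightarrow> (\<forall>(V, d)\<in>N. f p \<in> V \<longrightarrow> (\<forall>j. hol_at M (\<lambda>q. d (f q) $ j) p))"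

lemma hol_at_const [intro]: "hol_at M (\<lambda>_. k) p"
  unfolding hol_at_def by auto

lemma hol_at_add [intro]: "hol_at M f p \<Longrightarrow> hol_at M g p \<Longrightarrow> hol_at M (\<lambda>q. f q + g q) p"
  unfolding hol_at_def by fast

lemma hol_at_mult [intro]: "hol_at M f p \<Longrightarrow> hol_at M g p \<Longrightarrow> hol_at M (\<lambda>q. f q * g q) p"
  unfolding hol_at_def by fast

lemma hol_at_minus [intro]: "hol_at M f p \<Longrightarrow> hol_at M (\<lambda>q. - f q) p"
  unfolding hol_at_def by fast

lemma hol_at_diff [intro]: "hol_at M f p \<Longrightarrow> hol_at M g p \<Longrightarrow> hol_at M (\<lambda>q. f q - g q) p"
  unfolding hol_at_def by fast

lemma hol_at_power [intro]: "hol_at M f p \<Longrightarrow> hol_at M (\<lambda>q. f q ^ n) p"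
  unfolding hol_at_def by fast

lemma hol_at_sum [intro]: "(\<And>i. i \<in> I \<Longrightarrow> hol_at M (f i) p) \<Longrightarrow> hol_at M (\<lambda>q. \<Sum>i\<in>I. f i q) p"
  by (induction I rule: infinite_finite_induct) auto

lemma hol_at_divide [intro]:
  assumes "atlas_ok M" "hol_at M f p" "hol_at M g p" "g p \<noteq> 0" shows "hol_at M (\<lambda>q. f q / g q) p"
  using assms unfolding hol_at_def by (auto simp: chart_inv[OF assms(1)] intro!: cdf_divide)

lemma hol_at_cong:
  assumes M: "atlas_ok M" and W: "openin (mtop M) W" "p \<in> W" and eq: "\<And>q. q \<in> W \<Longrightarrow> f q = g q"
  shows "hol_at M f p \<longleftrightarrow> hol_at M g p"
proof -
  have "cdf (\<lambda>x. f (inv_into U c x)) (c p) \<longleftrightarrow> cdf (\<lambda>x. g (inv_into U c x)) (c p)" if C: "(U, c) \<in> M" "p \<in> U" for U c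
    by (rule cdf_cong_open[OF openin_chart_image[OF M W(1) C(1)]])
      (use C W(2) eq chart_inv[OF M C(1)] in auto)
  then show ?thesis unfolding hol_at_def by blast
qed

text \<open>One chart suffices, because near the point any other chart differs from it by a
  holomorphic change of coordinates.\<close>

lemma hol_atI:
  assumes M: "atlas_ok M" and C: "(U, c) \<in> M" "p \<in> U" and g: "cdf (\<lambda>x. g (inv_into U c x)) (c p)"
  shows "hol_at M g p"
  unfolding hol_at_def
proof safe
  fix V d assume D: "(V, d) \<in> M" "p \<in> V"
  have "cdf (\<lambda>y. g (inv_into U c (c (inv_into V d y)))) (d p)"
    by (rule cdf_comp[of "\<lambda>x. g (inv_into U c x)" "\<lambda>y. c (inv_into V d y)"])
      (use g chart_inv[OF M D] chart_cdiff[OF M D(1) C(1) D(2) C(2)] in auto)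
  moreover have "cdf (\<lambda>y. g (inv_into U c (c (inv_into V d y)))) (d p) \<longleftrightarrow> cdf (\<lambda>y. g (inv_into V d y)) (d p)"
    by (rule cdf_cong_open[OF chart_overlap_open[OF M D(1) C(1)]])
      (use D C chart_inv[OF M D(1)] chart_inv[OF M C(1)] in auto)
  ultimately show "cdf (\<lambda>y. g (inv_into V d y)) (d p)" by simp
qed

lemma hmap_at_chart:
  assumes "hmap_at M N f p" "(U, c) \<in> M" "p \<in> U" "(V, d) \<in> N" "f p \<in> V"
  shows "cdiff (\<lambda>x. d (f (inv_into U c x))) (c p)"
  using assms unfolding hmap_at_def hol_at_def cdiff_def by fast

lemma continuous_map_openin: "continuous_map X Y f \<Longrightarrow> openin Y W \<Longrightarrow> openin X {p \<in> topspace X. f p \<in> W}"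
  unfolding continuous_map_def by blast

lemma continuous_map_chart_open:
  assumes M: "atlas_ok M" and N: "atlas_ok N" and f: "continuous_map (mtop M) (mtop N) f"
    and C: "(U, c) \<in> M" and W: "openin (mtop N) W"
  shows "open (c ` (U \<inter> f -` W))"
proof -
  have "U \<inter> {p \<in> topspace (mtop M). f p \<in> W} = U \<inter> f -` W"
    using chart_subset[OF M C] topspace_mtop[OF M] by auto
  then show ?thesis using openin_chart_image[OF M continuous_map_openin[OF f W] C] by simp
qed

lemma openin_preimage:
  assumes M: "atlas_ok M" and f: "continuous_map (mtop M) (mtop N) f"
    and W: "openin (mtop M) W" and V: "openin (mtop N) V"
  shows "openin (mtop M) (W \<inter> f -` V)"
proof -
  have "W \<inter> f -` V = W \<inter> {p \<in> topspace (mtop M). f p \<in> V}" using openin_subset[OF W] by auto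
  then show ?thesis using continuous_map_openin[OF f V] W by auto
qed

lemma holomorphic_map_iff:
  assumes M: "atlas_ok M" and N: "atlas_ok N"
  shows "holomorphic_map M N f \<longleftrightarrow> continuous_map (mtop M) (mtop N) f \<and> (\<forall>p\<in>points M. hmap_at M N f p)"
proof
  assume h: "holomorphic_map M N f"
  show "continuous_map (mtop M) (mtop N) f \<and> (\<forall>p\<in>points M. hmap_at M N f p)"
  proof (intro conjI ballI)
    show "continuous_map (mtop M) (mtop N) f" using h unfolding holomorphic_map_def by blast
    fix p assume "p \<in> points M"
    show "hmap_at M N f p" unfolding hmap_at_def hol_at_def
    proof safe
      fix V d j U c assume *: "(V, d) \<in> N" "f p \<in> V" "(U, c) \<in> M" "p \<in> U"
      then have "holo_on (d \<circ> f \<circ> inv_into U c) (c ` (U \<inter> f -` V))" using h unfolding holomorphic_map_def by fast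
      then have "cdiff (d \<circ> f \<circ> inv_into U c) (c p)" using * unfolding holo_on_iff by blast
      then show "cdf (\<lambda>x. d (f (inv_into U c x)) $ j) (c p)" unfolding cdiff_def o_def by blast
    qed
  qed
next
  assume h: "continuous_map (mtop M) (mtop N) f \<and> (\<forall>p\<in>points M. hmap_at M N f p)"
  show "holomorphic_map M N f" unfolding holomorphic_map_def
  proof (intro conjI)
    show "continuous_map (mtop M) (mtop N) f" using h by blast
    show "\<forall>(U, c)\<in>M. \<forall>(V, d)\<in>N. holo_on (d \<circ> f \<circ> inv_into U c) (c ` (U \<inter> f -` V))"
    proof safe
      fix U c V d assume *: "(U, c) \<in> M" "(V, d) \<in> N"
      have "cdiff (d \<circ> f \<circ> inv_into U c) (c p)" if "p \<in> U" "f p \<in> V" for p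
        using hmap_at_chart[of M N f p U c V d] h * that chart_subset[OF M *(1)] unfolding o_def by blast
      then show "holo_on (d \<circ> f \<circ> inv_into U c) (c ` (U \<inter> f -` V))"
        unfolding holo_on_iff using continuous_map_chart_open[OF M N _ *(1) openin_chart[OF N *(2)]] h by auto
    qed
  qed
qed

lemma hol_at_comp:
  assumes M: "atlas_ok M" and N: "atlas_ok N" and f: "continuous_map (mtop M) (mtop N) f" "hmap_at M N f p"
    and p: "p \<in> points M" and g: "hol_at N g (f p)"
  shows "hol_at M (\<lambda>q. g (f q)) p"
proof -
  obtain U c where C: "(U, c) \<in> M" "p \<in> U" using chart_point[OF M p] by blast
  have "f p \<in> points N" using f(1) p topspace_mtop[OF M] topspace_mtop[OF N] unfolding continuous_map_def by auto
  then obtain V d where D: "(V, d) \<in> N" "f p \<in> V" using chart_point[OF N] by blast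
  have "cdf (\<lambda>x. g (inv_into V d (d (f (inv_into U c x))))) (c p)"
    using hmap_at_chart[OF f(2) C D] g D chart_inv[OF M C]
    by (intro cdf_comp[of "\<lambda>x. g (inv_into V d x)" "\<lambda>x. d (f (inv_into U c x))"]) (auto simp: hol_at_def)
  moreover have "cdf (\<lambda>x. g (inv_into V d (d (f (inv_into U c x))))) (c p) \<longleftrightarrow> cdf (\<lambda>x. g (f (inv_into U c x))) (c p)"
    by (rule cdf_cong_open[OF continuous_map_chart_open[OF M N f(1) C(1) openin_chart[OF N D(1)]]])
      (use C D chart_inv[OF M C(1)] chart_inv[OF N D(1)] in auto)
  ultimately show ?thesis using hol_atI[OF M C, of "\<lambda>q. g (f q)"] by simp
qed

lemma hmap_at_comp:
  assumes "atlas_ok M" "atlas_ok N" "continuous_map (mtop M) (mtop N) f" "hmap_at M N f p"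
    "p \<in> points M" "hmap_at N N2 g (f p)"
  shows "hmap_at M N2 (\<lambda>q. g (f q)) p"
  unfolding hmap_at_def
proof (intro ballI, clarify)
  fix W e j assume "(W, e) \<in> N2" "g (f p) \<in> W"
  then have "hol_at N (\<lambda>y. e (g y) $ j) (f p)" using assms(6) unfolding hmap_at_def by blast
  from hol_at_comp[OF assms(1-5) this] show "hol_at M (\<lambda>q. e (g (f q)) $ j) p" .
qed

text \<open>Continuity follows from the local condition because topologies are read in charts: the
  preimage of an open set is the union, over the target charts, of its preimages under coordinate
  expressions, and these are continuous with open domains.\<close>

lemma holomorphic_mapI:
  assumes M: "atlas_ok M" and N: "atlas_ok N" and f: "f ` points M \<subseteq> points N"
    and h: "\<And>U c V d. (U, c) \<in> M \<Longrightarrow> (V, d) \<in> N \<Longrightarrow> holo_on (\<lambda>x. d (f (inv_into U c x))) (c ` (U \<inter> f -` V))"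
  shows "holomorphic_map M N f"
  unfolding holomorphic_map_def
proof (intro conjI)
  show "\<forall>(U, c)\<in>M. \<forall>(V, d)\<in>N. holo_on (d \<circ> f \<circ> inv_into U c) (c ` (U \<inter> f -` V))"
    using h unfolding o_def by blast
  show "continuous_map (mtop M) (mtop N) f" unfolding continuous_map_def topspace_mtop[OF M] topspace_mtop[OF N]
  proof (intro conjI allI impI)
    show "f \<in> points M \<rightarrow> points N" using f by auto
    fix W assume W: "openin (mtop N) W"
    show "openin (mtop M) {x \<in> points M. f x \<in> W}" unfolding openin_mtop_iff[OF M]
    proof safe
      fix U c assume C: "(U, c) \<in> M"
      have WN: "W \<subseteq> points N" using W openin_mtop_iff[OF N] by blast
      have "c ` (U \<inter> {x \<in> points M. f x \<in> W}) =
        (\<Union>(V, d)\<in>N. c ` (U \<inter> f -` V) \<inter> (\<lambda>x. d (f (inv_into U c x))) -` (d ` (V \<inter> W)))" (is "?L = ?R")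
      proof
        show "?L \<subseteq> ?R"
        proof
          fix y assume "y \<in> ?L"
          then obtain p where p: "y = c p" "p \<in> U" "f p \<in> W" by blast
          then obtain V d where "(V, d) \<in> N" "f p \<in> V" using WN chart_point[OF N] by blast
          then show "y \<in> ?R" using p chart_inv[OF M C] by force
        qed
        show "?R \<subseteq> ?L"
        proof
          fix y assume "y \<in> ?R"
          then obtain V d p where *: "(V, d) \<in> N" "y = c p" "p \<in> U" "f p \<in> V" "d (f p) \<in> d ` (V \<inter> W)"
            using chart_inv[OF M C] by auto
          then have "f p \<in> W" using chart_inj[OF N *(1)] by (auto dest: inj_onD)
          then show "y \<in> ?L" using * chart_subset[OF M C] by auto
        qed
      qed
      moreover have "open (c ` (U \<inter> f -` V) \<inter> (\<lambda>x. d (f (inv_into U c x))) -` (d ` (V \<inter> W)))" if D: "(V, d) \<in> N" for V d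
      proof (rule continuous_open_preimage)
        show "continuous_on (c ` (U \<inter> f -` V)) (\<lambda>x. d (f (inv_into U c x)))"
          using h[OF C D] cdiff_isCont unfolding holo_on_iff by (intro continuous_at_imp_continuous_on) auto
        show "open (c ` (U \<inter> f -` V))" using h[OF C D] unfolding holo_on_iff by blast
        show "open (d ` (V \<inter> W))" using openin_chart_image[OF N W D] .
      qed
      ultimately show "open (c ` (U \<inter> {x \<in> points M. f x \<in> W}))" by auto
    qed
  qed
qed

text \<open>\<open>holo_on\<close> demands an open domain, so the openness of \<open>W\<close> is
  contained in the matrix condition and is extracted here.\<close>

lemma holo_matrix_on_iff:
  assumes M: "atlas_ok M" and W: "W \<subseteq> points M"
  shows "holo_matrix_on M W G \<longleftrightarrow> openin (mtop M) W \<and> (\<forall>p\<in>W. \<forall>i j. hol_at M (\<lambda>q. G q $ i $ j) p)"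
proof
  assume h: "holo_matrix_on M W (G :: _ \<Rightarrow> complex^'c^'d)"
  then have "open (c ` (U \<inter> W))" if "(U, c) \<in> M" for U c
    using that unfolding holo_matrix_on_def holo_on_iff by blast
  moreover have "hol_at M (\<lambda>q. G q $ i $ j) p" if "p \<in> W" for p i j
    using h that unfolding hol_at_def holo_matrix_on_def holo_on_iff cdiff_def by fast
  ultimately show "openin (mtop M) W \<and> (\<forall>p\<in>W. \<forall>i j. hol_at M (\<lambda>q. G q $ i $ j) p)"
    using W openin_mtop_iff[OF M] by blast
next
  assume "openin (mtop M) W \<and> (\<forall>p\<in>W. \<forall>i j. hol_at M (\<lambda>q. G q $ i $ j) p)"
  then show "holo_matrix_on M W G"
    unfolding holo_matrix_on_def holo_on_iff cdiff_def openin_mtop_iff[OF M] hol_at_def by fast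
qed

section \<open>Tangent vectors\<close>

abbreviation crep :: "'a set \<Rightarrow> ('a \<Rightarrow> complex^'n) \<Rightarrow> ('a \<Rightarrow> 'b) \<Rightarrow> ('b \<Rightarrow> complex^'m) \<Rightarrow> complex^'n \<Rightarrow> complex^'m" where
  "crep U c f d \<equiv> (\<lambda>x. d (f (inv_into U c x)))"

lemma tangent_zero: "X \<in> tangent_space M p \<Longrightarrow> C \<notin> M \<or> p \<notin> fst C \<Longrightarrow> X C = 0"
  unfolding tangent_space_def by blast

lemma tangent_trans:
  assumes M: "atlas_ok M" and X: "X \<in> tangent_space M p"
    and C: "(U, c) \<in> M" "p \<in> U" and D: "(V, d) \<in> M" "p \<in> V"
  shows "X (V, d) = jac (\<lambda>x. d (inv_into U c x)) (c p) *v X (U, c)"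
proof -
  have "X (V, d) = frechet_derivative (d \<circ> inv_into U c) (at (c p)) (X (U, c))"
    using X C D unfolding tangent_space_def by fast
  then show ?thesis using cdiff_frechet[OF chart_cdiff[OF M C(1) D(1) C(2) D(2)]] by (simp add: o_def)
qed

lemma tangent_eqI:
  assumes M: "atlas_ok M" and X: "X \<in> tangent_space M p" and Y: "Y \<in> tangent_space M p"
    and C: "(U, c) \<in> M" "p \<in> U" and eq: "X (U, c) = Y (U, c)"
  shows "X = Y"
proof
  fix D :: "'a set \<times> ('a \<Rightarrow> complex^'b)"
  show "X D = Y D"
  proof (cases "D \<in> M \<and> p \<in> fst D")
    case True
    then show ?thesis using tangent_trans[OF M X C, of "fst D" "snd D"] tangent_trans[OF M Y C, of "fst D" "snd D"] eq by simp
  next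
    case False
    then show ?thesis using tangent_zero X Y by metis
  qed
qed

lemma tangentI:
  assumes M: "atlas_ok M" and Z: "\<And>C. C \<notin> M \<or> p \<notin> fst C \<Longrightarrow> X C = 0"
    and T: "\<And>U c V d. (U, c) \<in> M \<Longrightarrow> p \<in> U \<Longrightarrow> (V, d) \<in> M \<Longrightarrow> p \<in> V \<Longrightarrow>
       X (V, d) = jac (\<lambda>x. d (inv_into U c x)) (c p) *v X (U, c)"
  shows "X \<in> tangent_space M p"
  unfolding tangent_space_def
proof (intro CollectI conjI allI impI ballI, goal_cases)
  case (1 C) then show ?case by (rule Z)
next
  case (2 C)
  obtain U c where C: "C = (U, c)" by fastforce
  have "X (V, d) = frechet_derivative (d \<circ> inv_into U c) (at (c p)) (X (U, c))"
    if "(V, d) \<in> M" "p \<in> U \<inter> V" for V d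
    using T[of U c V d] cdiff_frechet[OF chart_cdiff[OF M, of U c V d p]] 2 C that by (simp add: o_def)
  then show ?case unfolding C by blast
qed

lemma tangent_add:
  assumes M: "atlas_ok M" and X: "X \<in> tangent_space M p" and Y: "Y \<in> tangent_space M p"
  shows "(\<lambda>D. X D + Y D) \<in> tangent_space M p"
proof (rule tangentI[OF M])
  fix U c V d assume C: "(U, c) \<in> M" "p \<in> U" and D: "(V, d) \<in> M" "p \<in> V"
  show "X (V, d) + Y (V, d) = jac (\<lambda>x. d (inv_into U c x)) (c p) *v (X (U, c) + Y (U, c))"
    unfolding tangent_trans[OF M X C D] tangent_trans[OF M Y C D] matrix_vector_right_distrib ..
qed (simp add: tangent_zero[OF X] tangent_zero[OF Y])

lemma tangent_diff:
  assumes M: "atlas_ok M" and X: "X \<in> tangent_space M p" and Y: "Y \<in> tangent_space M p"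
  shows "(\<lambda>D. X D - Y D) \<in> tangent_space M p"
proof (rule tangentI[OF M])
  fix U c V d assume C: "(U, c) \<in> M" "p \<in> U" and D: "(V, d) \<in> M" "p \<in> V"
  show "X (V, d) - Y (V, d) = jac (\<lambda>x. d (inv_into U c x)) (c p) *v (X (U, c) - Y (U, c))"
    unfolding tangent_trans[OF M X C D] tangent_trans[OF M Y C D] matrix_vector_mult_diff_distrib ..
qed (simp add: tangent_zero[OF X] tangent_zero[OF Y])

lemma jac_chart_cocycle:
  assumes M: "atlas_ok M" and C: "(U, c) \<in> M" "p \<in> U" and D: "(V, d) \<in> M" "p \<in> V"
    and g: "cdiff (\<lambda>y. g (inv_into V d y)) (d p)"
  shows "jac (\<lambda>x. g (inv_into U c x)) (c p) = jac (\<lambda>y. g (inv_into V d y)) (d p) ** jac (\<lambda>x. d (inv_into U c x)) (c p)"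
proof -
  have "jac (\<lambda>x. g (inv_into U c x)) (c p) = jac (\<lambda>x. g (inv_into V d (d (inv_into U c x)))) (c p)"
    by (rule jac_cong_open[OF chart_overlap_open[OF M C(1) D(1)]])
      (use C D chart_inv[OF M C(1)] chart_inv[OF M D(1)] in auto)
  also have "\<dots> = jac (\<lambda>y. g (inv_into V d y)) (d (inv_into U c (c p))) ** jac (\<lambda>x. d (inv_into U c x)) (c p)"
    by (rule jac_comp[of "\<lambda>y. g (inv_into V d y)" "\<lambda>x. d (inv_into U c x)"])
      (use g chart_inv[OF M C] chart_cdiff[OF M C(1) D(1) C(2) D(2)] in auto)
  finally show ?thesis using chart_inv[OF M C] by simp
qed

lemma jac_chart_self:
  assumes M: "atlas_ok M" and C: "(U, c) \<in> M" "p \<in> U"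
  shows "jac (\<lambda>x. c (inv_into U c x)) (c p) = mat 1"
proof -
  have "jac (\<lambda>x. c (inv_into U c x)) (c p) = jac (\<lambda>x. x) (c p)"
    by (rule jac_cong_open[OF chart_open[OF M C(1)]]) (use C chart_inv[OF M C(1)] in auto)
  then show ?thesis by (simp add: jac_id)
qed

text \<open>The value in one chart can be prescribed: transporting it by the Jacobians of the
  coordinate changes is consistent by the chain rule on triple overlaps.\<close>

lemma tangent_ext:
  assumes M: "atlas_ok M" and C: "(U, c) \<in> M" "p \<in> U"
  shows "\<exists>X\<in>tangent_space M p. X (U, c) = h"
proof -
  define X where "X = (\<lambda>D. if D \<in> M \<and> p \<in> fst D then jac (\<lambda>x. snd D (inv_into U c x)) (c p) *v h else 0)"
  have "X \<in> tangent_space M p"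
  proof (rule tangentI[OF M])
    fix V d V' d' assume D: "(V, d) \<in> M" "p \<in> V" "(V', d') \<in> M" "p \<in> V'"
    show "X (V', d') = jac (\<lambda>x. d' (inv_into V d x)) (d p) *v X (V, d)"
      using jac_chart_cocycle[OF M C D(1,2) chart_cdiff[OF M D(1,3,2,4)]] D
      unfolding X_def by (simp add: matrix_vector_mul_assoc)
  qed (auto simp: X_def)
  moreover have "X (U, c) = h" unfolding X_def using C jac_chart_self[OF M C] by simp
  ultimately show ?thesis by blast
qed

text \<open>The definition evaluates in a source chart picked by choice; by the chain rule any other
  chart gives the same value.\<close>

lemma differential_eq:
  assumes M: "atlas_ok M" and f: "hmap_at M N f p" and X: "X \<in> tangent_space M p"
    and C: "(U, c) \<in> M" "p \<in> U" and D: "(V, d) \<in> N" "f p \<in> V"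
  shows "differential M N f p X (V, d) = jac (crep U c f d) (c p) *v X (U, c)"
proof -
  define C' where "C' = (SOME C. C \<in> M \<and> p \<in> fst C)"
  obtain U' c' where C': "C' = (U', c')" by fastforce
  have "C' \<in> M \<and> p \<in> fst C'" unfolding C'_def by (rule someI[of _ "(U, c)"]) (use C in simp)
  then have UC: "(U', c') \<in> M" "p \<in> U'" using C' by auto
  have cd: "cdiff (crep U' c' f d) (c' p)" using hmap_at_chart[OF f UC D] .
  have "differential M N f p X (V, d) = jac (crep U' c' f d) (c' p) *v X (U', c')"
    unfolding differential_def using D C' cdiff_frechet[OF cd] by (simp add: C'_def[symmetric] Let_def o_def)
  also have "\<dots> = jac (crep U c f d) (c p) *v X (U, c)"
    using tangent_trans[OF M X C UC] jac_chart_cocycle[OF M C UC cd] by (simp add: matrix_vector_mul_assoc)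
  finally show ?thesis .
qed

lemma differential_tangent:
  assumes M: "atlas_ok M" and N: "atlas_ok N" and f: "continuous_map (mtop M) (mtop N) f" "hmap_at M N f p"
    and X: "X \<in> tangent_space M p" and p: "p \<in> points M"
  shows "differential M N f p X \<in> tangent_space N (f p)"
proof (rule tangentI[OF N])
  show "differential M N f p X C = 0" if "C \<notin> N \<or> f p \<notin> fst C" for C
    using that unfolding differential_def by auto
next
  fix V d V' d' assume D: "(V, d) \<in> N" "f p \<in> V" "(V', d') \<in> N" "f p \<in> V'"
  obtain U c where C: "(U, c) \<in> M" "p \<in> U" using chart_point[OF M p] by blast
  have "jac (crep U c f d') (c p) = jac (\<lambda>x. d' (inv_into V d (d (f (inv_into U c x))))) (c p)"
    by (rule jac_cong_open[OF continuous_map_chart_open[OF M N f(1) C(1) openin_chart[OF N D(1)]]])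
      (use C D chart_inv[OF M C(1)] chart_inv[OF N D(1)] in auto)
  also have "\<dots> = jac (\<lambda>x. d' (inv_into V d x)) (d (f (inv_into U c (c p)))) ** jac (crep U c f d) (c p)"
    by (rule jac_comp[of "\<lambda>x. d' (inv_into V d x)" "crep U c f d"])
      (use chart_inv[OF M C] chart_cdiff[OF N D(1,3,2,4)] hmap_at_chart[OF f(2) C D(1,2)] in auto)
  finally show "differential M N f p X (V', d') =
       jac (\<lambda>x. d' (inv_into V d x)) (d (f p)) *v differential M N f p X (V, d)"
    using differential_eq[OF M f(2) X C D(1,2)] differential_eq[OF M f(2) X C D(3,4)] chart_inv[OF M C]
    by (simp add: matrix_vector_mul_assoc)
qed

lemma jac_crep_comp:
  assumes M: "atlas_ok M" and N: "atlas_ok N" and f: "continuous_map (mtop M) (mtop N) f" "hmap_at M N f p"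
    and C: "(U, c) \<in> M" "p \<in> U" and D: "(V, d) \<in> N" "f p \<in> V"
    and g: "cdiff (\<lambda>x. g (inv_into V d x)) (d (f p))"
  shows "jac (\<lambda>x. g (f (inv_into U c x))) (c p) = jac (\<lambda>x. g (inv_into V d x)) (d (f p)) ** jac (crep U c f d) (c p)"
proof -
  have "jac (\<lambda>x. g (f (inv_into U c x))) (c p) = jac (\<lambda>x. g (inv_into V d (d (f (inv_into U c x))))) (c p)"
    by (rule jac_cong_open[OF continuous_map_chart_open[OF M N f(1) C(1) openin_chart[OF N D(1)]]])
      (use C D chart_inv[OF M C(1)] chart_inv[OF N D(1)] in auto)
  also have "\<dots> = jac (\<lambda>x. g (inv_into V d x)) (d (f (inv_into U c (c p)))) ** jac (crep U c f d) (c p)"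
    by (rule jac_comp[of "\<lambda>x. g (inv_into V d x)" "crep U c f d"])
      (use chart_inv[OF M C] g hmap_at_chart[OF f(2) C D(1,2)] in auto)
  finally show ?thesis using chart_inv[OF M C] by simp
qed

lemma differential_comp:
  assumes M: "atlas_ok M" and N: "atlas_ok N" and f: "continuous_map (mtop M) (mtop N) f" "hmap_at M N f p"
    and g: "hmap_at N P g (f p)"
    and X: "X \<in> tangent_space M p" and p: "p \<in> points M"
  shows "differential M P (\<lambda>q. g (f q)) p X = differential N P g (f p) (differential M N f p X)"
proof
  fix E :: "'e set \<times> ('e \<Rightarrow> complex^'f)"
  obtain W e where E: "E = (W, e)" by fastforce
  have fp: "f p \<in> points N" using f(1) p topspace_mtop[OF M] topspace_mtop[OF N] unfolding continuous_map_def by auto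
  show "differential M P (\<lambda>q. g (f q)) p X E = differential N P g (f p) (differential M N f p X) E"
  proof (cases "E \<in> P \<and> g (f p) \<in> fst E")
    case False
    then show ?thesis unfolding differential_def by auto
  next
    case True
    then have EP: "(W, e) \<in> P" "g (f p) \<in> W" using E by auto
    obtain U c where C: "(U, c) \<in> M" "p \<in> U" using chart_point[OF M p] by blast
    obtain V d where D: "(V, d) \<in> N" "f p \<in> V" using chart_point[OF N fp] by blast
    have "jac (crep U c (\<lambda>q. g (f q)) e) (c p) = jac (crep V d g e) (d (f p)) ** jac (crep U c f d) (c p)"
      by (rule jac_crep_comp[OF M N f C D, of "\<lambda>x. e (g x)"]) (use hmap_at_chart[OF g D EP] in simp)
    then show ?thesis unfolding E
      using differential_eq[OF M hmap_at_comp[OF M N f p g] X C EP] differential_eq[OF M f(2) X C D]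
        differential_eq[OF N g differential_tangent[OF M N f X p] D EP]
      by (simp add: matrix_vector_mul_assoc)
  qed
qed

section \<open>Normal bundles of curves\<close>

lemma sum_UNIV_Plus_1: "sum f (UNIV :: (1 + 1) set) = f (Inl 1) + f (Inr 1)"
proof -
  have *: "(UNIV :: (1 + 1) set) = {Inl 1, Inr 1}"
    by (auto simp: UNIV_sum UNIV_1)
  show ?thesis by (subst *) simp
qed

lemma forall_Plus_1: "(\<forall>i::1+1. P i) \<longleftrightarrow> P (Inl 1) \<and> P (Inr 1)"
  by (metis num1_eq1 sum.exhaust)

lemma mv_Plus_1: "(A *v x) $ i = A $ i $ Inl 1 * x $ Inl 1 + A $ i $ Inr 1 * x $ Inr 1"
  for A :: "complex^(1+1)^'n"
  unfolding matrix_vector_mult_def by (simp add: sum_UNIV_Plus_1)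

lemma vec_nth_1: "vec (x $ 1) = (x :: complex^1)"
  by (simp add: vec_eq_iff)

text \<open>Writes the entries as derivatives in fixed directions, the form to which
  \<open>deriv_along_curve\<close> applies.\<close>

lemma jac_nth:
  assumes "cdiff f y"
  shows "jac f y $ i $ j = frechet_derivative (\<lambda>y. f y $ i) (at y) (axis j 1)"
proof -
  have "((\<lambda>y. f y $ i) has_derivative (\<lambda>h. (jac f y *v h) $ i)) (at y)"
    by (rule bounded_linear.has_derivative[OF bounded_linear_vec_nth cdiff_has_derivative[OF assms]])
  then have "frechet_derivative (\<lambda>y. f y $ i) (at y) = (\<lambda>h. (jac f y *v h) $ i)"
    by (metis frechet_derivative_at)
  moreover have "(jac f y *v axis j 1) $ i = jac f y $ i $ j"
    by (simp add: matrix_vector_mult_def axis_def if_distrib cong: if_cong)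
  ultimately show ?thesis by simp
qed

section \<open>Linear equations with holomorphic coefficients\<close>

lemma hol_nonzero_nbhd:
  assumes M: "atlas_ok M" and W: "openin (mtop M) W" and g: "\<And>p. p \<in> W \<Longrightarrow> hol_at M g p"
    and p: "p \<in> W" "g p \<noteq> 0"
  obtains W' where "openin (mtop M) W'" "p \<in> W'" "W' \<subseteq> W" "\<And>q. q \<in> W' \<Longrightarrow> g q \<noteq> 0"
proof -
  have "p \<in> points M" using W p openin_mtop_iff[OF M] by blast
  then obtain U c where C: "(U, c) \<in> M" "p \<in> U" using chart_point[OF M] by blast
  let ?g = "\<lambda>x. g (inv_into U c x)"
  have "continuous_on (c ` (U \<inter> W)) ?g"
  proof (intro continuous_at_imp_continuous_on ballI, clarify)
    fix q assume "q \<in> U" "q \<in> W"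
    then have "cdf ?g (c q)" using g C(1) unfolding hol_at_def by fast
    then show "isCont ?g (c q)" by (rule cdf_isCont)
  qed
  then have S: "open (c ` (U \<inter> W) \<inter> ?g -` (- {0}))"
    using openin_chart_image[OF M W C(1)] by (intro continuous_open_preimage) auto
  define W' where "W' = {q \<in> U. c q \<in> c ` (U \<inter> W) \<inter> ?g -` (- {0})}"
  have "q \<in> W \<and> g q \<noteq> 0" if "q \<in> W'" for q
  proof -
    have q: "q \<in> U" "c q \<in> c ` (U \<inter> W)" "g (inv_into U c (c q)) \<noteq> 0" using that unfolding W'_def by auto
    then obtain q' where q': "q' \<in> U" "q' \<in> W" "c q = c q'" by blast
    have "q = q'" by (metis chart_inv[OF M C(1)] q(1) q'(1,3))
    then show ?thesis using q(3) q'(2) chart_inv[OF M C(1) q(1)] by metis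
  qed
  moreover have "p \<in> W'" using p C chart_inv[OF M C] unfolding W'_def by auto
  moreover have "openin (mtop M) W'" unfolding W'_def by (rule openin_chart_preimage[OF M C(1) S])
  ultimately show ?thesis using that by blast
qed

lemma hol_at_matrix_mult:
  assumes "\<And>i j. hol_at M (\<lambda>q. A q $ i $ j) p" "\<And>i j. hol_at M (\<lambda>q. B q $ i $ j) p"
  shows "hol_at M (\<lambda>q. (A q ** B q) $ i $ j) p"
  unfolding matrix_matrix_mult_def vec_lambda_beta by (intro hol_at_sum hol_at_mult assms)

text \<open>Cramer's rule: the determinant of \<open>A\<close> stays nonzero near \<open>p\<close>,
  where every entry of \<open>T\<close> is then a quotient of holomorphic functions. The regularity
  of the unknown \<open>T\<close> thus comes from the equation alone.\<close>

lemma hol_at_solve: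
  fixes A :: "'a \<Rightarrow> complex^(1+1)^(1+1)" and B T :: "'a \<Rightarrow> complex^(1+1)^'s"
  assumes M: "atlas_ok M" and W: "openin (mtop M) W" "p \<in> W"
    and A: "\<And>q i j. q \<in> W \<Longrightarrow> hol_at M (\<lambda>q. A q $ i $ j) q"
    and B: "\<And>i j. hol_at M (\<lambda>q. B q $ i $ j) p"
    and T: "\<And>q. q \<in> W \<Longrightarrow> T q ** A q = B q"
    and d: "A p $ Inl 1 $ Inl 1 * A p $ Inr 1 $ Inr 1 - A p $ Inl 1 $ Inr 1 * A p $ Inr 1 $ Inl 1 \<noteq> 0"
  shows "hol_at M (\<lambda>q. T q $ i $ j) p"
proof -
  define det where "det = (\<lambda>q. A q $ Inl 1 $ Inl 1 * A q $ Inr 1 $ Inr 1 - A q $ Inl 1 $ Inr 1 * A q $ Inr 1 $ Inl 1)"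
  have hd: "hol_at M det q" if "q \<in> W" for q
    unfolding det_def using A[OF that] by (intro hol_at_diff hol_at_mult)
  obtain W' where W': "openin (mtop M) W'" "p \<in> W'" "W' \<subseteq> W" "\<And>q. q \<in> W' \<Longrightarrow> det q \<noteq> 0"
    using hol_nonzero_nbhd[OF M W(1) hd W(2)] d unfolding det_def by metis
  have eq: "T q $ i $ Inl 1 * A q $ Inl 1 $ k + T q $ i $ Inr 1 * A q $ Inr 1 $ k = B q $ i $ k" if "q \<in> W'" for q k
    using T[of q] W'(3) that by (auto simp: matrix_matrix_mult_def sum_UNIV_Plus_1 vec_eq_iff)
  have 1: "T q $ i $ Inl 1 = (B q $ i $ Inl 1 * A q $ Inr 1 $ Inr 1 - B q $ i $ Inr 1 * A q $ Inr 1 $ Inl 1) / det q"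
    if "q \<in> W'" for q
    using W'(4)[OF that] unfolding eq[OF that, symmetric] det_def by (simp add: field_simps)
  have 2: "T q $ i $ Inr 1 = (B q $ i $ Inr 1 * A q $ Inl 1 $ Inl 1 - B q $ i $ Inl 1 * A q $ Inl 1 $ Inr 1) / det q"
    if "q \<in> W'" for q
    using W'(4)[OF that] unfolding eq[OF that, symmetric] det_def by (simp add: field_simps)
  have "hol_at M (\<lambda>q. (B q $ i $ Inl 1 * A q $ Inr 1 $ Inr 1 - B q $ i $ Inr 1 * A q $ Inr 1 $ Inl 1) / det q) p"
    using A[OF W(2)] B hd[OF W(2)] W'(4)[OF W'(2)] by (intro hol_at_divide[OF M] hol_at_diff hol_at_mult)
  then have h1: "hol_at M (\<lambda>q. T q $ i $ Inl 1) p"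
    using hol_at_cong[OF M W'(1,2), of "\<lambda>q. T q $ i $ Inl 1", OF 1] by blast
  have "hol_at M (\<lambda>q. (B q $ i $ Inr 1 * A q $ Inl 1 $ Inl 1 - B q $ i $ Inl 1 * A q $ Inl 1 $ Inr 1) / det q) p"
    using A[OF W(2)] B hd[OF W(2)] W'(4)[OF W'(2)] by (intro hol_at_divide[OF M] hol_at_diff hol_at_mult)
  then have h2: "hol_at M (\<lambda>q. T q $ i $ Inr 1) p"
    using hol_at_cong[OF M W'(1,2), of "\<lambda>q. T q $ i $ Inr 1", OF 2] by blast
  show ?thesis using h1 h2 by (metis num1_eq1 sum.exhaust)
qed

text \<open>Translates injectivity of the differential on families of coordinate vectors into
  injectivity of the Jacobian in a single pair of charts.\<close>

lemma embedding_jac_inj: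
  assumes M: "atlas_ok M" and N: "atlas_ok N" and f: "holomorphic_embedding M N f"
    and C: "(U, c) \<in> M" "p \<in> U" and D: "(V, d) \<in> N" "f p \<in> V"
    and h: "jac (crep U c f d) (c p) *v h = 0"
  shows "h = 0"
proof -
  have p: "p \<in> points M" using C chart_subset[OF M] by blast
  have fm: "continuous_map (mtop M) (mtop N) f" "hmap_at M N f p" and
    inj: "inj_on (differential M N f p) (tangent_space M p)"
    using f p unfolding holomorphic_embedding_def holomorphic_map_iff[OF M N] by auto
  obtain X where X: "X \<in> tangent_space M p" "X (U, c) = h" using tangent_ext[OF M C] by blast
  obtain X0 where X0: "X0 \<in> tangent_space M p" "X0 (U, c) = 0" using tangent_ext[OF M C] by blast
  have "differential M N f p X = differential M N f p X0"
    by (rule tangent_eqI[OF N differential_tangent[OF M N fm X(1) p] differential_tangent[OF M N fm X0(1) p] D])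
      (simp add: differential_eq[OF M fm(2) X(1) C D] differential_eq[OF M fm(2) X0(1) C D] X X0 h)
  then have "X = X0" using inj X X0 by (auto dest: inj_onD)
  then show ?thesis using X X0 by simp
qed

text \<open>The value is independent of \<open>X\<close> and of the chart if \<open>K\<close> annihilates the tangent vectors of
  the curve, expressed in the coordinates \<open>x\<close>.\<close>

definition ntriv ::
  "('a, 'n::finite) atlas \<Rightarrow> ('b, 'm::finite) atlas \<Rightarrow> ('a \<Rightarrow> 'b) \<Rightarrow> ('b \<Rightarrow> complex^'k) \<Rightarrow>
   ('a \<Rightarrow> complex^'k^'r) \<Rightarrow> 'a \<Rightarrow> (('b, 'm) chart \<Rightarrow> complex^'m) set \<Rightarrow> complex^'r" where
  "ntriv M N f x K p e = (SOME v. \<exists>X\<in>tangent_space N (f p). \<exists>(V, d)\<in>N. f p \<in> V \<and>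
     e = normal_class M N f p X \<and> v = K p *v (jac (\<lambda>y. x (inv_into V d y)) (d (f p)) *v X (V, d)))"

section \<open>The normal bundle of an embedded curve in a threefold\<close>

locale immersed_curve =
  fixes M :: "('a, 1) atlas" and N :: "('b, 3) atlas" and f :: "'a \<Rightarrow> 'b"
  assumes M: "atlas_ok M" and N: "atlas_ok N" and f: "holomorphic_embedding M N f"
begin

lemma fc: "continuous_map (mtop M) (mtop N) f"
  using f unfolding holomorphic_embedding_def holomorphic_map_def by blast

lemma fh: "p \<in> points M \<Longrightarrow> hmap_at M N f p"
  using f unfolding holomorphic_embedding_def holomorphic_map_iff[OF M N] by blast

lemma fpoints: "p \<in> points M \<Longrightarrow> f p \<in> points N"
  using fc topspace_mtop[OF M] topspace_mtop[OF N] unfolding continuous_map_def by auto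

abbreviation im :: "'a \<Rightarrow> (('b, 3) chart \<Rightarrow> complex^3) set" where
  "im p \<equiv> differential M N f p ` tangent_space M p"

abbreviation nc where "nc \<equiv> normal_class M N f"

lemma im_iff:
  assumes C: "(U, c) \<in> M" "p \<in> U" and D: "(V, d) \<in> N" "f p \<in> V"
  shows "Y \<in> im p \<longleftrightarrow> Y \<in> tangent_space N (f p) \<and> (\<exists>h. Y (V, d) = jac (crep U c f d) (c p) *v h)"
proof -
  have p: "p \<in> points M" using C chart_subset[OF M] by blast
  show ?thesis
  proof
    assume "Y \<in> im p"
    then show "Y \<in> tangent_space N (f p) \<and> (\<exists>h. Y (V, d) = jac (crep U c f d) (c p) *v h)"
      using differential_tangent[OF M N fc fh[OF p] _ p] differential_eq[OF M fh[OF p] _ C D] by auto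
  next
    assume Y: "Y \<in> tangent_space N (f p) \<and> (\<exists>h. Y (V, d) = jac (crep U c f d) (c p) *v h)"
    then obtain h where h: "Y (V, d) = jac (crep U c f d) (c p) *v h" by blast
    obtain X where X: "X \<in> tangent_space M p" "X (U, c) = h" using tangent_ext[OF M C] by blast
    have "Y = differential M N f p X"
      by (rule tangent_eqI[OF N _ _ D])
        (use Y h X differential_tangent[OF M N fc fh[OF p] X(1) p] differential_eq[OF M fh[OF p] X(1) C D] in auto)
    then show "Y \<in> im p" using X by blast
  qed
qed

text \<open>Classes are cosets of the tangent line of the curve. That this line is closed under sums
  and negation is checked in one pair of charts, where it is the range of a matrix.\<close>

lemma nc_eq_iff:
  assumes p: "p \<in> points M" and X: "X \<in> tangent_space N (f p)" and X': "X' \<in> tangent_space N (f p)"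
  shows "nc p X = nc p X' \<longleftrightarrow> (\<lambda>D. X D - X' D) \<in> im p"
proof -
  obtain U c where C: "(U, c) \<in> M" "p \<in> U" using chart_point[OF M p] by blast
  obtain V d where D: "(V, d) \<in> N" "f p \<in> V" using chart_point[OF N fpoints[OF p]] by blast
  note im = im_iff[OF C D]
  have "(\<lambda>_. 0) \<in> im p" unfolding im
    using tangent_diff[OF N X X] by (auto intro!: exI[of _ 0])
  then have XX: "X \<in> nc p X" unfolding normal_class_def by force
  have sub: "nc p X \<subseteq> nc p X'" if XX': "(\<lambda>D. X D - X' D) \<in> im p" "X \<in> tangent_space N (f p)" for X X'
  proof
    fix Z assume "Z \<in> nc p X"
    then obtain Y where Y: "Y \<in> im p" "Z = (\<lambda>D. X D + Y D)" unfolding normal_class_def by blast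
    have "(\<lambda>D. (X D - X' D) + Y D) \<in> im p"
      unfolding im
    proof
      show "(\<lambda>D. X D - X' D + Y D) \<in> tangent_space N (f p)"
        using Y(1) XX'(1) tangent_add[OF N] unfolding im by blast
      obtain h h' where "X (V, d) - X' (V, d) = jac (crep U c f d) (c p) *v h" "Y (V, d) = jac (crep U c f d) (c p) *v h'"
        using Y(1) XX'(1) unfolding im by blast
      then have "X (V, d) - X' (V, d) + Y (V, d) = jac (crep U c f d) (c p) *v (h + h')"
        by (simp add: matrix_vector_right_distrib)
      then show "\<exists>h. X (V, d) - X' (V, d) + Y (V, d) = jac (crep U c f d) (c p) *v h" by blast
    qed
    moreover have "Z = (\<lambda>D. X' D + ((X D - X' D) + Y D))" using Y(2) by auto
    ultimately show "Z \<in> nc p X'" unfolding normal_class_def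
      by (intro CollectI exI[of _ "\<lambda>D. X D - X' D + Y D"] conjI)
  qed
  have neg: "(\<lambda>D. X' D - X D) \<in> im p" if a: "(\<lambda>D. X D - X' D) \<in> im p"
  proof -
    obtain h where h: "X (V, d) - X' (V, d) = jac (crep U c f d) (c p) *v h" using a unfolding im by blast
    then have "X' (V, d) - X (V, d) = jac (crep U c f d) (c p) *v (- h)" 
      using matrix_vector_mult_diff_distrib[of "jac (crep U c f d) (c p)" 0 h] by (simp add: algebra_simps)
    then show ?thesis unfolding im using tangent_diff[OF N X' X] by blast
  qed
  show ?thesis
  proof
    assume "nc p X = nc p X'"
    then have "X \<in> nc p X'" using XX by simp
    then obtain Y where "Y \<in> im p" "X = (\<lambda>D. X' D + Y D)" unfolding normal_class_def by blast
    moreover from this have "(\<lambda>D. X D - X' D) = Y" by auto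
    ultimately show "(\<lambda>D. X D - X' D) \<in> im p" by simp
  next
    assume a: "(\<lambda>D. X D - X' D) \<in> im p"
    then show "nc p X = nc p X'" using sub[OF a X] sub[OF neg[OF a] X'] by blast
  qed
qed

text \<open>The source has dimension one, so in a chart the embedded curve is a holomorphic function
  \<open>\<gamma>\<close> of one complex variable, and each entry is a directional derivative
  evaluated along it.\<close>

lemma jac_hol_along:
  assumes Os: "openin (mtop N) Os" and x: "\<And>q j. q \<in> Os \<Longrightarrow> hol_at N (\<lambda>q. x q $ j) q"
    and p: "p \<in> points M" "f p \<in> Os" and D: "(V, d) \<in> N" "f p \<in> V"
  shows "hol_at M (\<lambda>p. jac (\<lambda>y. x (inv_into V d y)) (d (f p)) $ i $ j) p"
proof -
  obtain U c where C: "(U, c) \<in> M" "p \<in> U" using chart_point[OF M p(1)] by blast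
  define S where "S = d ` (V \<inter> Os)"
  have S: "open S" unfolding S_def using openin_chart_image[OF N Os D(1)] .
  have cd: "cdiff (\<lambda>y. x (inv_into V d y)) y" if "y \<in> S" for y
    using that x D unfolding S_def cdiff_def hol_at_def by fast
  define \<gamma> where "\<gamma> = (\<lambda>t. crep U c f d (vec t))"
  have op: "openin (mtop N) (V \<inter> Os)" using openin_chart[OF N D(1)] Os by blast
  define S' where "S' = c ` (U \<inter> f -` (V \<inter> Os))"
  have S': "open S'" unfolding S'_def by (rule continuous_map_chart_open[OF M N fc C(1) op])
  define T where "T = (vec :: complex \<Rightarrow> complex^1) -` S'"
  have "continuous_on UNIV (vec :: complex \<Rightarrow> complex^1)"
    unfolding vec_def by (intro continuous_intros)
  then have T: "open T" unfolding T_def using S' by (rule open_vimage[rotated])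
  have inT: "\<gamma> t \<in> S" "cdiff (crep U c f d) (vec t)" if t: "t \<in> T" for t
  proof -
    obtain q where q: "vec t = c q" "q \<in> U" "f q \<in> V" "f q \<in> Os" using t unfolding T_def S'_def by auto
    show "\<gamma> t \<in> S" unfolding \<gamma>_def S_def using q chart_inv[OF M C(1)] by auto
    show "cdiff (crep U c f d) (vec t)"
      unfolding q(1) using hmap_at_chart[OF fh C(1) q(2) D(1) q(3)] q(2) chart_subset[OF M C(1)] by blast
  qed
  have hol: "(\<lambda>t. \<gamma> t $ i) holomorphic_on T" for i
    unfolding holomorphic_on_def
  proof
    fix t assume t: "t \<in> T"
    have "cdf (\<lambda>z. crep U c f d z $ i) (vec t)" using inT(2)[OF t] unfolding cdiff_def by blast
    from cdf_vec_1[OF this] show "(\<lambda>t. \<gamma> t $ i) field_differentiable at t within T"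
      unfolding \<gamma>_def by (rule field_differentiable_at_within)
  qed
  have t0: "c p $ 1 \<in> T" unfolding T_def S'_def using C D p by (auto simp: vec_nth_1)
  have cS: "cdf (\<lambda>y. x (inv_into V d y) $ i) y" if "y \<in> S" for y
    using cd[OF that] unfolding cdiff_def by blast
  have "(\<lambda>t. frechet_derivative (\<lambda>y. x (inv_into V d y) $ i) (at (\<gamma> t)) (axis j 1)) field_differentiable at (c p $ 1)"
    by (rule deriv_along_curve[OF S cS T t0 inT(1) hol])
  then have "cdf (\<lambda>z::complex^1. frechet_derivative (\<lambda>y. x (inv_into V d y) $ i) (at (crep U c f d z)) (axis j 1)) (c p)"
    using field_differentiable_cdf[of "\<lambda>t. frechet_derivative (\<lambda>y. x (inv_into V d y) $ i) (at (\<gamma> t)) (axis j 1)"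
      "\<lambda>z. z $ 1" "c p"] unfolding \<gamma>_def by (simp add: vec_nth_1)
  moreover have "cdf (\<lambda>z::complex^1. frechet_derivative (\<lambda>y. x (inv_into V d y) $ i) (at (crep U c f d z)) (axis j 1)) (c p)
    \<longleftrightarrow> cdf (\<lambda>z. jac (\<lambda>y. x (inv_into V d y)) (crep U c f d z) $ i $ j) (c p)"
  proof (rule cdf_cong_open[OF S'])
    show "c p \<in> S'" unfolding S'_def using C D p by auto
    fix z assume "z \<in> S'"
    then have "z $ 1 \<in> T" unfolding T_def by (simp add: vec_nth_1)
    from inT(1)[OF this] have "crep U c f d z \<in> S" unfolding \<gamma>_def by (simp add: vec_nth_1)
    from jac_nth[OF cd[OF this], of i j]
    show "frechet_derivative (\<lambda>y. x (inv_into V d y) $ i) (at (crep U c f d z)) (axis j 1) =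
        jac (\<lambda>y. x (inv_into V d y)) (crep U c f d z) $ i $ j" by simp
  qed
  ultimately show ?thesis
    using hol_atI[OF M C, of "\<lambda>p. jac (\<lambda>y. x (inv_into V d y)) (d (f p)) $ i $ j"] by simp
qed

lemma ntriv_eq:
  fixes x :: "'b \<Rightarrow> complex^'k" and K :: "'a \<Rightarrow> complex^'k^'r"
  assumes C: "(U, c) \<in> M" "p \<in> U" and D: "(V, d) \<in> N" "f p \<in> V" and X: "X \<in> tangent_space N (f p)"
    and x: "\<And>j. hol_at N (\<lambda>q. x q $ j) (f p)"
    and ker: "\<And>V d h. (V, d) \<in> N \<Longrightarrow> f p \<in> V \<Longrightarrow>
      K p *v (jac (\<lambda>y. x (inv_into V d y)) (d (f p)) *v (jac (crep U c f d) (c p) *v h)) = 0"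
  shows "ntriv M N f x K p (nc p X) = K p *v (jac (\<lambda>y. x (inv_into V d y)) (d (f p)) *v X (V, d))"
proof -
  have p: "p \<in> points M" using C chart_subset[OF M] by blast
  have cd: "cdiff (\<lambda>y. x (inv_into V d y)) (d (f p))" if "(V, d) \<in> N" "f p \<in> V" for V d
    using x that unfolding cdiff_def hol_at_def by fast
  let ?P = "\<lambda>v. \<exists>X'\<in>tangent_space N (f p). \<exists>(V, d)\<in>N. f p \<in> V \<and>
     nc p X = nc p X' \<and> v = K p *v (jac (\<lambda>y. x (inv_into V d y)) (d (f p)) *v X' (V, d))"
  define v where "v = ntriv M N f x K p (nc p X)"
  have "?P v" unfolding v_def ntriv_def
    by (rule someI[of ?P "K p *v (jac (\<lambda>y. x (inv_into V d y)) (d (f p)) *v X (V, d))"]) (use X D in blast)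
  then obtain X' V' d' where *: "X' \<in> tangent_space N (f p)" "(V', d') \<in> N" "f p \<in> V'" "nc p X = nc p X'"
    "v = K p *v (jac (\<lambda>y. x (inv_into V' d' y)) (d' (f p)) *v X' (V', d'))" by blast
  have 1: "jac (\<lambda>y. x (inv_into V' d' y)) (d' (f p)) *v X' (V', d') = jac (\<lambda>y. x (inv_into V d y)) (d (f p)) *v X' (V, d)"
    unfolding tangent_trans[OF N *(1) D *(2,3)] jac_chart_cocycle[OF N D *(2,3) cd[OF *(2,3)]]
    by (simp add: matrix_vector_mul_assoc)
  have "(\<lambda>D. X D - X' D) \<in> im p" using nc_eq_iff[OF p X *(1)] *(4) by blast
  then obtain h where "X (V, d) - X' (V, d) = jac (crep U c f d) (c p) *v h" unfolding im_iff[OF C D] by blast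
  then have "K p *v (jac (\<lambda>y. x (inv_into V d y)) (d (f p)) *v (X (V, d) - X' (V, d))) = 0" using ker[OF D] by simp
  then have "K p *v (jac (\<lambda>y. x (inv_into V d y)) (d (f p)) *v X (V, d)) = K p *v (jac (\<lambda>y. x (inv_into V d y)) (d (f p)) *v X' (V, d))"
    by (simp add: matrix_vector_mult_diff_distrib)
  then show ?thesis using 1 *(5) v_def by simp
qed

lemma surj_of_kernel:
  fixes A :: "complex^3^(1+1)"
  assumes v0: "v0 \<noteq> 0" and ker: "\<And>v. A *v v = 0 \<Longrightarrow> \<exists>k. v = k *s v0"
  shows "surj (\<lambda>v. A *v v)"
proof -
  obtain i where i: "v0 $ i \<noteq> 0" using v0 by (auto simp: vec_eq_iff)
  \<comment> \<open>The coordinate \<open>i\<close> does not vanish on the kernel line. Adjoining it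
    as a third row gives an injective, hence invertible, square matrix.\<close>
  define B :: "complex^3^3" where "B = (\<chi> j. if j = 1 then A $ Inl 1 else if j = 2 then A $ Inr 1 else axis i 1)"
  have B1: "(B *v v) $ 1 = (A *v v) $ Inl 1" and B2: "(B *v v) $ 2 = (A *v v) $ Inr 1" for v
    unfolding B_def matrix_vector_mult_def by simp_all
  have B3: "(B *v v) $ 3 = v $ i" for v
    unfolding B_def matrix_vector_mult_def by (simp add: axis_def if_distrib[of "\<lambda>a. a * _"] cong: if_cong)
  have "v = 0" if "B *v v = 0" for v
  proof -
    have "A *v v = 0" using B1[of v] B2[of v] that unfolding vec_eq_iff forall_Plus_1 by simp
    then obtain k where k: "v = k *s v0" using ker by blast
    have "v $ i = 0" using B3[of v] that by simp
    then show ?thesis using k i by simp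
  qed
  then have "inj (\<lambda>v. B *v v)"
    by (intro injI) (metis (no_types) eq_iff_diff_eq_0 matrix_vector_mult_diff_distrib)
  then obtain B' where "B' ** B = mat 1" using matrix_left_invertible_injective by blast
  then have BB: "B ** B' = mat 1" using matrix_left_right_inverse by blast
  show ?thesis unfolding surj_def
  proof
    fix y :: "complex^(1+1)"
    define w :: "complex^3" where "w = (\<chi> j. if j = 1 then y $ Inl 1 else y $ Inr 1)"
    have "B *v (B' *v w) = w" by (simp add: matrix_vector_mul_assoc BB)
    then have "y = A *v (B' *v w)"
      using B1[of "B' *v w"] B2[of "B' *v w"] unfolding vec_eq_iff forall_Plus_1 w_def by simp
    then show "\<exists>v. y = A *v v" by blast
  qed
qed

text \<open>The kernel of the covectors is exactly the tangent line of the curve, so they are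
  injective on the quotient; a map from dimension three to dimension two with a line as kernel is
  onto. The functions \<open>x\<close> may outnumber the dimension of \<open>N\<close>, which allows
  redundant coordinates subject to a relation.\<close>

lemma ntriv_in_trivs:
  fixes x :: "'b \<Rightarrow> complex^'k" and K :: "'a \<Rightarrow> complex^'k^(1+1)"
  assumes W: "openin (mtop M) W" and Os: "openin (mtop N) Os" "\<And>p. p \<in> W \<Longrightarrow> f p \<in> Os"
    and x: "\<And>q j. q \<in> Os \<Longrightarrow> hol_at N (\<lambda>q. x q $ j) q"
    and K: "\<And>p i j. p \<in> W \<Longrightarrow> hol_at M (\<lambda>q. K q $ i $ j) p"
    and C: "(U, c) \<in> M" "W \<subseteq> U"
    and ker: "\<And>p V d v. p \<in> W \<Longrightarrow> (V, d) \<in> N \<Longrightarrow> f p \<in> V \<Longrightarrow>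
      K p *v (jac (\<lambda>y. x (inv_into V d y)) (d (f p)) *v v) = 0 \<longleftrightarrow> (\<exists>h. v = jac (crep U c f d) (c p) *v h)"
  shows "(W, ntriv M N f x K) \<in> trivs (normal_bundle M N f)"
proof -
  have Wp: "W \<subseteq> points M" using W openin_mtop_iff[OF M] by blast
  have eq: "ntriv M N f x K p (nc p X) = K p *v (jac (\<lambda>y. x (inv_into V d y)) (d (f p)) *v X (V, d))"
    if "p \<in> W" "(V, d) \<in> N" "f p \<in> V" "X \<in> tangent_space N (f p)" for p V d X
    using ntriv_eq[OF C(1) subsetD[OF C(2) that(1)] that(2-4) x[OF Os(2)[OF that(1)]], of K] ker[OF that(1)] by blast
  have bij: "bij_betw (ntriv M N f x K p) (nc p ` tangent_space N (f p)) UNIV" if p: "p \<in> W" for p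
  proof -
    have pp: "p \<in> points M" "p \<in> U" using p Wp C(2) by auto
    obtain V d where D: "(V, d) \<in> N" "f p \<in> V" using chart_point[OF N fpoints[OF pp(1)]] by blast
    define A where "A = K p ** jac (\<lambda>y. x (inv_into V d y)) (d (f p))"
    define v0 where "v0 = jac (crep U c f d) (c p) *v (vec 1)"
    have kerA: "A *v v = 0 \<longleftrightarrow> (\<exists>h. v = jac (crep U c f d) (c p) *v h)" for v
      using ker[OF p D] unfolding A_def by (simp add: matrix_vector_mul_assoc)
    have v0: "v0 \<noteq> 0" using embedding_jac_inj[OF M N f C(1) pp(2) D, of "vec 1"] unfolding v0_def by (auto simp: vec_eq_iff)
    have "jac (crep U c f d) (c p) *v h = h $ 1 *s v0" for h
    proof -
      have "h = h $ 1 *s vec 1" by (simp add: vec_eq_iff)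
      then show ?thesis unfolding v0_def by (metis matrix_vector_scale)
    qed
    then have "surj (\<lambda>v. A *v v)" using surj_of_kernel[OF v0, of A] kerA by metis
    note surj = this
    have inj: "inj_on (ntriv M N f x K p) (nc p ` tangent_space N (f p))"
    proof (rule inj_onI, clarify)
      fix X Y assume X: "X \<in> tangent_space N (f p)" and Y: "Y \<in> tangent_space N (f p)"
        and "ntriv M N f x K p (nc p X) = ntriv M N f x K p (nc p Y)"
      then have "A *v X (V, d) = A *v Y (V, d)"
        unfolding A_def by (simp add: eq[OF p D X] eq[OF p D Y] matrix_vector_mul_assoc)
      then have "A *v (X (V, d) - Y (V, d)) = 0" by (simp add: matrix_vector_mult_diff_distrib)
      then have "(\<lambda>D. X D - Y D) \<in> im p"
        using kerA tangent_diff[OF N X Y] unfolding im_iff[OF C(1) pp(2) D] by blast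
      then show "nc p X = nc p Y" using nc_eq_iff[OF pp(1) X Y] by blast
    qed
    have "y \<in> ntriv M N f x K p ` (nc p ` tangent_space N (f p))" for y
    proof -
      obtain v where v: "y = A *v v" using surj unfolding surj_def by blast
      obtain X where X: "X \<in> tangent_space N (f p)" "X (V, d) = v" using tangent_ext[OF N D] by blast
      have "ntriv M N f x K p (nc p X) = y"
        unfolding v A_def by (simp add: eq[OF p D X(1)] X(2) matrix_vector_mul_assoc)
      then show ?thesis using X(1) by blast
    qed
    then show ?thesis using inj unfolding bij_betw_def by blast
  qed
  have hol: "\<exists>G. holo_matrix_on M (W \<inter> f -` fst D) G \<and>
          (\<forall>p\<in>W \<inter> f -` fst D. \<forall>X\<in>tangent_space N (f p). ntriv M N f x K p (nc p X) = G p *v X D)"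
    if D: "D \<in> N" for D
  proof -
    obtain V d where VD: "D = (V, d)" by fastforce
    have VN: "(V, d) \<in> N" using D VD by simp
    define G where "G = (\<lambda>p. K p ** jac (\<lambda>y. x (inv_into V d y)) (d (f p)))"
    have "holo_matrix_on M (W \<inter> f -` V) G"
    proof (subst holo_matrix_on_iff[OF M])
      show "W \<inter> f -` V \<subseteq> points M" using Wp by blast
      have "hol_at M (\<lambda>q. G q $ i $ j) p" if "p \<in> W" "f p \<in> V" for p i j
        unfolding G_def using K[OF that(1)] jac_hol_along[OF Os(1) x _ Os(2)[OF that(1)] VN that(2)] Wp that(1)
        by (intro hol_at_matrix_mult) auto
      then show "openin (mtop M) (W \<inter> f -` V) \<and> (\<forall>p\<in>W \<inter> f -` V. \<forall>i j. hol_at M (\<lambda>q. G q $ i $ j) p)"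
        using openin_preimage[OF M fc W openin_chart[OF N VN]] by blast
    qed
    moreover have "ntriv M N f x K p (nc p X) = G p *v X D" if "p \<in> W" "f p \<in> V" "X \<in> tangent_space N (f p)" for p X
      unfolding G_def VD eq[OF that(1) VN that(2,3)] by (simp add: matrix_vector_mul_assoc)
    ultimately show ?thesis unfolding VD by auto
  qed
  show ?thesis unfolding normal_bundle_def using W bij hol by simp
qed

abbreviation NB :: "('a, (('b, 3) chart \<Rightarrow> complex^3) set, 1 + 1) vbundle" where
  "NB \<equiv> normal_bundle M N f"

lemma trivD:
  assumes "(W, t) \<in> trivs (normal_bundle M N f :: ('a, (('b, 3) chart \<Rightarrow> complex^3) set, 'r::finite) vbundle)"
  shows "openin (mtop M) W" "p \<in> W \<Longrightarrow> bij_betw (t p) (nc p ` tangent_space N (f p)) UNIV"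
    "(V, d) \<in> N \<Longrightarrow> \<exists>G. (\<forall>p\<in>W \<inter> f -` V. \<forall>i j. hol_at M (\<lambda>q. G q $ i $ j) p) \<and>
          (\<forall>p\<in>W \<inter> f -` V. \<forall>X\<in>tangent_space N (f p). t p (nc p X) = G p *v X (V, d))"
proof -
  have *: "openin (mtop M) W" "\<forall>p\<in>W. bij_betw (t p) (nc p ` tangent_space N (f p)) UNIV"
   "\<forall>D\<in>N. \<exists>G. holo_matrix_on M (W \<inter> f -` fst D) G \<and>
          (\<forall>p\<in>W \<inter> f -` fst D. \<forall>X\<in>tangent_space N (f p). t p (nc p X) = G p *v X D)"
    using assms unfolding normal_bundle_def by auto
  show "openin (mtop M) W" "p \<in> W \<Longrightarrow> bij_betw (t p) (nc p ` tangent_space N (f p)) UNIV" using * by auto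
  assume D: "(V, d) \<in> N"
  obtain G where G: "holo_matrix_on M (W \<inter> f -` V) G"
     "\<forall>p\<in>W \<inter> f -` V. \<forall>X\<in>tangent_space N (f p). t p (nc p X) = G p *v X (V, d)"
    using bspec[OF *(3) D] by auto
  have "W \<inter> f -` V \<subseteq> points M" using *(1) openin_mtop_iff[OF M] by blast
  then have "\<forall>p\<in>W \<inter> f -` V. \<forall>i j. hol_at M (\<lambda>q. G q $ i $ j) p" using G(1) holo_matrix_on_iff[OF M] by blast
  then show "\<exists>G. (\<forall>p\<in>W \<inter> f -` V. \<forall>i j. hol_at M (\<lambda>q. G q $ i $ j) p) \<and>
          (\<forall>p\<in>W \<inter> f -` V. \<forall>X\<in>tangent_space N (f p). t p (nc p X) = G p *v X (V, d))"
    using G(2) by blast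
qed

text \<open>In a chart of \<open>N\<close> the trivialisations are matrices \<open>H\<close> and
  \<open>G\<close> with two rows and three columns, and the transition is the square matrix
  \<open>T\<close> with \<open>T H = G\<close>. It exists because both have the tangent line as
  kernel, and it inherits holomorphy from this equation.\<close>

lemma triv_transition:
  fixes t t' :: "'a \<Rightarrow> (('b, 3) chart \<Rightarrow> complex^3) set \<Rightarrow> complex^(1+1)"
  assumes t: "(W, t) \<in> trivs (normal_bundle M N f)" and t': "(W', t') \<in> trivs (normal_bundle M N f)"
  shows "\<exists>G::'a \<Rightarrow> complex^(1+1)^(1+1). holo_matrix_on M (W \<inter> W') G \<and>
        (\<forall>p\<in>W \<inter> W'. \<forall>e\<in>nc p ` tangent_space N (f p). t' p e = G p *v t p e)"
proof -
  note t1 = trivD[OF t] and t2 = trivD[OF t']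
  have Wp: "W \<subseteq> points M" using t1(1) openin_mtop_iff[OF M] by blast
  have WW: "openin (mtop M) (W \<inter> W')" using t1(1) t2(1) by blast
  have data: "\<exists>T. \<forall>e\<in>nc p ` tangent_space N (f p). t' p e = T *v t p e"
    and right_inv: "(V, d) \<in> N \<Longrightarrow> f p \<in> V \<Longrightarrow> \<forall>X\<in>tangent_space N (f p). t p (nc p X) = H *v X (V, d) \<Longrightarrow> \<exists>R. H ** R = mat 1"
    if p: "p \<in> W \<inter> W'" for p V d H
  proof -
    have R: "\<exists>R. H ** R = mat 1" if D: "(V, d) \<in> N" "f p \<in> V" and H: "\<forall>X\<in>tangent_space N (f p). t p (nc p X) = H *v X (V, d)" for V d H
    proof -
      have "\<exists>v. y = H *v v" for y
      proof -
        have "y \<in> t p ` (nc p ` tangent_space N (f p))"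
          using bij_betw_imp_surj_on[OF t1(2)[of p]] p by simp
        then obtain X where "X \<in> tangent_space N (f p)" "t p (nc p X) = y" by blast
        then show ?thesis using H by metis
      qed
      then have "surj (\<lambda>v. H *v v)" unfolding surj_def by blast
      then show ?thesis using matrix_right_invertible_surjective by blast
    qed
    show "(V, d) \<in> N \<Longrightarrow> f p \<in> V \<Longrightarrow> \<forall>X\<in>tangent_space N (f p). t p (nc p X) = H *v X (V, d) \<Longrightarrow> \<exists>R. H ** R = mat 1" by (rule R)
    have pp: "p \<in> points M" using p Wp by blast
    obtain V d where D: "(V, d) \<in> N" "f p \<in> V" using chart_point[OF N fpoints[OF pp]] by blast
    obtain H where H: "\<forall>X\<in>tangent_space N (f p). t p (nc p X) = H *v X (V, d)" using t1(3)[OF D(1)] p D(2) by blast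
    obtain G where G: "\<forall>X\<in>tangent_space N (f p). t' p (nc p X) = G *v X (V, d)" using t2(3)[OF D(1)] p D(2) by blast
    obtain R where R: "H ** R = mat 1" using R[OF D H] by blast
    have "t' p (nc p X) = (G ** R) *v t p (nc p X)" if X: "X \<in> tangent_space N (f p)" for X
    proof -
      \<comment> \<open>A vector killed by \<open>H\<close> represents the zero class, because
        \<open>t\<close> is injective on classes; hence \<open>G\<close> kills it as well, and
        \<open>G\<close> is determined by its values on the range of the right inverse
        \<open>R\<close>.\<close>
      define v where "v = X (V, d) - R *v (H *v X (V, d))"
      have Hv: "H *v v = 0" unfolding v_def
        by (simp add: matrix_vector_mult_diff_distrib matrix_vector_mul_assoc matrix_mul_assoc R)
      obtain Y where Y: "Y \<in> tangent_space N (f p)" "Y (V, d) = v" using tangent_ext[OF N D] by blast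
      obtain Z where Z: "Z \<in> tangent_space N (f p)" "Z (V, d) = 0" using tangent_ext[OF N D] by blast
      have "t p (nc p Y) = t p (nc p Z)" using H Y Z Hv by simp
      then have "nc p Y = nc p Z" using t1(2)[of p] p Y Z unfolding bij_betw_def by (auto dest: inj_onD)
      then have "G *v Y (V, d) = G *v Z (V, d)" using G Y(1) Z(1) by metis
      then have "G *v v = 0" using Y Z by simp
      then have "G *v X (V, d) = G *v (R *v (H *v X (V, d)))" unfolding v_def by (simp add: matrix_vector_mult_diff_distrib)
      then show ?thesis using G H X by (simp add: matrix_vector_mul_assoc matrix_mul_assoc)
    qed
    then show "\<exists>T. \<forall>e\<in>nc p ` tangent_space N (f p). t' p e = T *v t p e" by blast
  qed
  obtain T where T: "\<And>p e. p \<in> W \<inter> W' \<Longrightarrow> e \<in> nc p ` tangent_space N (f p) \<Longrightarrow> t' p e = T p *v t p e"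
    using data by metis
  have hol: "hol_at M (\<lambda>q. T q $ i $ j) p" if p: "p \<in> W \<inter> W'" for p i j
  proof -
    have pp: "p \<in> points M" using p Wp by blast
    obtain V d where D: "(V, d) \<in> N" "f p \<in> V" using chart_point[OF N fpoints[OF pp]] by blast
    obtain H where H: "\<forall>p\<in>W \<inter> f -` V. \<forall>i j. hol_at M (\<lambda>q. H q $ i $ j) p"
      "\<forall>p\<in>W \<inter> f -` V. \<forall>X\<in>tangent_space N (f p). t p (nc p X) = H p *v X (V, d)" using t1(3)[OF D(1)] by blast
    obtain G where G: "\<forall>p\<in>W' \<inter> f -` V. \<forall>i j. hol_at M (\<lambda>q. G q $ i $ j) p"
      "\<forall>p\<in>W' \<inter> f -` V. \<forall>X\<in>tangent_space N (f p). t' p (nc p X) = G p *v X (V, d)" using t2(3)[OF D(1)] by blast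
    obtain R where R: "H p ** R = mat 1" using right_inv[OF p D, of "H p"] H(2) p D by blast
    \<comment> \<open>The right inverse is taken at \<open>p\<close> and then held constant, so that
      \<open>A\<close> is a holomorphic square matrix which is the identity at
      \<open>p\<close>.\<close>
    define A where "A = (\<lambda>q. H q ** R)"
    show ?thesis
    proof (rule hol_at_solve[OF M openin_preimage[OF M fc WW openin_chart[OF N D(1)]]])
      show "p \<in> W \<inter> W' \<inter> f -` V" using p D by blast
      show "hol_at M (\<lambda>q. A q $ i $ j) q" if "q \<in> W \<inter> W' \<inter> f -` V" for q i j
        unfolding A_def using H(1) that by (intro hol_at_matrix_mult) auto
      show "hol_at M (\<lambda>q. (G q ** R) $ i $ j) p" for i j
        using G(1) p D by (intro hol_at_matrix_mult) auto
      show "T q ** A q = G q ** R" if q: "q \<in> W \<inter> W' \<inter> f -` V" for q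
      proof -
        have "T q *v (H q *v v) = G q *v v" for v
        proof -
          have D': "f q \<in> V" using q by blast
          obtain X where X: "X \<in> tangent_space N (f q)" "X (V, d) = v" using tangent_ext[OF N D(1) D'] by blast
          have "t' q (nc q X) = T q *v t q (nc q X)" using T q X(1) by blast
          then show ?thesis using H(2) G(2) q X by auto
        qed
        then have "T q ** H q = G q" unfolding matrix_eq by (simp add: matrix_vector_mul_assoc)
        then show ?thesis unfolding A_def by (simp add: matrix_mul_assoc)
      qed
      show "A p $ Inl 1 $ Inl 1 * A p $ Inr 1 $ Inr 1 - A p $ Inl 1 $ Inr 1 * A p $ Inr 1 $ Inl 1 \<noteq> 0"
        unfolding A_def R by (simp add: mat_def)
    qed
  qed
  have "holo_matrix_on M (W \<inter> W') T"
    by (subst holo_matrix_on_iff[OF M]) (use Wp WW hol in auto)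
  then show ?thesis using T by blast
qed

text \<open>The bundle contains every admissible trivialisation and \<open>triv_transition\<close>
  relates any two of them, so only a cover has to be supplied.\<close>

lemma normal_bundle_vector_bundle:
  assumes "\<And>p. p \<in> points M \<Longrightarrow> \<exists>W t. (W, t) \<in> trivs NB \<and> p \<in> W"
  shows "vector_bundle M NB"
  unfolding vector_bundle_def
proof (intro conjI)
  have sub: "W \<subseteq> points M" if "(W, t) \<in> trivs NB" for W t
    using trivD(1)[OF that] openin_mtop_iff[OF M] by blast
  show "\<Union> (fst ` trivs NB) = points M"
  proof
    show "\<Union> (fst ` trivs NB) \<subseteq> points M"
      using sub by fastforce
    show "points M \<subseteq> \<Union> (fst ` trivs NB)"
    proof
      fix p assume "p \<in> points M"
      then obtain W t where "(W, t) \<in> trivs NB" "p \<in> W"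
        using assms by blast
      then show "p \<in> \<Union> (fst ` trivs NB)"
        by (metis UN_I fst_conv)
    qed
  qed
  show "\<forall>(W, t)\<in>trivs NB. openin (mtop M) W \<and>
     (\<forall>p\<in>W. bij_betw (t p) (fibre NB p) UNIV)"
    unfolding normal_bundle_def by auto
  show "\<forall>(W, t)\<in>trivs NB.
     \<forall>(W', t')\<in>trivs NB. \<exists>G::'a \<Rightarrow> complex^(1+1)^(1+1).
        holo_matrix_on M (W \<inter> W') G \<and>
        (\<forall>p\<in>W \<inter> W'. \<forall>e\<in>fibre NB p. t' p e = G p *v t p e)"
  proof (safe)
    fix W t W' t'
    assume "(W, t) \<in> trivs NB"
      "(W', t') \<in> trivs NB"
    from triv_transition[OF this] show "\<exists>G::'a \<Rightarrow> complex^(1+1)^(1+1).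
        holo_matrix_on M (W \<inter> W') G \<and>
        (\<forall>p\<in>W \<inter> W'. \<forall>e\<in>fibre NB p. t' p e = G p *v t p e)"
      unfolding normal_bundle_def by simp
  qed
qed

end

section \<open>The projective line and the bundles \<open>O(k) + O(l)\<close>\<close>

definition cpU :: "2 \<Rightarrow> (complex^2) set set" where
  "cpU i = {pt y | y. y $ i \<noteq> 0}"

definition cpc :: "2 \<Rightarrow> (complex^2) set \<Rightarrow> complex^1" where
  "cpc i = (\<lambda>l. \<chi> _. let y = (SOME y. y \<in> l) in y $ (i + 1) / y $ i)"

definition aff :: "2 \<Rightarrow> complex \<Rightarrow> complex^2" where
  "aff i w = (\<chi> j. if j = i then 1 else w)"

lemma CP1_charts: "CP1 = {(cpU i, cpc i) | i. True}"
  unfolding CP1_def cpU_def cpc_def ..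

lemma CP1_chart: "(cpU i, cpc i) \<in> CP1"
  unfolding CP1_charts by blast

lemma two_neq [simp]: "i + 1 \<noteq> (i :: 2)" "i \<noteq> i + (1 :: 2)"
  by simp_all

lemma two_add [simp]: "i + 1 + 1 = (i :: 2)"
proof -
  have "(1 + 1 :: 2) = 0" by simp
  then show ?thesis by (metis add.assoc add.right_neutral)
qed

lemma two_cases: "j = i \<or> j = i + (1 :: 2)"
proof -
  have "\<forall>i j::2. j = i \<or> j = i + 1" unfolding forall_2 by simp
  then show ?thesis by blast
qed

lemma vec2_eq_iff: "x = y \<longleftrightarrow> x $ i = y $ i \<and> x $ (i + 1) = y $ (i + 1)" for x y :: "complex^2"
  unfolding vec_eq_iff using two_cases[of _ i] by metis

lemma mem_pt: "y \<in> pt y"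
  unfolding pt_def by (intro CollectI exI[of _ 1]) simp

lemma pt_scale: "k \<noteq> 0 \<Longrightarrow> pt (k *s y) = pt y"
  unfolding pt_def
proof (intro set_eqI iffI)
  fix x assume k: "k \<noteq> 0"
  show "x \<in> {c *s (k *s y) |c. c \<noteq> 0} \<Longrightarrow> x \<in> {c *s y |c. c \<noteq> 0}" using k by (auto simp: vector_smult_assoc)
  assume "x \<in> {c *s y |c. c \<noteq> 0}"
  then obtain c where "x = c *s y" "c \<noteq> 0" by blast
  then show "x \<in> {c *s (k *s y) |c. c \<noteq> 0}" using k
    by (intro CollectI exI[of _ "c / k"]) (simp add: vector_smult_assoc)
qed

lemma pt_eq_iff: "pt y = pt y' \<longleftrightarrow> (\<exists>c. c \<noteq> 0 \<and> y' = c *s y)"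
proof
  assume "pt y = pt y'"
  then have "y' \<in> pt y" using mem_pt by blast
  then show "\<exists>c. c \<noteq> 0 \<and> y' = c *s y" unfolding pt_def by blast
qed (auto simp: pt_scale)

lemma pt_some: "\<exists>c. c \<noteq> 0 \<and> (SOME x. x \<in> pt y) = c *s y"
proof -
  have "(SOME x. x \<in> pt y) \<in> pt y" using someI[of "\<lambda>x. x \<in> pt y", OF mem_pt] .
  then show ?thesis unfolding pt_def by blast
qed

lemma pt_in_cpU [simp]: "pt y \<in> cpU i \<longleftrightarrow> y $ i \<noteq> 0"
  unfolding cpU_def by (auto simp: pt_eq_iff)

lemma cpU_E: "p \<in> cpU i \<Longrightarrow> (\<And>y. p = pt y \<Longrightarrow> y $ i \<noteq> 0 \<Longrightarrow> thesis) \<Longrightarrow> thesis"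
  unfolding cpU_def by blast

lemma cpc_pt: "cpc i (pt y) = vec (y $ (i + 1) / y $ i)"
proof -
  obtain c where "c \<noteq> 0" "(SOME x. x \<in> pt y) = c *s y" using pt_some by blast
  then show ?thesis unfolding cpc_def by (simp add: vec_eq_iff Let_def)
qed

lemma aff_nth [simp]: "aff i w $ i = 1" "aff i w $ (i + 1) = w"
  unfolding aff_def by auto

lemma pt_aff: "y $ i \<noteq> 0 \<Longrightarrow> pt (aff i (y $ (i + 1) / y $ i)) = pt y"
  unfolding pt_eq_iff by (intro exI[of _ "y $ i"]) (auto simp: vec2_eq_iff[of _ _ i])

lemma CP1_points: "points CP1 = {pt y | y. y \<noteq> 0}"
proof -
  have "points CP1 = (\<Union>i. cpU i)" unfolding points_def CP1_charts by auto
  also have "\<dots> = {pt y | y. y \<noteq> 0}" unfolding cpU_def by (auto simp: vec_eq_iff)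
  finally show ?thesis .
qed

lemma points_cpU: "p \<in> points CP1 \<longleftrightarrow> p \<in> cpU i \<or> p \<in> cpU (i + 1)"
  unfolding CP1_points cpU_def by (auto simp: vec2_eq_iff[of _ 0 i])

lemma cpU_points: "cpU i \<subseteq> points CP1"
  using points_cpU by blast

lemma cpc_inj: "inj_on (cpc i) (cpU i)"
proof (rule inj_onI)
  fix p q assume p: "p \<in> cpU i" and q: "q \<in> cpU i" and e: "cpc i p = cpc i q"
  obtain y z where y: "p = pt y" "y $ i \<noteq> 0" and z: "q = pt z" "z $ i \<noteq> 0" using p q by (auto elim!: cpU_E)
  have "y $ (i + 1) / y $ i = z $ (i + 1) / z $ i" using e unfolding y z cpc_pt by (simp add: vec_eq_iff)
  then show "p = q" using pt_aff[OF y(2)] pt_aff[OF z(2)] y z by simp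
qed

lemma cpc_aff: "cpc i (pt (aff i w)) = vec w"
  by (simp add: cpc_pt)

lemma cpc_image: "cpc i ` cpU i = UNIV"
proof -
  have "x \<in> cpc i ` cpU i" for x
    by (rule image_eqI[of _ _ "pt (aff i (x $ 1))"]) (auto simp: cpc_aff vec_nth_1)
  then show ?thesis by blast
qed

lemma cpc_inv: "inv_into (cpU i) (cpc i) x = pt (aff i (x $ 1))"
  by (rule inv_into_f_eq[OF cpc_inj]) (auto simp: cpc_aff vec_nth_1)

lemma cdf_aff: "cdf (\<lambda>x. aff i (x $ 1) $ j) (x :: complex^1)"
  by (cases "j = i") (auto simp: aff_def)

lemma cpc_preimage: "cpc i ` (cpU i \<inter> W) = {x::complex^1. pt (aff i (x $ 1)) \<in> W}"
proof (intro set_eqI iffI)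
  fix x assume "x \<in> cpc i ` (cpU i \<inter> W)"
  then obtain p where "p \<in> cpU i" "p \<in> W" "x = cpc i p" by blast
  then show "x \<in> {x::complex^1. pt (aff i (x $ 1)) \<in> W}" using cpc_inv[of i x] inv_into_f_f[OF cpc_inj] by auto
next
  fix x assume "x \<in> {x::complex^1. pt (aff i (x $ 1)) \<in> W}"
  then show "x \<in> cpc i ` (cpU i \<inter> W)"
    by (intro image_eqI[of _ _ "pt (aff i (x $ 1))"]) (auto simp: cpc_aff vec_nth_1)
qed

lemma CP1_ok: "atlas_ok CP1"
  unfolding atlas_ok_def
proof (intro conjI)
  show "\<forall>(U, c)\<in>CP1. inj_on c U \<and> open (c ` U)"
    unfolding CP1_charts using cpc_inj cpc_image by auto
  show "\<forall>(U, c)\<in>CP1. \<forall>(V, d)\<in>CP1. holo_on (d \<circ> inv_into U c) (c ` (U \<inter> V))"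
    unfolding CP1_charts
  proof (clarsimp)
    fix i j
    have e: "cpc i ` (cpU i \<inter> cpU j) = {x. aff i (x $ 1) $ j \<noteq> 0}" unfolding cpc_preimage by simp
    show "holo_on (cpc j \<circ> inv_into (cpU i) (cpc i)) (cpc i ` (cpU i \<inter> cpU j))"
      unfolding holo_on_iff e o_def cpc_inv cdiff_def cpc_pt
    proof (intro conjI ballI allI)
      have "continuous_on UNIV (\<lambda>x::complex^1. aff i (x $ 1) $ j)"
        using cdf_aff cdf_isCont by (blast intro: continuous_at_imp_continuous_on)
      then show "open {x::complex^1. aff i (x $ 1) $ j \<noteq> 0}"
        by (intro open_Collect_neq continuous_on_const)
    next
      fix x :: "complex^1" and l :: 1
      assume "x \<in> {x. aff i (x $ 1) $ j \<noteq> 0}"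
      then show "cdf (\<lambda>x. vec (aff i (x $ 1) $ (j + 1) / aff i (x $ 1) $ j) $ l) x"
        by (auto intro!: cdf_divide cdf_aff)
    qed
  qed
qed

lemma cpU_open: "openin (mtop CP1) (cpU i)"
  by (rule openin_chart[OF CP1_ok CP1_chart])

definition rho :: "2 \<Rightarrow> 2 \<Rightarrow> (complex^2) set \<Rightarrow> complex" where
  "rho i j p = (let y = (SOME y. y \<in> p) in y $ i / y $ j)"

lemma rho_pt [simp]: "rho i j (pt y) = y $ i / y $ j"
proof -
  obtain c where "c \<noteq> 0" "(SOME x. x \<in> pt y) = c *s y" using pt_some by blast
  then show ?thesis unfolding rho_def by (simp add: Let_def)
qed

lemma hol_at_rho: "p \<in> cpU j \<Longrightarrow> hol_at CP1 (rho i j) p"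
  by (rule hol_atI[OF CP1_ok CP1_chart[of j]]) (auto simp: cpc_inv intro!: cdf_aff)

section \<open>Classes in the total space of \<open>O(k)\<close> and sums of such bundles\<close>

lemma mem_tw: "(y, z) \<in> tw k y z"
  unfolding tw_def by (intro CollectI exI[of _ 1]) simp

lemma tw_scale: "c \<noteq> 0 \<Longrightarrow> tw k (c *s y) (c ^ k * z) = tw k y z"
  unfolding tw_def
proof (intro set_eqI iffI)
  fix x assume c: "c \<noteq> 0"
  show "x \<in> {(d *s (c *s y), d ^ k * (c ^ k * z)) |d. d \<noteq> 0} \<Longrightarrow> x \<in> {(c *s y, c ^ k * z) |c. c \<noteq> 0}"
  proof -
    assume "x \<in> {(d *s (c *s y), d ^ k * (c ^ k * z)) |d. d \<noteq> 0}"
    then obtain d where "x = (d *s (c *s y), d ^ k * (c ^ k * z))" "d \<noteq> 0" by blast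
    then show "x \<in> {(c *s y, c ^ k * z) |c. c \<noteq> 0}" using c
      by (intro CollectI exI[of _ "d * c"]) (simp add: vector_smult_assoc power_mult_distrib)
  qed
  assume "x \<in> {(c *s y, c ^ k * z) |c. c \<noteq> 0}"
  then obtain d where "x = (d *s y, d ^ k * z)" "d \<noteq> 0" by blast
  then show "x \<in> {(d *s (c *s y), d ^ k * (c ^ k * z)) |d. d \<noteq> 0}" using c
    by (intro CollectI exI[of _ "d / c"]) (simp add: vector_smult_assoc power_divide)
qed

lemma tw_eq_iff: "tw k y z = tw k y' z' \<longleftrightarrow> (\<exists>c. c \<noteq> 0 \<and> y' = c *s y \<and> z' = c ^ k * z)"
proof
  assume "tw k y z = tw k y' z'"
  then have "(y', z') \<in> tw k y z" using mem_tw by blast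
  then show "\<exists>c. c \<noteq> 0 \<and> y' = c *s y \<and> z' = c ^ k * z" unfolding tw_def by blast
qed (auto simp: tw_scale)

lemma tw_some: "\<exists>c. c \<noteq> 0 \<and> (SOME p. p \<in> tw k y z) = (c *s y, c ^ k * z)"
proof -
  have "(SOME p. p \<in> tw k y z) \<in> tw k y z" using someI[of "\<lambda>p. p \<in> tw k y z", OF mem_tw] .
  then show ?thesis unfolding tw_def by blast
qed

lemma tw_inj: "y \<noteq> 0 \<Longrightarrow> tw k y z = tw k y z' \<Longrightarrow> z = z'"
  unfolding tw_eq_iff
proof safe
  fix c assume y: "y \<noteq> 0" and c: "y = c *s y"
  obtain i where i: "y $ i \<noteq> 0" using y by (auto simp: vec_eq_iff)
  have "y $ i = c * y $ i" using c by (metis vector_smult_component)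
  then have "c = 1" using i by simp
  then show "z = c ^ k * z" by simp
qed

definition Otriv :: "nat \<Rightarrow> 2 \<Rightarrow> (complex^2) set \<Rightarrow> ((complex^2) \<times> complex) set \<Rightarrow> complex^1" where
  "Otriv k i = (\<lambda>l e. \<chi> _. let (y, z) = (SOME p. p \<in> e) in z / (y $ i) ^ k)"

lemma Otriv_tw [simp]: "Otriv k i l (tw k y z) = vec (z / (y $ i) ^ k)"
proof -
  obtain c where "c \<noteq> 0" "(SOME p. p \<in> tw k y z) = (c *s y, c ^ k * z)" using tw_some by blast
  then show ?thesis unfolding Otriv_def by (simp add: vec_eq_iff Let_def power_mult_distrib)
qed

lemma O_trivs: "trivs (O_bundle k) = {(cpU i, Otriv k i) | i. True}"
  unfolding O_bundle_def cpU_def Otriv_def by simp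

lemma O_fibre: "fibre (O_bundle k) (pt y) = {tw k y z | z. True}"
proof (intro set_eqI iffI)
  fix e assume "e \<in> fibre (O_bundle k) (pt y)"
  then obtain c z where e: "c \<noteq> 0" "e = tw k (c *s y) z" unfolding O_bundle_def pt_def by auto
  then have "e = tw k y (z / c ^ k)" using tw_scale[of c k y "z / c ^ k"] by simp
  then show "e \<in> {tw k y z | z. True}" by blast
next
  fix e assume "e \<in> {tw k y z | z. True}"
  then show "e \<in> fibre (O_bundle k) (pt y)" unfolding O_bundle_def using mem_pt by auto
qed

text \<open>The summands are trivialised over independently chosen charts, hence the two chart
  indices.\<close>

definition sumtriv :: "nat \<Rightarrow> nat \<Rightarrow> 2 \<Rightarrow> 2 \<Rightarrow> (complex^2) set \<Rightarrow>
    ((complex^2) \<times> complex) set \<times> ((complex^2) \<times> complex) set \<Rightarrow> complex^(1 + 1)" where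
  "sumtriv k l i j = (\<lambda>p (e, e'). \<chi> a. case a of Inl b \<Rightarrow> Otriv k i p e $ b | Inr b \<Rightarrow> Otriv l j p e' $ b)"

abbreviation OSum :: "nat \<Rightarrow> nat \<Rightarrow> ((complex^2) set, ((complex^2) \<times> complex) set \<times> ((complex^2) \<times> complex) set, 1 + 1) vbundle" where
  "OSum k l \<equiv> vb_sum (O_bundle k) (O_bundle l)"

lemma sum_trivs: "trivs (OSum k l) = {(cpU i \<inter> cpU j, sumtriv k l i j) | i j. True}"
proof -
  have "{(W \<inter> W', \<lambda>p (e, e'). \<chi> k. case k of Inl i \<Rightarrow> t p e $ i | Inr j \<Rightarrow> t' p e' $ j)
      | W t W' t'. (W, t) \<in> {(cpU i, Otriv k i) | i. True} \<and> (W', t') \<in> {(cpU i, Otriv l i) | i. True}}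
    = {(cpU i \<inter> cpU j, \<lambda>p (e, e'). \<chi> a. case a of Inl b \<Rightarrow> Otriv k i p e $ b | Inr b \<Rightarrow> Otriv l j p e' $ b) | i j. True}"
    by blast
  then show ?thesis unfolding vb_sum_def sumtriv_def O_trivs by simp
qed

lemma sum_fibre: "fibre (OSum k l) (pt y) = {(tw k y z, tw l y z') | z z'. True}"
  unfolding vb_sum_def by (auto simp: O_fibre)

lemma sumtriv_Inl [simp]: "sumtriv k l i j p (tw k y z, tw l y' z') $ Inl a = z / (y $ i) ^ k"
  and sumtriv_Inr [simp]: "sumtriv k l i j p (tw k y z, tw l y' z') $ Inr a = z' / (y' $ j) ^ l"
  unfolding sumtriv_def by simp_all

lemma vec_11_eq: "x = y \<longleftrightarrow> x $ Inl 1 = y $ Inl 1 \<and> x $ Inr 1 = y $ Inr 1" for x y :: "complex^(1+1)"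
  unfolding vec_eq_iff forall_Plus_1 ..

lemma sumtriv_bij:
  assumes "p \<in> cpU i \<inter> cpU j"
  shows "bij_betw (sumtriv k l i j p) (fibre (OSum k l) p) UNIV"
proof -
  obtain y where y: "p = pt y" "y $ i \<noteq> 0" using assms by (auto elim!: cpU_E)
  then have j: "y $ j \<noteq> 0" using assms by simp
  show ?thesis unfolding bij_betw_def y(1) sum_fibre
  proof
    show "inj_on (sumtriv k l i j (pt y)) {(tw k y z, tw l y z') |z z'. True}"
      using y(2) j by (intro inj_onI) (auto simp: vec_11_eq)
    have "v \<in> sumtriv k l i j (pt y) ` {(tw k y z, tw l y z') |z z'. True}" for v
      by (rule image_eqI[of _ _ "(tw k y (v $ Inl 1 * (y $ i) ^ k), tw l y (v $ Inr 1 * (y $ j) ^ l))"])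
        (use y(2) j in \<open>auto simp: vec_11_eq\<close>)
    then show "sumtriv k l i j (pt y) ` {(tw k y z, tw l y z') |z z'. True} = UNIV" by blast
  qed
qed

definition diag2 :: "complex \<Rightarrow> complex \<Rightarrow> complex^(1+1)^(1+1)" where
  "diag2 u v = (\<chi> a b. if a = b then (case a of Inl _ \<Rightarrow> u | Inr _ \<Rightarrow> v) else 0)"

lemma diag2_mv [simp]: "(diag2 u v *v x) $ Inl 1 = u * x $ Inl 1" "(diag2 u v *v x) $ Inr 1 = v * x $ Inr 1"
  unfolding mv_Plus_1 diag2_def by simp_all

lemma vector_bundle_sum: "vector_bundle CP1 (OSum k l)"
  unfolding vector_bundle_def
proof (intro conjI)
  have "\<Union> (fst ` trivs (OSum k l)) = (\<Union>i j. cpU i \<inter> cpU j)"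
  proof
    show "\<Union> (fst ` trivs (OSum k l)) \<subseteq> (\<Union>i j. cpU i \<inter> cpU j)"
    proof clarify
      fix x W t assume "(W, t) \<in> trivs (OSum k l)" "x \<in> fst (W, t)"
      then obtain i j where "W = cpU i \<inter> cpU j" "x \<in> W" unfolding sum_trivs by auto
      then show "x \<in> (\<Union>i j. cpU i \<inter> cpU j)" by blast
    qed
    show "(\<Union>i j. cpU i \<inter> cpU j) \<subseteq> \<Union> (fst ` trivs (OSum k l))"
    proof clarify
      fix x i j assume x: "x \<in> cpU i" "x \<in> cpU j"
      have "(cpU i \<inter> cpU j, sumtriv k l i j) \<in> trivs (OSum k l)"
        unfolding sum_trivs by blast
      then show "x \<in> \<Union> (fst ` trivs (OSum k l))"
        using x by (intro UN_I[of "(cpU i \<inter> cpU j, sumtriv k l i j)"]) simp_all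
    qed
  qed
  also have "\<dots> = points CP1"
  proof (intro set_eqI iffI)
    fix x :: "(complex^2) set" assume "x \<in> (\<Union>i j. cpU i \<inter> cpU j)"
    then obtain i where "x \<in> cpU i" by blast
    then show "x \<in> points CP1" using cpU_points by blast
  next
    fix x :: "(complex^2) set" assume "x \<in> points CP1"
    then obtain i where "x \<in> cpU i" using points_cpU by blast
    then show "x \<in> (\<Union>i j. cpU i \<inter> cpU j)" by blast
  qed
  finally show "\<Union> (fst ` trivs (OSum k l)) = points CP1" .
  show "\<forall>(W, t)\<in>trivs (OSum k l). openin (mtop CP1) W \<and>
     (\<forall>p\<in>W. bij_betw (t p) (fibre (OSum k l) p) UNIV)"
    unfolding sum_trivs using cpU_open sumtriv_bij by auto
  show "\<forall>(W, t)\<in>trivs (OSum k l). \<forall>(W', t')\<in>trivs (OSum k l).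
     \<exists>G::(complex^2) set \<Rightarrow> complex^(1+1)^(1+1). holo_matrix_on CP1 (W \<inter> W') G \<and>
        (\<forall>p\<in>W \<inter> W'. \<forall>e\<in>fibre (OSum k l) p. t' p e = G p *v t p e)"
    unfolding sum_trivs
  proof clarify
    fix i j i' j' :: 2
    define G where "G = (\<lambda>p. diag2 (rho i i' p ^ k) (rho j j' p ^ l))"
    have "hol_at CP1 (\<lambda>q. G q $ a $ b) p" if "p \<in> cpU i'" "p \<in> cpU j'" for p a b
      unfolding G_def diag2_def using that
      by (cases "a = b"; cases b) (auto intro!: hol_at_power hol_at_rho hol_at_const)
    then have "holo_matrix_on CP1 (cpU i \<inter> cpU j \<inter> (cpU i' \<inter> cpU j')) G"
      by (subst holo_matrix_on_iff[OF CP1_ok]) (use cpU_points in blast, auto intro!: openin_Int cpU_open)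
    moreover have "sumtriv k l i' j' p e = G p *v sumtriv k l i j p e"
      if p: "p \<in> cpU i \<inter> cpU j \<inter> (cpU i' \<inter> cpU j')" and e: "e \<in> fibre (OSum k l) p" for p e
    proof -
      obtain y where y: "p = pt y" "y $ i \<noteq> 0" using p by (auto elim!: cpU_E)
      then have "y $ j \<noteq> 0" "y $ i' \<noteq> 0" "y $ j' \<noteq> 0" using p by auto
      moreover obtain z z' where "e = (tw k y z, tw l y z')" using e unfolding y(1) sum_fibre by blast
      ultimately show ?thesis using y unfolding G_def by (simp add: vec_11_eq power_divide)
    qed
    ultimately show "\<exists>G::(complex^2) set \<Rightarrow> complex^(1+1)^(1+1). holo_matrix_on CP1 (cpU i \<inter> cpU j \<inter> (cpU i' \<inter> cpU j')) G \<and>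
        (\<forall>p\<in>cpU i \<inter> cpU j \<inter> (cpU i' \<inter> cpU j'). \<forall>e\<in>fibre (OSum k l) p. sumtriv k l i' j' p e = G p *v sumtriv k l i j p e)"
      by blast
  qed
qed

text \<open>A vector over \<open>pt y\<close> goes to the pair of classes with values
  \<open>(y $ i) ^ k\<close> times its first coordinate and \<open>(y $ i) ^ l\<close> times its
  second. The hypotheses make this independent of \<open>i\<close>, and rescaling \<open>y\<close>
  changes both values by the factors built into \<open>tw\<close>.\<close>

lemma vb_isomorphic_sumI:
  fixes E :: "((complex^2) set, 'e, 1 + 1) vbundle" and t :: "2 \<Rightarrow> (complex^2) set \<Rightarrow> 'e \<Rightarrow> complex^(1+1)"
  assumes E: "vector_bundle CP1 E" and t: "\<And>i. (cpU i, t i) \<in> trivs E"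
    and tk: "\<And>i j y e. y $ i \<noteq> 0 \<Longrightarrow> y $ j \<noteq> 0 \<Longrightarrow> e \<in> fibre E (pt y) \<Longrightarrow>
      (y $ i) ^ k * t i (pt y) e $ Inl 1 = (y $ j) ^ k * t j (pt y) e $ Inl 1"
    and tl: "\<And>i j y e. y $ i \<noteq> 0 \<Longrightarrow> y $ j \<noteq> 0 \<Longrightarrow> e \<in> fibre E (pt y) \<Longrightarrow>
      (y $ i) ^ l * t i (pt y) e $ Inr 1 = (y $ j) ^ l * t j (pt y) e $ Inr 1"
  shows "vb_isomorphic CP1 E (OSum k l)"
  unfolding vb_isomorphic_def
proof (intro conjI E vector_bundle_sum)
  define F where "F = (\<lambda>p e. let y = (SOME y. pt y = p); i = (SOME i. y $ i \<noteq> 0) in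
     (tw k y ((y $ i) ^ k * t i p e $ Inl 1), tw l y ((y $ i) ^ l * t i p e $ Inr 1)))"
  have F: "F (pt y) e = (tw k y ((y $ i) ^ k * t i (pt y) e $ Inl 1), tw l y ((y $ i) ^ l * t i (pt y) e $ Inr 1))"
    if i: "y $ i \<noteq> 0" and e: "e \<in> fibre E (pt y)" for y e i
  proof -
    define y' where "y' = (SOME y'. pt y' = pt y)"
    have "pt y' = pt y" unfolding y'_def by (rule someI[of _ y]) simp
    then obtain c where c: "c \<noteq> 0" "y' = c *s y" using pt_eq_iff[of y y'] by metis
    define j where "j = (SOME j. y' $ j \<noteq> 0)"
    have "y' $ j \<noteq> 0" unfolding j_def by (rule someI[of _ i]) (use c i in simp)
    then have j: "y $ j \<noteq> 0" using c by simp
    have "F (pt y) e = (tw k y' ((y' $ j) ^ k * t j (pt y) e $ Inl 1), tw l y' ((y' $ j) ^ l * t j (pt y) e $ Inr 1))"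
      unfolding F_def Let_def y'_def[symmetric] j_def[symmetric] ..
    also have "\<dots> = (tw k y ((y $ j) ^ k * t j (pt y) e $ Inl 1), tw l y ((y $ j) ^ l * t j (pt y) e $ Inr 1))"
      using tw_scale[OF c(1), of k y "(y $ j) ^ k * t j (pt y) e $ Inl 1"]
        tw_scale[OF c(1), of l y "(y $ j) ^ l * t j (pt y) e $ Inr 1"]
      unfolding c(2) by (simp add: power_mult_distrib mult.assoc)
    finally show ?thesis using tk[OF j i e] tl[OF j i e] by simp
  qed
  have tbij: "bij_betw (t i p) (fibre E p) UNIV" if "p \<in> cpU i" for i p
    using E t[of i] that unfolding vector_bundle_def by fast
  have Fbij: "bij_betw (F p) (fibre E p) (fibre (OSum k l) p)" if p: "p \<in> points CP1" for p
  proof -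
    obtain i where "p \<in> cpU i" using p points_cpU by blast
    then obtain y where y: "p = pt y" "y $ i \<noteq> 0" by (auto elim!: cpU_E)
    have y0: "y \<noteq> 0" using y(2) by auto
    have b: "bij_betw (t i (pt y)) (fibre E (pt y)) UNIV" using tbij y by simp
    show ?thesis unfolding y(1) bij_betw_def sum_fibre
    proof
      show "inj_on (F (pt y)) (fibre E (pt y))"
      proof (rule inj_onI)
        fix e e' assume e: "e \<in> fibre E (pt y)" "e' \<in> fibre E (pt y)" and "F (pt y) e = F (pt y) e'"
        then have "t i (pt y) e $ Inl 1 = t i (pt y) e' $ Inl 1" "t i (pt y) e $ Inr 1 = t i (pt y) e' $ Inr 1"
          using F[OF y(2) e(1)] F[OF y(2) e(2)] y(2) by (auto dest!: tw_inj[OF y0])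
        then have "t i (pt y) e = t i (pt y) e'" by (simp add: vec_11_eq)
        then show "e = e'" using b e unfolding bij_betw_def by (auto dest: inj_onD)
      qed
      show "F (pt y) ` fibre E (pt y) = {(tw k y z, tw l y z') |z z'. True}"
      proof
        show "F (pt y) ` fibre E (pt y) \<subseteq> {(tw k y z, tw l y z') |z z'. True}" using F[OF y(2)] by auto
        show "{(tw k y z, tw l y z') |z z'. True} \<subseteq> F (pt y) ` fibre E (pt y)"
        proof clarify
          fix z z'
          define v :: "complex^(1+1)" where "v = (\<chi> a. case a of Inl _ \<Rightarrow> z / (y $ i) ^ k | Inr _ \<Rightarrow> z' / (y $ i) ^ l)"
          obtain e where e: "e \<in> fibre E (pt y)" "t i (pt y) e = v" using b unfolding bij_betw_def by (metis UNIV_I imageE)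
          have "F (pt y) e = (tw k y z, tw l y z')" unfolding F[OF y(2) e(1)] e(2) v_def using y(2) by simp
          then show "(tw k y z, tw l y z') \<in> F (pt y) ` fibre E (pt y)" using e(1) by force
        qed
      qed
    qed
  qed
  have hol: "\<exists>G::(complex^2) set \<Rightarrow> complex^(1+1)^(1+1). holo_matrix_on CP1 (W \<inter> (cpU i \<inter> cpU j)) G \<and>
           (\<forall>p\<in>W \<inter> (cpU i \<inter> cpU j). \<forall>e\<in>fibre E p. sumtriv k l i j p (F p e) = G p *v t' p e)"
    if t': "(W, t') \<in> trivs E" for W t' i j
  proof -
    have W: "openin (mtop CP1) W" using E t' unfolding vector_bundle_def by fast
    have Wp: "W \<subseteq> points CP1" using W openin_mtop_iff[OF CP1_ok] by blast
    have "\<exists>G::(complex^2) set \<Rightarrow> complex^(1+1)^(1+1). holo_matrix_on CP1 (W \<inter> cpU i) G \<and> (\<forall>p\<in>W \<inter> cpU i. \<forall>e\<in>fibre E p. t i p e = G p *v t' p e)" for i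
      using E t' t[of i] unfolding vector_bundle_def by fast
    then obtain G :: "2 \<Rightarrow> (complex^2) set \<Rightarrow> complex^(1+1)^(1+1)" where
      G: "\<And>i. holo_matrix_on CP1 (W \<inter> cpU i) (G i)" "\<And>i p e. p \<in> W \<inter> cpU i \<Longrightarrow> e \<in> fibre E p \<Longrightarrow> t i p e = G i p *v t' p e"
      by metis
    have Gh: "hol_at CP1 (\<lambda>q. G i q $ a $ b) p" if "p \<in> W" "p \<in> cpU i" for i p a b
      using G(1)[of i] that holo_matrix_on_iff[OF CP1_ok, of "W \<inter> cpU i"] Wp by blast
    \<comment> \<open>The two summands may be trivialised over different charts, so the first row is
      taken from \<open>G i\<close> and the second from \<open>G j\<close>.\<close>
    define H where "H = (\<lambda>p. (\<chi> a b. case a of Inl _ \<Rightarrow> G i p $ a $ b | Inr _ \<Rightarrow> G j p $ a $ b) :: complex^(1+1)^(1+1))"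
    have Hh: "hol_at CP1 (\<lambda>q. H q $ a $ b) p" if "p \<in> W" "p \<in> cpU i" "p \<in> cpU j" for p a b
      unfolding H_def using Gh that by (cases a) auto
    have "holo_matrix_on CP1 (W \<inter> (cpU i \<inter> cpU j)) H"
      by (subst holo_matrix_on_iff[OF CP1_ok]) (use W Wp cpU_open Hh in auto)
    moreover have "sumtriv k l i j p (F p e) = H p *v t' p e" if p: "p \<in> W" "p \<in> cpU i" "p \<in> cpU j" and e: "e \<in> fibre E p" for p e
    proof -
      obtain y where y: "p = pt y" "y $ i \<noteq> 0" using p by (auto elim!: cpU_E)
      have j: "y $ j \<noteq> 0" using p(3) y by simp
      have e': "e \<in> fibre E (pt y)" using e y by simp
      have "sumtriv k l i j p (F p e) $ Inl 1 = t i p e $ Inl 1"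
        unfolding y(1) F[OF y(2) e'] using y(2) by simp
      moreover have "sumtriv k l i j p (F p e) $ Inr 1 = t j p e $ Inr 1"
        unfolding y(1) F[OF j e'] using j by simp
      moreover have "t i p e = G i p *v t' p e" "t j p e = G j p *v t' p e" using G(2) p e by auto
      ultimately show ?thesis unfolding vec_11_eq H_def mv_Plus_1 by simp
    qed
    ultimately show ?thesis by blast
  qed
  have "\<forall>(W, t)\<in>trivs E. \<forall>(W', t')\<in>trivs (OSum k l). \<exists>G::(complex^2) set \<Rightarrow> complex^(1+1)^(1+1).
           holo_matrix_on CP1 (W \<inter> W') G \<and>
           (\<forall>p\<in>W \<inter> W'. \<forall>e\<in>fibre E p. t' p (F p e) = G p *v t p e)"
    unfolding sum_trivs using hol by blast
  then show "\<exists>F. (\<forall>p\<in>points CP1. bij_betw (F p) (fibre E p) (fibre (OSum k l) p)) \<and>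
        (\<forall>(W, t)\<in>trivs E. \<forall>(W', t')\<in>trivs (OSum k l). \<exists>G::(complex^2) set \<Rightarrow> complex^(1+1)^(1+1).
           holo_matrix_on CP1 (W \<inter> W') G \<and>
           (\<forall>p\<in>W \<inter> W'. \<forall>e\<in>fibre E p. t' p (F p e) = G p *v t p e))"
    using Fbij by blast
qed

section \<open>Lifting through an embedding\<close>

lemma crep_isCont:
  assumes M: "atlas_ok M" and N: "atlas_ok N" and f: "continuous_map (mtop M) (mtop N) f"
    and C: "(U, c) \<in> M" "p \<in> U" and D: "(V, d) \<in> N" "f p \<in> V"
  shows "isCont (crep U c f d) (c p)"
  unfolding continuous_at_open
proof (intro allI impI)
  fix t assume t: "open t \<and> crep U c f d (c p) \<in> t"
  define W where "W = {q \<in> V. d q \<in> t}"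
  have W: "openin (mtop N) W" unfolding W_def by (rule openin_chart_preimage[OF N D(1)]) (use t in blast)
  have "f p \<in> W" using t D(2) chart_inv[OF M C] unfolding W_def by simp
  then show "\<exists>s. open s \<and> c p \<in> s \<and> (\<forall>x'\<in>s. crep U c f d x' \<in> t)"
    using continuous_map_chart_open[OF M N f C(1) W] C chart_inv[OF M C(1)] unfolding W_def
    by (intro exI[of _ "c ` (U \<inter> f -` W)"]) (auto simp: W_def)
qed

text \<open>The inverse of \<open>f\<close> on its image is continuous since \<open>f\<close> is a
  topological embedding, so the lift is continuous; injectivity of the differential then makes it
  holomorphic by \<open>cdiff_lift\<close>.\<close>

lemma embedding_lift:
  fixes f :: "'b \<Rightarrow> 'c" and g :: "'a \<Rightarrow> 'c"
  assumes A: "atlas_ok A" and B: "atlas_ok B" and C: "atlas_ok C"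
    and f: "holomorphic_embedding B C f" and g: "holomorphic_map A C g"
    and sub: "g ` points A \<subseteq> f ` points B"
  defines "h \<equiv> (\<lambda>p. inv_into (points B) f (g p))"
  shows "holomorphic_map A B h" "\<And>p. p \<in> points A \<Longrightarrow> h p \<in> points B" "\<And>p. p \<in> points A \<Longrightarrow> f (h p) = g p"
proof -
  show hp: "h p \<in> points B" "f (h p) = g p" if "p \<in> points A" for p
    using that sub unfolding h_def by (auto intro!: inv_into_into f_inv_into_f)
  have fm: "continuous_map (mtop B) (mtop C) f" "\<And>p. p \<in> points B \<Longrightarrow> hmap_at B C f p"
    using f unfolding holomorphic_embedding_def holomorphic_map_iff[OF B C] by auto
  have gm: "continuous_map (mtop A) (mtop C) g" "\<And>p. p \<in> points A \<Longrightarrow> hmap_at A C g p"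
    using g unfolding holomorphic_map_iff[OF A C] by auto
  have "homeomorphic_map (mtop B) (subtopology (mtop C) (f ` points B)) f"
    using f unfolding holomorphic_embedding_def embedding_map_def topspace_mtop[OF B] by blast
  then obtain k where k: "homeomorphic_maps (mtop B) (subtopology (mtop C) (f ` points B)) f k"
    unfolding homeomorphic_map_maps by blast
  have kf: "k (f p) = p" if "p \<in> points B" for p
    using k that unfolding homeomorphic_maps_def topspace_mtop[OF B] by blast
  have "continuous_map (mtop A) (subtopology (mtop C) (f ` points B)) g"
    using gm(1) sub by (simp add: continuous_map_in_subtopology topspace_mtop[OF A] image_subset_iff_funcset)
  then have kg: "continuous_map (mtop A) (mtop B) (k \<circ> g)"
    using k unfolding homeomorphic_maps_def by (blast intro: continuous_map_compose)
  have "(k \<circ> g) p = h p" if "p \<in> points A" for p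
    using kf[OF hp(1)[OF that]] hp(2)[OF that] by simp
  then have hc: "continuous_map (mtop A) (mtop B) h"
    using continuous_map_eq[OF kg] by (simp add: topspace_mtop[OF A])
  have "hmap_at A B h p" if p: "p \<in> points A" for p
    unfolding hmap_at_def
  proof (intro ballI, clarify)
    fix V d j assume D: "(V, d) \<in> B" "h p \<in> V"
    obtain U c where U: "(U, c) \<in> A" "p \<in> U" using chart_point[OF A p] by blast
    have "f (h p) \<in> points C" using gm(1) hp(2)[OF p] p unfolding continuous_map_def topspace_mtop[OF A] topspace_mtop[OF C] by auto
    then obtain W e where E: "(W, e) \<in> C" "f (h p) \<in> W" using chart_point[OF C] by blast
    have hcp: "crep U c h d (c p) = d (h p)" using chart_inv[OF A U] by simp
    have F: "cdiff (crep V d f e) (crep U c h d (c p))"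
      unfolding hcp by (rule hmap_at_chart[OF fm(2)[OF hp(1)[OF p]] D E])
    have inj: "inj (\<lambda>v. jac (crep V d f e) (crep U c h d (c p)) *v v)"
    proof (rule injI)
      fix v w assume "jac (crep V d f e) (crep U c h d (c p)) *v v = jac (crep V d f e) (crep U c h d (c p)) *v w"
      then have "jac (crep V d f e) (d (h p)) *v (v - w) = 0" unfolding hcp by (simp add: matrix_vector_mult_diff_distrib)
      then have "v - w = 0" by (rule embedding_jac_inj[OF B C f D E])
      then show "v = w" by simp
    qed
    have "cdiff (crep U c g e) (c p)"
      by (rule hmap_at_chart[OF gm(2)[OF p] U E(1)]) (use E(2) hp(2)[OF p] in simp)
    moreover have "cdiff (\<lambda>y. crep V d f e (crep U c h d y)) (c p) \<longleftrightarrow> cdiff (crep U c g e) (c p)"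
    proof (rule cdiff_cong_open[OF continuous_map_chart_open[OF A B hc U(1) openin_chart[OF B D(1)]]])
      show "c p \<in> c ` (U \<inter> h -` V)" using U D by blast
      fix y assume "y \<in> c ` (U \<inter> h -` V)"
      then obtain q where q: "y = c q" "q \<in> U" "h q \<in> V" by blast
      then have "q \<in> points A" using chart_subset[OF A U(1)] by blast
      then show "crep V d f e (crep U c h d y) = crep U c g e y"
        using hp(2) q chart_inv[OF A U(1) q(2)] chart_inv[OF B D(1) q(3)] by simp
    qed
    ultimately have "cdiff (crep U c h d) (c p)"
      using cdiff_lift[OF F inj crep_isCont[OF A B hc U D]] by blast
    then show "hol_at A (\<lambda>q. d (h q) $ j) p"
      unfolding cdiff_def by (intro hol_atI[OF A U]) blast
  qed
  then show "holomorphic_map A B h" unfolding holomorphic_map_iff[OF A B] using hc by blast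
qed

section \<open>Topology of the projective line\<close>

abbreviation ch :: "2 \<Rightarrow> complex^1 \<Rightarrow> (complex^2) set" where
  "ch i x \<equiv> pt (aff i (x $ 1))"

lemma openin_CP1: "openin (mtop CP1) W \<longleftrightarrow> W \<subseteq> points CP1 \<and> (\<forall>i. open {x. ch i x \<in> W})"
proof -
  have "(\<forall>(U, c)\<in>CP1. open (c ` (U \<inter> W))) \<longleftrightarrow> (\<forall>i. open (cpc i ` (cpU i \<inter> W)))"
    unfolding CP1_charts by blast
  then show ?thesis unfolding openin_mtop_iff[OF CP1_ok] cpc_preimage by simp
qed

lemma ch_cpU: "ch i x \<in> cpU i"
  by simp

lemma ch_points: "ch i x \<in> points CP1"
  using cpU_points ch_cpU by blast

lemma ch_surj: "p \<in> cpU i \<Longrightarrow> \<exists>x. p = ch i x"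
  by (metis chart_inv[OF CP1_ok CP1_chart] cpc_inv)

lemma ch_inj: "inj (ch i)"
proof (rule injI)
  fix x y assume "ch i x = ch i y"
  then have "cpc i (ch i x) = cpc i (ch i y)" by simp
  then show "x = y" by (simp only: cpc_aff vec_nth_1)
qed

lemma ch_continuous: "continuous_map euclidean (mtop CP1) (ch i)"
  unfolding continuous_map_def topspace_mtop[OF CP1_ok]
  using ch_points openin_CP1 by auto

lemma two_eq_0: "(2 :: 2) = 0"
  by simp

text \<open>Dividing the smaller homogeneous coordinate by the larger one places every point in one
  of two closed unit discs.\<close>

lemma compact_CP1: "compact_space (mtop CP1)"
proof -
  have n: "norm (x :: complex^1) = norm (x $ 1)" for x
    by (simp add: norm_vec_def L2_set_def UNIV_1)
  have c: "compactin (mtop CP1) (ch i ` cball 0 1)" for i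
    by (rule image_compactin[OF _ ch_continuous]) simp
  have "points CP1 \<subseteq> ch 0 ` cball 0 1 \<union> ch 1 ` cball 0 1"
  proof
    fix p assume "p \<in> points CP1"
    then obtain y where y: "p = pt y" "y \<noteq> 0" unfolding CP1_points by blast
    define i where "i = (if norm (y $ 1) \<le> norm (y $ 0) then 0 else 1 :: 2)"
    have i: "norm (y $ (i + 1)) \<le> norm (y $ i)" unfolding i_def by (simp add: two_eq_0)
    have yi: "y $ i \<noteq> 0" using i y(2) vec2_eq_iff[of y 0 i] by auto
    have "p = ch i (vec (y $ (i + 1) / y $ i))" using pt_aff[OF yi] y(1) by simp
    moreover have "vec (y $ (i + 1) / y $ i) \<in> cball (0 :: complex^1) 1"
      using i yi by (simp add: n norm_divide divide_simps)
    ultimately have "p \<in> ch i ` cball 0 1" by blast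
    then show "p \<in> ch 0 ` cball 0 1 \<union> ch 1 ` cball 0 1" unfolding i_def by (auto split: if_splits)
  qed
  then have "points CP1 = ch 0 ` cball 0 1 \<union> ch 1 ` cball 0 1" using ch_points by auto
  then show ?thesis unfolding compact_space_def topspace_mtop[OF CP1_ok] using compactin_Un[OF c c] by simp
qed

text \<open>Off the finite intersection the complements of \<open>B1\<close> and \<open>B2\<close>
  are disjoint open sets covering a connected part of the affine line, so one of them misses it. The
  point at infinity follows because a single point is not open.\<close>

lemma CP1_closed_cover:
  assumes B1: "closedin (mtop CP1) B1" and B2: "closedin (mtop CP1) B2"
    and cov: "points CP1 \<subseteq> B1 \<union> B2" and fin: "finite (B1 \<inter> B2)"
  shows "points CP1 \<subseteq> B1 \<or> points CP1 \<subseteq> B2"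
proof -
  have op: "open {x. ch i x \<notin> B}" if "closedin (mtop CP1) B" for i B
  proof -
    have "openin (mtop CP1) (points CP1 - B)" using that by (simp add: closedin_def topspace_mtop[OF CP1_ok])
    then have "open {x. ch i x \<in> points CP1 - B}" unfolding openin_CP1 by blast
    then show ?thesis using ch_points by simp
  qed
  have extend: "points CP1 \<subseteq> B" if B: "closedin (mtop CP1) B" and 0: "\<And>x. ch 0 x \<in> B" for B
  proof -
    have "ch 1 x \<in> B" if "x $ 1 \<noteq> 0" for x
    proof -
      have "ch 1 x \<in> cpU 0" using that by (simp add: aff_def)
      then obtain x' where "ch 1 x = ch 0 x'" using ch_surj by blast
      then show ?thesis using 0[of x'] by (simp only:)
    qed
    then have "x = 0" if "ch 1 x \<notin> B" for x using that by (metis vec_nth_1 vec_0)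
    then have "{x. ch 1 x \<notin> B} \<subseteq> {0}" by blast
    moreover have "\<not> open {0 :: complex^1}" by (rule not_open_singleton)
    ultimately have "{x. ch 1 x \<notin> B} = {}" using op[OF B, of 1] by (metis subset_singletonD)
    then have "ch i x \<in> B" for i x using 0 two_cases[of i 0] by auto
    then show ?thesis using points_cpU ch_surj by (metis subsetI)
  qed
  define U V where "U = {x. ch 0 x \<notin> B1}" and "V = {x. ch 0 x \<notin> B2}"
  define A where "A = (UNIV :: (complex^1) set) - {x. ch 0 x \<in> B1 \<inter> B2}"
  have "finite (ch 0 -` (B1 \<inter> B2))" using fin ch_inj by (rule finite_vimageI)
  then have "countable {x. ch 0 x \<in> B1 \<inter> B2}" by (auto simp: vimage_def intro: countable_finite)
  \<comment> \<open>\<open>complex^1\<close> has real dimension two, so removing finitely many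
    points leaves it connected.\<close>
  then have "connected A" unfolding A_def
    by (intro connected_open_diff_countable) (auto simp: )
  moreover have "A \<subseteq> U \<union> V" "U \<inter> V \<inter> A = {}" using cov ch_points unfolding A_def U_def V_def by blast+
  ultimately have "U \<inter> A = {} \<or> V \<inter> A = {}" using op[OF B1] op[OF B2] unfolding U_def V_def by (metis connectedD)
  then show ?thesis
  proof
    assume "U \<inter> A = {}"
    then have "ch 0 x \<in> B1" for x unfolding U_def A_def by blast
    then show ?thesis using extend[OF B1] by blast
  next
    assume "V \<inter> A = {}"
    then have "ch 0 x \<in> B2" for x unfolding V_def A_def by blast
    then show ?thesis using extend[OF B2] by blast
  qed
qed

section \<open>Curves in a Hausdorff space parametrised by the projective line\<close>

lemma CP1_nonempty: "points CP1 \<noteq> {}"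
  using ch_points by blast

lemma CP1_image_closed:
  assumes "Hausdorff_space Y" "continuous_map (mtop CP1) Y f"
  shows "closedin Y (f ` points CP1)"
proof -
  have "compactin (mtop CP1) (points CP1)" using compact_CP1 unfolding compact_space_def topspace_mtop[OF CP1_ok] .
  then show ?thesis using compactin_imp_closedin[OF assms(1)] image_compactin[OF _ assms(2)] by blast
qed

lemma CP1_embedding:
  assumes "Hausdorff_space Y" "continuous_map (mtop CP1) Y f" "inj_on f (points CP1)"
  shows "embedding_map (mtop CP1) Y f"
  using assms compact_CP1
  by (intro injective_closed_imp_embedding_map continuous_imp_closed_map) (auto simp: topspace_mtop[OF CP1_ok])

text \<open>By invariance of domain, the smaller curve is open in the larger one.\<close>

lemma CP1_image_subset_eq:
  assumes Y: "Hausdorff_space Y" and f: "continuous_map (mtop CP1) Y f" "inj_on f (points CP1)"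
    and g: "continuous_map (mtop CP1) Y g" "inj_on g (points CP1)"
    and sub: "f ` points CP1 \<subseteq> g ` points CP1"
  shows "f ` points CP1 = g ` points CP1"
proof -
  let ?P = "points CP1"
  define m where "m = (\<lambda>p. inv_into ?P g (f p))"
  have mp: "m p \<in> ?P" "g (m p) = f p" if "p \<in> ?P" for p
    using that sub unfolding m_def by (auto intro!: inv_into_into f_inv_into_f)
  have "homeomorphic_map (mtop CP1) (subtopology Y (g ` ?P)) g"
    using CP1_embedding[OF Y g] unfolding embedding_map_def topspace_mtop[OF CP1_ok] .
  then obtain k where k: "homeomorphic_maps (mtop CP1) (subtopology Y (g ` ?P)) g k"
    unfolding homeomorphic_map_maps by blast
  have kg: "k (g p) = p" if "p \<in> ?P" for p
    using k that unfolding homeomorphic_maps_def topspace_mtop[OF CP1_ok] by blast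
  have "continuous_map (mtop CP1) (subtopology Y (g ` ?P)) f"
    using f(1) sub by (simp add: continuous_map_in_subtopology topspace_mtop[OF CP1_ok] image_subset_iff_funcset)
  then have kf: "continuous_map (mtop CP1) (mtop CP1) (k \<circ> f)"
    using k unfolding homeomorphic_maps_def by (blast intro: continuous_map_compose)
  have "(k \<circ> f) p = m p" if "p \<in> ?P" for p
    using kg[OF mp(1)[OF that]] mp(2)[OF that] by simp
  then have mc: "continuous_map (mtop CP1) (mtop CP1) m"
    using continuous_map_eq[OF kf] by (simp add: topspace_mtop[OF CP1_ok])
  have minj: "inj_on m ?P" using mp(2) f(2) by (metis inj_on_def)
  have "m ` ?P = {q \<in> topspace (mtop CP1). g q \<in> f ` ?P}"
    unfolding topspace_mtop[OF CP1_ok]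
  proof (intro set_eqI iffI)
    fix q assume "q \<in> m ` ?P"
    then obtain p where "p \<in> ?P" "q = m p" by blast
    then show "q \<in> {q \<in> ?P. g q \<in> f ` ?P}" using mp[of p] by simp
  next
    fix q assume "q \<in> {q \<in> ?P. g q \<in> f ` ?P}"
    then obtain p where p: "q \<in> ?P" "p \<in> ?P" "g q = f p" by blast
    then have "q = m p" using mp[of p] g(2) by (simp add: inj_onD)
    then show "q \<in> m ` ?P" using p(2) by blast
  qed
  then have cl: "closedin (mtop CP1) (m ` ?P)"
    using closedin_continuous_map_preimage[OF g(1) CP1_image_closed[OF Y f(1)]] by simp
  have "openin (mtop CP1) (m ` ?P)"
    unfolding openin_subopen[of _ "m ` ?P"]
  proof
    fix q assume "q \<in> m ` ?P"
    then obtain p where p: "p \<in> ?P" "q = m p" by blast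
    obtain i where i: "p \<in> cpU i" using p(1) points_cpU by blast
    obtain j where j: "q \<in> cpU j" using mp(1)[OF p(1)] p(2) points_cpU by blast
    define S where "S = cpc i ` (cpU i \<inter> m -` cpU j)"
    define h where "h = crep (cpU i) (cpc i) m (cpc j)"
    have S: "open S" unfolding S_def by (rule continuous_map_chart_open[OF CP1_ok CP1_ok mc CP1_chart cpU_open])
    have inv: "inv_into (cpU i) (cpc i) (cpc i r) = r" if "r \<in> cpU i" for r using chart_inv[OF CP1_ok CP1_chart that] .
    have "continuous_on S h"
    proof (intro continuous_at_imp_continuous_on ballI)
      fix x assume "x \<in> S"
      then obtain r where r: "r \<in> cpU i" "m r \<in> cpU j" "x = cpc i r" unfolding S_def by auto
      show "isCont h x" unfolding h_def r(3) by (rule crep_isCont[OF CP1_ok CP1_ok mc CP1_chart r(1) CP1_chart r(2)])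
    qed
    moreover have "inj_on h S"
    proof (rule inj_onI)
      fix x y assume "x \<in> S" "y \<in> S" and e: "h x = h y"
      then obtain r r' where r: "r \<in> cpU i" "m r \<in> cpU j" "x = cpc i r" "r' \<in> cpU i" "m r' \<in> cpU j" "y = cpc i r'"
        unfolding S_def by auto
      have "cpc j (m r) = cpc j (m r')" using e unfolding h_def r(3,6) inv[OF r(1)] inv[OF r(4)] .
      then have "m r = m r'" using cpc_inj r(2,5) by (meson inj_onD)
      then have "r = r'" using minj r(1,4) cpU_points by (meson inj_onD subsetD)
      then show "x = y" using r by simp
    qed
    ultimately have hS: "open (h ` S)" using invariance_of_domain S by blast
    define T where "T = {r \<in> cpU j. cpc j r \<in> h ` S}"
    have "openin (mtop CP1) T" unfolding T_def by (rule openin_chart_preimage[OF CP1_ok CP1_chart hS])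
    moreover have "q \<in> T"
    proof -
      have "h (cpc i p) = cpc j q" unfolding h_def inv[OF i] p(2) ..
      moreover have "cpc i p \<in> S" unfolding S_def using i j p(2) by blast
      ultimately show ?thesis unfolding T_def using j by (metis (mono_tags, lifting) image_eqI mem_Collect_eq)
    qed
    moreover have "T \<subseteq> m ` ?P"
    proof
      fix r assume "r \<in> T"
      then obtain r' where r: "r \<in> cpU j" "r' \<in> cpU i" "m r' \<in> cpU j" "cpc j r = h (cpc i r')"
        unfolding T_def S_def by auto
      have "cpc j r = cpc j (m r')" using r(4) unfolding h_def inv[OF r(2)] .
      then have "r = m r'" using cpc_inj r(1,3) by (meson inj_onD)
      then show "r \<in> m ` ?P" using r(2) cpU_points by blast
    qed
    ultimately show "\<exists>T. openin (mtop CP1) T \<and> q \<in> T \<and> T \<subseteq> m ` ?P" by blast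
  qed
  \<comment> \<open>The image of \<open>m\<close> is now both open and closed. Connectedness of the
    projective line is the case of an empty intersection in \<open>CP1_closed_cover\<close>.\<close>
  then have cl': "closedin (mtop CP1) (?P - m ` ?P)" using closedin_diff closedin_topspace topspace_mtop[OF CP1_ok] by metis
  have "m ` ?P \<inter> (?P - m ` ?P) = {}" "?P \<subseteq> m ` ?P \<union> (?P - m ` ?P)" by blast+
  then have "?P \<subseteq> m ` ?P \<or> ?P \<subseteq> ?P - m ` ?P" using CP1_closed_cover[OF cl cl'] by (metis finite.emptyI)
  moreover obtain p0 where "p0 \<in> ?P" using CP1_nonempty by blast
  moreover from this have "m p0 \<in> ?P" "m p0 \<in> m ` ?P" using mp(1) by auto
  ultimately have "?P \<subseteq> m ` ?P" by blast
  have "g ` ?P \<subseteq> f ` ?P"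
  proof clarify
    fix p assume "p \<in> ?P"
    then obtain p' where "p' \<in> ?P" "p = m p'" using \<open>?P \<subseteq> m ` ?P\<close> by blast
    then show "g p \<in> f ` ?P" using mp(2)[of p'] by simp
  qed
  then show ?thesis using sub by blast
qed

text \<open>The preimages of the two curves under \<open>f\<close> are closed, cover the projective
  line and meet in a finite set, so one of them is everything; containment is then equality by
  \<open>CP1_image_subset_eq\<close>.\<close>

lemma CP1_image_in_union:
  assumes Y: "Hausdorff_space Y" and f: "continuous_map (mtop CP1) Y f" "inj_on f (points CP1)"
    and g: "continuous_map (mtop CP1) Y g" "inj_on g (points CP1)"
    and h: "continuous_map (mtop CP1) Y h" "inj_on h (points CP1)"
    and sub: "f ` points CP1 \<subseteq> g ` points CP1 \<union> h ` points CP1"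
    and fin: "finite (g ` points CP1 \<inter> h ` points CP1)"
  shows "f ` points CP1 = g ` points CP1 \<or> f ` points CP1 = h ` points CP1"
proof -
  define B where "B = (\<lambda>k. {p \<in> topspace (mtop CP1). f p \<in> k ` points CP1})"
  have cl: "closedin (mtop CP1) (B k)" if "continuous_map (mtop CP1) Y k" for k
    unfolding B_def by (rule closedin_continuous_map_preimage[OF f(1) CP1_image_closed[OF Y that]])
  have "f ` (B g \<inter> B h) \<subseteq> g ` points CP1 \<inter> h ` points CP1" unfolding B_def by auto
  moreover have "inj_on f (B g \<inter> B h)" using f(2) unfolding B_def topspace_mtop[OF CP1_ok] by (rule inj_on_subset) auto
  ultimately have "finite (B g \<inter> B h)" using fin by (meson finite_imageD finite_subset)
  then have "points CP1 \<subseteq> B g \<or> points CP1 \<subseteq> B h"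
    by (rule CP1_closed_cover[OF cl[OF g(1)] cl[OF h(1)], rotated]) (use sub in \<open>auto simp: B_def topspace_mtop[OF CP1_ok]\<close>)
  then have "f ` points CP1 \<subseteq> g ` points CP1 \<or> f ` points CP1 \<subseteq> h ` points CP1"
    unfolding B_def by auto
  then show ?thesis using CP1_image_subset_eq[OF Y f g] CP1_image_subset_eq[OF Y f h] by blast
qed

section \<open>The splitting types \<open>(1, 1)\<close> and \<open>(0, 2)\<close> are different\<close>

text \<open>Global sections of \<open>O(1)\<close> are linear forms. Boundedness of
  \<open>g 1\<close> on the unit disc gives \<open>g 0\<close> at most linear growth, and
  Liouville's theorem leaves a polynomial of degree at most one.\<close>

lemma O1_section:
  fixes \<tau> :: "2 \<Rightarrow> (complex^2) set \<Rightarrow> complex"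
  assumes hol: "\<And>i p. p \<in> cpU i \<Longrightarrow> hol_at CP1 (\<tau> i) p"
    and rel: "\<And>i j y. y $ i \<noteq> 0 \<Longrightarrow> y $ j \<noteq> 0 \<Longrightarrow> y $ i * \<tau> i (pt y) = y $ j * \<tau> j (pt y)"
  shows "\<exists>\<alpha> \<beta>. \<forall>i y. y $ i \<noteq> 0 \<longrightarrow> y $ i * \<tau> i (pt y) = \<alpha> * y $ 0 + \<beta> * y $ 1"
proof -
  define g where "g = (\<lambda>i w. \<tau> i (pt (aff i w)))"
  have fd: "g i field_differentiable at w" for i w
  proof -
    have "cdf (\<lambda>x. \<tau> i (inv_into (cpU i) (cpc i) x)) (cpc i (ch i (vec w)))"
      using hol[of "ch i (vec w)" i] CP1_chart[of i] unfolding hol_at_def by auto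
    then have "cdf (\<lambda>x::complex^1. \<tau> i (ch i x)) (vec w)" by (simp add: cpc_inv cpc_aff)
    from cdf_vec_1[OF this] show ?thesis unfolding g_def by simp
  qed
  have holo: "g i holomorphic_on UNIV" for i using fd unfolding holomorphic_on_def by (simp add: field_differentiable_at_within)
  have two: "1 + (1::2) = 0" "(0::2) \<noteq> 1" by simp_all
  have tau: "\<tau> i (pt y) = g i (y $ (i + 1) / y $ i)" if "y $ i \<noteq> 0" for i y
    unfolding g_def using pt_aff[OF that] by simp
  have swap: "g 0 w = w * g 1 (1 / w)" if w: "w \<noteq> 0" for w
  proof -
    define y where "y = aff 0 w"
    have y: "y $ 0 = 1" "y $ 1 = w" unfolding y_def using aff_nth[of 0 w] by auto
    have "\<tau> 0 (pt y) = w * \<tau> 1 (pt y)" using rel[of y 0 1] y w by simp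
    then show ?thesis using tau[of y 0] tau[of y 1] y w two by (simp del: one_add_one)
  qed
  have "continuous_on (cball 0 1) (g 1)"
    using holo[of 1] holomorphic_on_imp_continuous_on holomorphic_on_subset by blast
  then have "bounded (g 1 ` cball 0 1)" by (intro compact_imp_bounded compact_continuous_image) auto
  then obtain B where "\<forall>z\<in>g 1 ` cball 0 1. norm z \<le> B" unfolding bounded_iff by blast
  then have B: "norm (g 1 w) \<le> B" if "norm w \<le> 1" for w using that by simp
  have bd: "norm (g 0 w) \<le> B * norm w ^ 1" if w: "1 \<le> norm w" for w
  proof -
    have w0: "w \<noteq> 0" using w by auto
    have "norm (1 / w) \<le> 1" using w by (simp add: norm_divide divide_simps)
    then have "norm w * norm (g 1 (1 / w)) \<le> norm w * B" by (intro mult_left_mono B) auto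
    then show ?thesis using swap[OF w0] by (simp add: norm_mult mult.commute)
  qed
  define \<alpha> \<beta> where "\<alpha> = g 0 0" and "\<beta> = deriv (g 0) 0"
  have g0: "g 0 w = \<alpha> + \<beta> * w" for w
    using Liouville_polynomial[OF holo[of 0] bd, where \<xi>=w] unfolding \<alpha>_def \<beta>_def by simp
  have g1: "g 1 w = \<alpha> * w + \<beta>" if "w \<noteq> 0" for w
    using swap[of "1 / w"] that unfolding g0 by (simp add: field_simps)
  \<comment> \<open>The relation between the charts says nothing at the origin of chart 1; the value
    there is obtained by continuity.\<close>
  have "(g 1 \<longlongrightarrow> g 1 0) (at 0)"
    using field_differentiable_imp_continuous_at[OF fd] isCont_def by blast
  moreover have "((\<lambda>w. \<alpha> * w + \<beta>) \<longlongrightarrow> \<alpha> * 0 + \<beta>) (at 0)" by (intro tendsto_intros)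
  then have "(g 1 \<longlongrightarrow> \<alpha> * 0 + \<beta>) (at 0)"
    by (rule Lim_transform_eventually) (auto simp: eventually_at_filter g1)
  ultimately have "g 1 0 = \<beta>" using tendsto_unique[of "at (0::complex)"] by fastforce
  then have g1': "g 1 w = \<alpha> * w + \<beta>" for w using g1[of w] by (cases "w = 0") auto
  have "y $ i * \<tau> i (pt y) = \<alpha> * y $ 0 + \<beta> * y $ 1" if y: "y $ i \<noteq> 0" for i y
    using two_cases[of i 0]
  proof
    assume i: "i = 0"
    then show ?thesis using tau[OF y] y by (simp add: g0 field_simps)
  next
    assume "i = 0 + 1"
    then have i: "i = 1" by simp
    then show ?thesis using tau[OF y] y two by (simp add: g1' field_simps del: one_add_one)
  qed
  then show ?thesis by blast
qed

text \<open>If the determinant vanishes, the columns of the adjugate lie in the kernel and are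
  therefore zero; then \<open>A\<close> itself is zero, which contradicts injectivity.\<close>

lemma det2_nonzero:
  fixes A :: "complex^(1+1)^(1+1)"
  assumes "\<And>v. A *v v = 0 \<Longrightarrow> v = 0"
  shows "A $ Inl 1 $ Inl 1 * A $ Inr 1 $ Inr 1 - A $ Inl 1 $ Inr 1 * A $ Inr 1 $ Inl 1 \<noteq> 0"
proof
  assume d: "A $ Inl 1 $ Inl 1 * A $ Inr 1 $ Inr 1 - A $ Inl 1 $ Inr 1 * A $ Inr 1 $ Inl 1 = 0"
  define mk :: "complex \<Rightarrow> complex \<Rightarrow> complex^(1+1)" where "mk = (\<lambda>u v. \<chi> a. case a of Inl _ \<Rightarrow> u | Inr _ \<Rightarrow> v)"
  have mk: "mk u v $ Inl 1 = u" "mk u v $ Inr 1 = v" for u v unfolding mk_def by auto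
  have "mk (A $ Inr 1 $ Inr 1) (- A $ Inr 1 $ Inl 1) = 0" "mk (- A $ Inl 1 $ Inr 1) (A $ Inl 1 $ Inl 1) = 0"
    by (rule assms; use d in \<open>simp add: vec_11_eq mv_Plus_1 mk algebra_simps\<close>)+
  then have "A $ Inr 1 $ Inr 1 = 0" "A $ Inr 1 $ Inl 1 = 0" "A $ Inl 1 $ Inr 1 = 0" "A $ Inl 1 $ Inl 1 = 0"
    by (auto simp: vec_11_eq mk)
  then have "A *v mk 1 1 = 0" by (simp add: vec_11_eq mv_Plus_1)
  then have "mk 1 1 = 0" by (rule assms)
  then show False by (simp add: vec_11_eq mk)
qed

lemma differential_cong:
  assumes M: "atlas_ok M" and f: "hmap_at M N f p" and g: "hmap_at M N g p"
    and eq: "\<And>q. q \<in> points M \<Longrightarrow> f q = g q" and p: "p \<in> points M" and X: "X \<in> tangent_space M p"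
  shows "differential M N f p X = differential M N g p X"
proof
  fix D :: "'c set \<times> ('c \<Rightarrow> complex^'d)"
  obtain V d where D: "D = (V, d)" by fastforce
  obtain U c where C: "(U, c) \<in> M" "p \<in> U" using chart_point[OF M p] by blast
  show "differential M N f p X D = differential M N g p X D"
  proof (cases "D \<in> N \<and> f p \<in> fst D")
    case True
    have "jac (crep U c f d) (c p) = jac (crep U c g d) (c p)"
      by (rule jac_cong_open[OF chart_open[OF M C(1)]])
        (use C chart_inv[OF M C(1)] eq chart_subset[OF M C(1)] in auto)
    then show ?thesis
      using differential_eq[OF M f X C, of V d] differential_eq[OF M g X C, of V d] True eq[OF p] D by simp
  next
    case False
    then show ?thesis using eq[OF p] unfolding differential_def by auto
  qed
qed

text \<open>A nonzero section of \<open>O(0) + O(2)\<close> may vanish at two points, a nonzero section of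
  \<open>O(1) + O(1)\<close> cannot. The automorphism relating two parametrisations moves the two points.\<close>

lemma not_split_0_2:
  fixes N :: "('b, 3) atlas" and t :: "2 \<Rightarrow> (complex^2) set \<Rightarrow> (('b, 3) chart \<Rightarrow> complex^3) set \<Rightarrow> complex^(1+1)"
  assumes N: "atlas_ok N" and f: "holomorphic_embedding CP1 N f" and f': "holomorphic_embedding CP1 N f'"
    and img: "f ` points CP1 = f' ` points CP1"
    and t: "\<And>i. (cpU i, t i) \<in> trivs (normal_bundle CP1 N f)"
    and rel: "\<And>i j y e a. y $ i \<noteq> 0 \<Longrightarrow> y $ j \<noteq> 0 \<Longrightarrow>
      e \<in> normal_class CP1 N f (pt y) ` tangent_space N (f (pt y)) \<Longrightarrow>
      y $ i * t i (pt y) e $ a = y $ j * t j (pt y) e $ a"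
  shows "\<not> vb_isomorphic CP1 (normal_bundle CP1 N f') (OSum 0 2)"
proof
  let ?P = "points CP1"
  interpret I: immersed_curve CP1 N f using CP1_ok N f by unfold_locales
  interpret I': immersed_curve CP1 N f' using CP1_ok N f' by unfold_locales
  assume "vb_isomorphic CP1 I'.NB (OSum 0 2)"
  then obtain F where Fb: "\<And>p. p \<in> ?P \<Longrightarrow> bij_betw (F p) (fibre I'.NB p) (fibre (OSum 0 2) p)"
    and Ft: "\<And>W t W' t'. (W, t) \<in> trivs I'.NB \<Longrightarrow> (W', t') \<in> trivs (OSum 0 2) \<Longrightarrow>
       \<exists>G::(complex^2) set \<Rightarrow> complex^(1+1)^(1+1). holo_matrix_on CP1 (W \<inter> W') G \<and>
           (\<forall>p\<in>W \<inter> W'. \<forall>e\<in>fibre I'.NB p. t' p (F p e) = G p *v t p e)"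
    unfolding vb_isomorphic_def by fast
  have hf: "holomorphic_map CP1 N f" "holomorphic_map CP1 N f'"
    using f f' unfolding holomorphic_embedding_def by auto
  \<comment> \<open>The changes of parameter between the two embeddings of the same curve; they are
    inverse to each other and holomorphic by \<open>embedding_lift\<close>.\<close>
  define m n where "m = (\<lambda>p. inv_into ?P f (f' p))" and "n = (\<lambda>p. inv_into ?P f' (f p))"
  have m: "holomorphic_map CP1 CP1 m" "\<And>p. p \<in> ?P \<Longrightarrow> m p \<in> ?P" "\<And>p. p \<in> ?P \<Longrightarrow> f (m p) = f' p"
    using embedding_lift[OF CP1_ok CP1_ok N f hf(2)] img unfolding m_def by auto
  have n: "holomorphic_map CP1 CP1 n" "\<And>p. p \<in> ?P \<Longrightarrow> n p \<in> ?P" "\<And>p. p \<in> ?P \<Longrightarrow> f' (n p) = f p"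
    using embedding_lift[OF CP1_ok CP1_ok N f' hf(1)] img unfolding n_def by auto
  have finj: "inj_on f ?P" "inj_on f' ?P"
    using f f' unfolding holomorphic_embedding_def embedding_map_def homeomorphic_map_def
    by (auto dest: homeomorphic_imp_injective_map simp: topspace_mtop[OF CP1_ok] homeomorphic_map_def)
  have mn: "m (n q) = q" if "q \<in> ?P" for q
    using m(3)[OF n(2)[OF that]] n(3)[OF that] finj(1) m(2)[OF n(2)[OF that]] that by (metis inj_onD)
  have nm: "n (m p) = p" if "p \<in> ?P" for p
    using n(3)[OF m(2)[OF that]] m(3)[OF that] finj(2) n(2)[OF m(2)[OF that]] that by (metis inj_onD)
  have mc: "continuous_map (mtop CP1) (mtop CP1) m" "\<And>p. p \<in> ?P \<Longrightarrow> hmap_at CP1 CP1 m p"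
    using m(1) unfolding holomorphic_map_iff[OF CP1_ok CP1_ok] by auto
  have ncc: "continuous_map (mtop CP1) (mtop CP1) n" "\<And>p. p \<in> ?P \<Longrightarrow> hmap_at CP1 CP1 n p"
    using n(1) unfolding holomorphic_map_iff[OF CP1_ok CP1_ok] by auto
  \<comment> \<open>The two embeddings have the same tangent lines at corresponding points. Hence
    the fibres of the normal bundles coincide and the frames \<open>t i\<close> can be pulled back
    along \<open>m\<close>.\<close>
  have im: "I'.im p = I.im (m p)" if p: "p \<in> ?P" for p
  proof
    show "I'.im p \<subseteq> I.im (m p)"
    proof clarify
      fix X assume X: "X \<in> tangent_space CP1 p"
      have h: "hmap_at CP1 N (\<lambda>q. f (m q)) p" by (rule hmap_at_comp[OF CP1_ok CP1_ok mc(1) mc(2)[OF p] p I.fh[OF m(2)[OF p]]])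
      have "differential CP1 N f' p X = differential CP1 N (\<lambda>q. f (m q)) p X"
        by (rule differential_cong[OF CP1_ok I'.fh[OF p] h _ p X]) (simp add: m(3))
      also have "\<dots> = differential CP1 N f (m p) (differential CP1 CP1 m p X)"
        by (rule differential_comp[OF CP1_ok CP1_ok mc(1) mc(2)[OF p] I.fh[OF m(2)[OF p]] X p])
      finally show "differential CP1 N f' p X \<in> I.im (m p)"
        using differential_tangent[OF CP1_ok CP1_ok mc(1) mc(2)[OF p] X p] by blast
    qed
    show "I.im (m p) \<subseteq> I'.im p"
    proof clarify
      fix X assume X: "X \<in> tangent_space CP1 (m p)"
      have q: "m p \<in> ?P" using m(2)[OF p] .
      have h: "hmap_at CP1 N (\<lambda>q. f' (n q)) (m p)"
        by (rule hmap_at_comp[OF CP1_ok CP1_ok ncc(1) ncc(2)[OF q] q I'.fh[OF n(2)[OF q]]])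
      have "differential CP1 N f (m p) X = differential CP1 N (\<lambda>q. f' (n q)) (m p) X"
        by (rule differential_cong[OF CP1_ok I.fh[OF q] h _ q X]) (simp add: n(3))
      also have "\<dots> = differential CP1 N f' (n (m p)) (differential CP1 CP1 n (m p) X)"
        by (rule differential_comp[OF CP1_ok CP1_ok ncc(1) ncc(2)[OF q] I'.fh[OF n(2)[OF q]] X q])
      finally show "differential CP1 N f (m p) X \<in> I'.im p"
        using differential_tangent[OF CP1_ok CP1_ok ncc(1) ncc(2)[OF q] X q] unfolding nm[OF p] by blast
    qed
  qed
  have nc: "I'.nc p = I.nc (m p)" if "p \<in> ?P" for p
    unfolding normal_class_def im[OF that] ..
  have fib: "fibre I'.NB p = I.nc (m p) ` tangent_space N (f (m p))" if "p \<in> ?P" for p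
    unfolding normal_bundle_def using nc[OF that] m(3)[OF that] by simp
  define W where "W = (\<lambda>i. ?P \<inter> m -` cpU i)"
  have WP: "W i \<subseteq> ?P" for i unfolding W_def by blast
  have Wo: "openin (mtop CP1) (W i)" for i
    unfolding W_def using openin_preimage[OF CP1_ok mc(1) _ cpU_open] openin_topspace topspace_mtop[OF CP1_ok] by metis
  have t': "(W i, \<lambda>p. t i (m p)) \<in> trivs I'.NB" for i
  proof -
    have G: "\<exists>G. holo_matrix_on CP1 (W i \<inter> f' -` fst D) G \<and>
          (\<forall>p\<in>W i \<inter> f' -` fst D. \<forall>X\<in>tangent_space N (f' p). t i (m p) (I'.nc p X) = G p *v X D)" if D: "D \<in> N" for D
    proof -
      obtain V d where VD: "D = (V, d)" by fastforce
      obtain G where G: "\<forall>p\<in>cpU i \<inter> f -` V. \<forall>a b. hol_at CP1 (\<lambda>q. G q $ a $ b) p"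
          "\<forall>p\<in>cpU i \<inter> f -` V. \<forall>X\<in>tangent_space N (f p). t i p (I.nc p X) = G p *v X (V, d)"
        using I.trivD(3)[OF t[of i], of V d] D VD by blast
      have "holo_matrix_on CP1 (W i \<inter> f' -` V) (\<lambda>p. G (m p))"
      proof (subst holo_matrix_on_iff[OF CP1_ok])
        show "W i \<inter> f' -` V \<subseteq> ?P" using WP by blast
        have "hol_at CP1 (\<lambda>q. G (m q) $ a $ b) p" if p: "p \<in> W i" "f' p \<in> V" for p a b
        proof -
          have pP: "p \<in> ?P" using p WP by blast
          have "hol_at CP1 (\<lambda>q. G q $ a $ b) (m p)" using G(1) p m(3)[OF pP] unfolding W_def by simp
          from hol_at_comp[OF CP1_ok CP1_ok mc(1) mc(2)[OF pP] pP this] show ?thesis .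
        qed
        then show "openin (mtop CP1) (W i \<inter> f' -` V) \<and> (\<forall>p\<in>W i \<inter> f' -` V. \<forall>a b. hol_at CP1 (\<lambda>q. G (m q) $ a $ b) p)"
          using openin_preimage[OF CP1_ok I'.fc Wo openin_chart[OF N]] D VD by blast
      qed
      moreover have "t i (m p) (I'.nc p X) = G (m p) *v X (V, d)"
        if p: "p \<in> W i" "f' p \<in> V" and X: "X \<in> tangent_space N (f' p)" for p X
      proof -
        have pP: "p \<in> ?P" using p WP by blast
        show ?thesis using G(2) p X m(3)[OF pP] nc[OF pP] unfolding W_def by simp
      qed
      ultimately show ?thesis unfolding VD by auto
    qed
    have "bij_betw (t i (m p)) (I'.nc p ` tangent_space N (f' p)) UNIV" if p: "p \<in> W i" for p
    proof -
      have pP: "p \<in> ?P" using p WP by blast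
      show ?thesis using I.trivD(2)[OF t[of i], of "m p"] p m(3)[OF pP] nc[OF pP] unfolding W_def by simp
    qed
    then show ?thesis unfolding normal_bundle_def using Wo G by simp
  qed
  \<comment> \<open>The section with components \<open>0\<close> and \<open>y $ 0 * y $ 1\<close>,
    which vanishes exactly at the two coordinate points.\<close>
  define sec where "sec = (\<lambda>p. let y = (SOME y. pt y = p) in (tw 0 y 0, tw 2 y (y $ 0 * y $ 1)) :: ((complex^2) \<times> complex) set \<times> ((complex^2) \<times> complex) set)"
  have sec: "sec (pt y) = (tw 0 y 0, tw 2 y (y $ 0 * y $ 1))" for y
  proof -
    define y' where "y' = (SOME y'. pt y' = pt y)"
    have "pt y' = pt y" unfolding y'_def by (rule someI[of _ y]) simp
    then obtain c where c: "c \<noteq> 0" "y' = c *s y" using pt_eq_iff[of y y'] by metis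
    have "sec (pt y) = (tw 0 y' 0, tw 2 y' (y' $ 0 * y' $ 1))" unfolding sec_def Let_def y'_def ..
    then show ?thesis using tw_scale[OF c(1), of 0 y 0] tw_scale[OF c(1), of 2 y "y $ 0 * y $ 1"]
      unfolding c(2) by (simp add: power2_eq_square ac_simps)
  qed
  define S where "S = (\<lambda>p. inv_into (fibre I'.NB p) (F p) (sec p))"
  have S: "S p \<in> fibre I'.NB p" "F p (S p) = sec p" if p: "p \<in> ?P" for p
  proof -
    obtain y where y: "p = pt y" using p unfolding CP1_points by blast
    have "sec p \<in> fibre (OSum 0 2) p" unfolding y sec sum_fibre by blast
    then have "sec p \<in> F p ` fibre I'.NB p" using bij_betw_imp_surj_on[OF Fb[OF p]] by simp
    then show "S p \<in> fibre I'.NB p" "F p (S p) = sec p"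
      unfolding S_def by (auto intro: inv_into_into f_inv_into_f)
  qed
  define \<tau> where "\<tau> = (\<lambda>i p. t i (m p) (S p))"
  define b :: "2 \<Rightarrow> (complex^2) set \<Rightarrow> complex^(1+1)" where
    "b = (\<lambda>j p. \<chi> a. case a of Inl _ \<Rightarrow> 0 | Inr _ \<Rightarrow> rho 0 j p * rho 1 j p)"
  have bsec: "sumtriv 0 2 j j p (sec p) = b j p" if p: "p \<in> ?P" for p j
  proof -
    obtain y where y: "p = pt y" using p unfolding CP1_points by blast
    show ?thesis unfolding y sec b_def by (simp add: vec_11_eq power2_eq_square)
  qed
  \<comment> \<open>In frames the isomorphism \<open>F\<close> is an invertible holomorphic matrix,
    which maps the coordinates \<open>\<tau> i\<close> of the transported section to the known
    coordinates \<open>b j\<close>.\<close>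
  have key: "\<exists>G::(complex^2) set \<Rightarrow> complex^(1+1)^(1+1). (\<forall>p\<in>W i \<inter> cpU j. (\<forall>a b. hol_at CP1 (\<lambda>q. G q $ a $ b) p) \<and>
      G p *v \<tau> i p = b j p \<and> (\<forall>v. G p *v v = 0 \<longrightarrow> v = 0))" for i j
  proof -
    have "(cpU j \<inter> cpU j, sumtriv 0 2 j j) \<in> trivs (OSum 0 2)" unfolding sum_trivs by blast
    then obtain G :: "(complex^2) set \<Rightarrow> complex^(1+1)^(1+1)" where G: "holo_matrix_on CP1 (W i \<inter> cpU j) G"
       "\<forall>p\<in>W i \<inter> cpU j. \<forall>e\<in>fibre I'.NB p. sumtriv 0 2 j j p (F p e) = G p *v t i (m p) e"
      using Ft[OF t'[of i]] by fastforce
    have "W i \<inter> cpU j \<subseteq> ?P" using WP by blast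
    then have Gh: "\<forall>p\<in>W i \<inter> cpU j. \<forall>a b. hol_at CP1 (\<lambda>q. G q $ a $ b) p"
      using G(1) holo_matrix_on_iff[OF CP1_ok] by blast
    have "G p *v \<tau> i p = b j p" if p: "p \<in> W i \<inter> cpU j" for p
    proof -
      have pP: "p \<in> ?P" using p WP by blast
      show ?thesis using G(2) p S[OF pP] bsec[OF pP, of j] unfolding \<tau>_def by metis
    qed
    moreover have "v = 0" if p: "p \<in> W i \<inter> cpU j" and v: "G p *v v = 0" for p v
    proof -
      have pP: "p \<in> ?P" using p WP by blast
      have tb: "bij_betw (t i (m p)) (fibre I'.NB p) UNIV"
        using I'.trivD(2)[OF t'[of i], of p] p unfolding normal_bundle_def by simp
      obtain e where e: "e \<in> fibre I'.NB p" "t i (m p) e = v"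
        using tb unfolding bij_betw_def by (metis UNIV_I imageE)
      obtain e0 where e0: "e0 \<in> fibre I'.NB p" "t i (m p) e0 = 0"
        using tb unfolding bij_betw_def by (metis UNIV_I imageE)
      have "sumtriv 0 2 j j p (F p e) = sumtriv 0 2 j j p (F p e0)" using G(2) p e e0 v by simp
      moreover have "F p e \<in> fibre (OSum 0 2) p" "F p e0 \<in> fibre (OSum 0 2) p"
        using Fb[OF pP] e(1) e0(1) unfolding bij_betw_def by auto
      moreover have "inj_on (sumtriv 0 2 j j p) (fibre (OSum 0 2) p)"
        using sumtriv_bij[of p j j 0 2] p unfolding bij_betw_def by blast
      ultimately have "F p e = F p e0" by (meson inj_onD)
      then have "e = e0" using Fb[OF pP] e(1) e0(1) unfolding bij_betw_def by (meson inj_onD)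
      then show ?thesis using e(2) e0(2) by simp
    qed
    ultimately show ?thesis using Gh by blast
  qed
  have \<tau>h: "hol_at CP1 (\<lambda>p. \<tau> i p $ a) p" if p: "p \<in> W i" for i a p
  proof -
    obtain j where j: "p \<in> cpU j" using p WP points_cpU by blast
    obtain G :: "(complex^2) set \<Rightarrow> complex^(1+1)^(1+1)" where G: "\<And>q. q \<in> W i \<inter> cpU j \<Longrightarrow> (\<forall>a b. hol_at CP1 (\<lambda>q. G q $ a $ b) q) \<and>
      G q *v \<tau> i q = b j q \<and> (\<forall>v. G q *v v = 0 \<longrightarrow> v = 0)" using key[of i j] by blast
    \<comment> \<open>\<open>\<tau>\<close> is known only through \<open>G\<close> applied to it.
      Transposing puts the unknown on the left, as \<open>hol_at_solve\<close> requires; the result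
      is used for a matrix with one row.\<close>
    define T :: "(complex^2) set \<Rightarrow> complex^(1+1)^1" where "T = (\<lambda>q. \<chi> _. \<tau> i q)"
    define A where "A = (\<lambda>q. transpose (G q))"
    have "hol_at CP1 (\<lambda>q. T q $ 1 $ a) p"
    proof (rule hol_at_solve[OF CP1_ok, of "W i \<inter> cpU j" p A "\<lambda>q. \<chi> _. b j q"])
      show "openin (mtop CP1) (W i \<inter> cpU j)" using Wo cpU_open by blast
      show "p \<in> W i \<inter> cpU j" using p j by blast
      show "hol_at CP1 (\<lambda>q. A q $ c $ d) q" if "q \<in> W i \<inter> cpU j" for q c d
        using G[OF that] unfolding A_def transpose_def by simp
      show "hol_at CP1 (\<lambda>q. (\<chi> _. b j q) $ c $ d) p" for c d
        unfolding b_def using hol_at_rho[OF j] by (cases d) (auto intro!: hol_at_const hol_at_mult)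
      show "T q ** A q = (\<chi> _. b j q)" if q: "q \<in> W i \<inter> cpU j" for q
      proof -
        have "(T q ** A q) $ k $ l = (G q *v \<tau> i q) $ l" for k l
          unfolding T_def A_def matrix_matrix_mult_def matrix_vector_mult_def transpose_def by (simp add: mult.commute)
        then show ?thesis using G[OF q] by (simp add: vec_eq_iff)
      qed
      show "A p $ Inl 1 $ Inl 1 * A p $ Inr 1 $ Inr 1 - A p $ Inl 1 $ Inr 1 * A p $ Inr 1 $ Inl 1 \<noteq> 0"
        using det2_nonzero[of "G p"] G[of p] p j unfolding A_def transpose_def by (simp add: algebra_simps)
    qed
    then show ?thesis unfolding T_def by simp
  qed
  \<comment> \<open>The section seen from the parameter of \<open>f\<close>, where by
    \<open>rel\<close> each coordinate transforms as a section of \<open>O(1)\<close>.\<close>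
  define \<sigma> where "\<sigma> = (\<lambda>i q. t i q (S (n q)))"
  have \<sigma>\<tau>: "\<sigma> i (m p) = \<tau> i p" if "p \<in> ?P" for i p unfolding \<sigma>_def \<tau>_def nm[OF that] ..
  have \<sigma>h: "hol_at CP1 (\<lambda>q. \<sigma> i q $ a) q" if q: "q \<in> cpU i" for i a q
  proof -
    have qP: "q \<in> ?P" using q cpU_points by blast
    have "n q \<in> W i" unfolding W_def using n(2)[OF qP] mn[OF qP] q by simp
    from hol_at_comp[OF CP1_ok CP1_ok ncc(1) ncc(2)[OF qP] qP \<tau>h[OF this]]
    have "hol_at CP1 (\<lambda>q. \<tau> i (n q) $ a) q" .
    moreover have "\<tau> i (n q) = \<sigma> i q" if "q \<in> cpU i" for q
    proof -
      have "q \<in> ?P" using that cpU_points by blast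
      then show ?thesis unfolding \<tau>_def \<sigma>_def by (simp add: mn)
    qed
    ultimately show ?thesis using hol_at_cong[OF CP1_ok cpU_open q, of "\<lambda>q. \<tau> i (n q) $ a" "\<lambda>q. \<sigma> i q $ a"] by simp
  qed
  have \<sigma>rel: "y $ i * \<sigma> i (pt y) $ a = y $ j * \<sigma> j (pt y) $ a" if y: "y $ i \<noteq> 0" "y $ j \<noteq> 0" for i j y a
  proof -
    have P: "pt y \<in> ?P" using y cpU_points by (metis pt_in_cpU subsetD)
    have "S (n (pt y)) \<in> I.nc (pt y) ` tangent_space N (f (pt y))"
      using S(1)[OF n(2)[OF P]] fib[OF n(2)[OF P]] mn[OF P] by simp
    from rel[OF y this] show ?thesis unfolding \<sigma>_def .
  qed
  have \<tau>0: "\<tau> i p = 0" if p: "p \<in> W i" "p \<in> cpU j" "b j p = 0" for i j p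
    using key[of i j] p by (metis IntI)
  have e: "b 0 (ch 0 0) = 0" "b 1 (ch 1 0) = 0"
    unfolding b_def by (simp_all add: vec_11_eq aff_def)
  have neq: "ch 0 0 \<noteq> ch 1 0"
    by (metis aff_nth ch_cpU pt_in_cpU add_0 zero_index)
  have "\<sigma> i q = 0" if q: "q \<in> cpU i" for i q
  proof -
    have "\<sigma> i q $ a = 0" for a
    proof -
      obtain \<alpha> \<beta> where ab: "\<And>i y. y $ i \<noteq> 0 \<Longrightarrow> y $ i * \<sigma> i (pt y) $ a = \<alpha> * y $ 0 + \<beta> * y $ 1"
        using O1_section[of "\<lambda>i q. \<sigma> i q $ a", OF \<sigma>h \<sigma>rel] by blast
      have z: "\<exists>y. m p = pt y \<and> y \<noteq> 0 \<and> \<alpha> * y $ 0 + \<beta> * y $ 1 = 0" if p: "p \<in> cpU j" "b j p = 0" for p j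
      proof -
        have pP: "p \<in> ?P" using p cpU_points by blast
        obtain y where y: "m p = pt y" "y \<noteq> 0" using m(2)[OF pP] unfolding CP1_points by blast
        obtain k where k: "y $ k \<noteq> 0" using y(2) by (auto simp: vec_eq_iff)
        have "p \<in> W k" unfolding W_def using pP y k by simp
        then have "\<sigma> k (pt y) = 0" using \<tau>0[OF _ p] \<sigma>\<tau>[OF pP] y(1) by metis
        then show ?thesis using ab[OF k] y by (intro exI[of _ y]) simp
      qed
      obtain y y' where y: "m (ch 0 0) = pt y" "y \<noteq> 0" "\<alpha> * y $ 0 + \<beta> * y $ 1 = 0"
        and y': "m (ch 1 0) = pt y'" "y' \<noteq> 0" "\<alpha> * y' $ 0 + \<beta> * y' $ 1 = 0"
        using z[OF ch_cpU e(1)] z[OF ch_cpU e(2)] by blast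
      have ne: "pt y \<noteq> pt y'" using y(1) y'(1) nm[OF ch_points] neq by metis
      \<comment> \<open>A nonzero linear form has a single zero on the projective line, whereas
        \<open>y\<close> and \<open>y'\<close> represent two distinct ones.\<close>
      have "\<alpha> = 0 \<and> \<beta> = 0"
      proof (rule ccontr)
        assume ab0: "\<not> (\<alpha> = 0 \<and> \<beta> = 0)"
        define v :: "complex^2" where "v = (\<chi> j. if j = 0 then - \<beta> else \<alpha>)"
        have v: "v $ 0 = - \<beta>" "v $ 1 = \<alpha>" unfolding v_def by simp_all
        have line: "\<exists>c. x = c *s v" if x: "\<alpha> * x $ 0 + \<beta> * x $ 1 = 0" for x :: "complex^2"
        proof (cases "\<alpha> = 0")
          case True
          then have "x $ 1 = 0" "\<beta> \<noteq> 0" using ab0 x by auto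
          then show ?thesis using True v vec2_eq_iff[of x _ 0]
            by (intro exI[of _ "- x $ 0 / \<beta>"]) simp
        next
          case False
          then have "x $ 0 = - \<beta> * x $ 1 / \<alpha>" using x by (simp add: field_simps eq_neg_iff_add_eq_0)
          then show ?thesis using False v vec2_eq_iff[of x _ 0]
            by (intro exI[of _ "x $ 1 / \<alpha>"]) (simp add: field_simps)
        qed
        obtain c where "y = c *s v" using line[OF y(3)] by blast
        moreover obtain c' where "y' = c' *s v" using line[OF y'(3)] by blast
        moreover have "c \<noteq> 0" "c' \<noteq> 0" using calculation y(2) y'(2) by auto
        ultimately show False using ne by (simp add: pt_scale)
      qed
      then show ?thesis using ab[of _ i] q by (auto elim!: cpU_E)
    qed
    then show ?thesis by (simp add: vec_eq_iff)
  qed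
  note \<sigma>0 = this
  \<comment> \<open>The point \<open>(1 : 1)\<close>, at which the section of
    \<open>O(0) + O(2)\<close> does not vanish.\<close>
  define p where "p = ch 0 (vec 1)"
  have p: "p \<in> cpU 0" "p \<in> ?P" unfolding p_def by (rule ch_cpU ch_points)+
  obtain k where k: "m p \<in> cpU k" using m(2)[OF p(2)] points_cpU by blast
  have pW: "p \<in> W k" unfolding W_def using p k by simp
  have "\<tau> k p = 0" using \<sigma>\<tau>[OF p(2), of k] \<sigma>0[OF k] by simp
  moreover obtain G :: "complex^(1+1)^(1+1)" where "G *v \<tau> k p = b 0 p" using key[of k 0] pW p by blast
  ultimately have "b 0 p = 0" by simp
  then show False unfolding b_def p_def by (simp add: vec_11_eq aff_def)
qed

section \<open>The total space of \<open>O(2)\<close> over projective space\<close>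

abbreviation TW :: "(((complex^4) \<times> complex) set, 4) atlas" where
  "TW \<equiv> tw_atlas 2"

definition tU :: "4 \<Rightarrow> ((complex^4) \<times> complex) set set" where
  "tU i = {tw 2 y z | y z. y $ i \<noteq> 0}"

definition tc :: "4 \<Rightarrow> ((complex^4) \<times> complex) set \<Rightarrow> complex^4" where
  "tc i = (\<lambda>e. let (y, z) = (SOME p. p \<in> e) in \<chi> j. if j = i then z / (y $ i) ^ 2 else y $ j / y $ i)"

text \<open>Index \<open>i\<close> of a chart vector stores the fibre coordinate; the homogeneous
  representative has 1 in that place.\<close>

definition yv :: "4 \<Rightarrow> complex^4 \<Rightarrow> complex^4" where
  "yv i x = (\<chi> j. if j = i then 1 else x $ j)"

lemma TW_charts: "TW = {(tU i, tc i) | i. True}"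
  unfolding tw_atlas_def tU_def tc_def ..

lemma TW_chart: "(tU i, tc i) \<in> TW"
  unfolding TW_charts by blast

lemma tw_in_tU [simp]: "tw 2 y z \<in> tU i \<longleftrightarrow> y $ i \<noteq> 0"
  unfolding tU_def by (auto simp: tw_eq_iff)

lemma tc_tw: "tc i (tw 2 y z) = (\<chi> j. if j = i then z / (y $ i) ^ 2 else y $ j / y $ i)"
proof -
  obtain c where "c \<noteq> 0" "(SOME p. p \<in> tw 2 y z) = (c *s y, c ^ 2 * z)" using tw_some by blast
  then show ?thesis unfolding tc_def by (simp add: vec_eq_iff power_mult_distrib)
qed

lemma yv_nth [simp]: "yv i x $ i = 1" and yv_nth': "yv i x $ j = (if j = i then 1 else x $ j)"
  unfolding yv_def by auto

lemma tc_lift: "tc i (tw 2 (yv i x) (x $ i)) = x"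
  unfolding tc_tw by (simp add: vec_eq_iff yv_nth')

lemma lift_tc: "y $ i \<noteq> 0 \<Longrightarrow> tw 2 (yv i (tc i (tw 2 y z))) (tc i (tw 2 y z) $ i) = tw 2 y z"
  unfolding tw_eq_iff tc_tw by (intro exI[of _ "y $ i"]) (auto simp: vec_eq_iff yv_nth')

lemma tU_E: "e \<in> tU i \<Longrightarrow> (\<And>y z. e = tw 2 y z \<Longrightarrow> y $ i \<noteq> 0 \<Longrightarrow> thesis) \<Longrightarrow> thesis"
  unfolding tU_def by blast

lemma tc_inj: "inj_on (tc i) (tU i)"
  by (rule inj_onI) (metis lift_tc tU_E)

lemma tc_inv: "inv_into (tU i) (tc i) x = tw 2 (yv i x) (x $ i)"
  by (rule inv_into_f_eq[OF tc_inj]) (auto simp: tc_lift)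

lemma tc_preimage: "tc i ` (tU i \<inter> W) = {x. tw 2 (yv i x) (x $ i) \<in> W}"
proof (intro set_eqI iffI)
  fix x assume "x \<in> tc i ` (tU i \<inter> W)"
  then obtain e where "e \<in> tU i" "e \<in> W" "x = tc i e" by blast
  then show "x \<in> {x. tw 2 (yv i x) (x $ i) \<in> W}" using tc_inv[of i x] inv_into_f_f[OF tc_inj] by auto
next
  fix x assume "x \<in> {x. tw 2 (yv i x) (x $ i) \<in> W}"
  then show "x \<in> tc i ` (tU i \<inter> W)"
    by (intro image_eqI[of _ _ "tw 2 (yv i x) (x $ i)"]) (auto simp: tc_lift)
qed

lemma cdf_yv [intro]: "cdf (\<lambda>x. yv i x $ j) x"
  by (cases "j = i") (auto simp: yv_nth')

lemma cdf_continuous: "(\<And>x. cdf f x) \<Longrightarrow> continuous_on UNIV f"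
  using cdf_isCont by (blast intro: continuous_at_imp_continuous_on)

lemma TW_points: "points TW = {tw 2 y z | y z. y \<noteq> 0}"
proof -
  have "points TW = (\<Union>i. tU i)" unfolding points_def TW_charts by auto
  also have "\<dots> = {tw 2 y z | y z. y \<noteq> 0}" unfolding tU_def by (auto simp: vec_eq_iff)
  finally show ?thesis .
qed

lemma TW_ok: "atlas_ok TW"
  unfolding atlas_ok_def
proof (intro conjI)
  have "tc i ` tU i = UNIV" for i using tc_preimage[of i UNIV] by simp
  then show "\<forall>(U, c)\<in>TW. inj_on c U \<and> open (c ` U)"
    unfolding TW_charts using tc_inj by auto
  show "\<forall>(U, c)\<in>TW. \<forall>(V, d)\<in>TW. holo_on (d \<circ> inv_into U c) (c ` (U \<inter> V))"
    unfolding TW_charts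
  proof (clarsimp)
    fix i j
    have e: "tc i ` (tU i \<inter> tU j) = {x. yv i x $ j \<noteq> 0}" unfolding tc_preimage by simp
    show "holo_on (tc j \<circ> inv_into (tU i) (tc i)) (tc i ` (tU i \<inter> tU j))"
      unfolding holo_on_iff e o_def tc_inv cdiff_def tc_tw
    proof (intro conjI ballI allI)
      show "open {x. yv i x $ j \<noteq> 0}"
        by (intro open_Collect_neq continuous_on_const cdf_continuous cdf_yv)
    next
      fix x l assume x: "x \<in> {x. yv i x $ j \<noteq> 0}"
      show "cdf (\<lambda>x. (\<chi> k. if k = j then x $ i / (yv i x $ j) ^ 2 else yv i x $ k / yv i x $ j) $ l) x"
        using x by (cases "l = j") (auto intro!: cdf_divide cdf_yv cdf_power)
    qed
  qed
qed

lemma hol_at_TWI: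
  assumes "y $ i \<noteq> 0" "cdf (\<lambda>x. g (tw 2 (yv i x) (x $ i))) (tc i (tw 2 y z))"
  shows "hol_at TW g (tw 2 y z)"
  using assms by (intro hol_atI[OF TW_ok TW_chart[of i]]) (auto simp: tc_inv)

section \<open>Open submanifolds\<close>

lemma restrict_charts: "(U, c) \<in> M \<Longrightarrow> (U \<inter> W, c) \<in> restrict_atlas M W"
  unfolding restrict_atlas_def by force

lemma restrict_chartE: "(U', c) \<in> restrict_atlas M W \<Longrightarrow> (\<And>U. (U, c) \<in> M \<Longrightarrow> U' = U \<inter> W \<Longrightarrow> thesis) \<Longrightarrow> thesis"
  unfolding restrict_atlas_def by force

lemma restrict_points: "points (restrict_atlas M W) = points M \<inter> W"
  unfolding points_def restrict_atlas_def by force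

context
  fixes M :: "('a, 'n::finite) atlas" and W :: "'a set"
  assumes M: "atlas_ok M" and W: "openin (mtop M) W"
begin

lemma restrict_inv:
  assumes C: "(U, c) \<in> M" and x: "x \<in> c ` (U \<inter> W)"
  shows "inv_into (U \<inter> W) c x = inv_into U c x"
proof -
  obtain p where p: "p \<in> U" "p \<in> W" "x = c p" using x by blast
  have "inj_on c (U \<inter> W)" using chart_inj[OF M C] by (rule inj_on_subset) blast
  then show ?thesis using p chart_inv[OF M C p(1)] by (simp add: inv_into_f_f)
qed

lemma restrict_ok: "atlas_ok (restrict_atlas M W)"
  unfolding atlas_ok_def
proof (intro conjI ballI; clarify)
  fix U' c assume "(U', c) \<in> restrict_atlas M W"
  then obtain U where U: "(U, c) \<in> M" "U' = U \<inter> W" by (rule restrict_chartE)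
  show "inj_on c U' \<and> open (c ` U')"
    unfolding U(2) using inj_on_subset[OF chart_inj[OF M U(1)]] openin_chart_image[OF M W U(1)] by blast
next
  fix U' c V' d assume "(U', c) \<in> restrict_atlas M W" "(V', d) \<in> restrict_atlas M W"
  then obtain U V where U: "(U, c) \<in> M" "U' = U \<inter> W" and V: "(V, d) \<in> M" "V' = V \<inter> W"
    by (meson restrict_chartE)
  have o: "open (c ` (U \<inter> (V \<inter> W)))"
    by (intro openin_chart_image[OF M _ U(1)] openin_Int openin_chart[OF M V(1)] W)
  have "cdiff (d \<circ> inv_into (U \<inter> W) c) (c p)" if p: "p \<in> U" "p \<in> V" "p \<in> W" for p
  proof -
    have "cdiff (d \<circ> inv_into (U \<inter> W) c) (c p) \<longleftrightarrow> cdiff (\<lambda>x. d (inv_into U c x)) (c p)"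
      by (rule cdiff_cong_open[OF openin_chart_image[OF M W U(1)]]) (use p restrict_inv[OF U(1)] in auto)
    then show ?thesis using chart_cdiff[OF M U(1) V(1) p(1,2)] by simp
  qed
  moreover have "U' \<inter> V' = U \<inter> (V \<inter> W)" using U V by blast
  ultimately show "holo_on (d \<circ> inv_into U' c) (c ` (U' \<inter> V'))" using o unfolding holo_on_iff U(2) by auto
qed

lemma openin_restrict: "openin (mtop (restrict_atlas M W)) T \<longleftrightarrow> openin (mtop M) T \<and> T \<subseteq> W"
proof
  assume T: "openin (mtop (restrict_atlas M W)) T"
  then have TW: "T \<subseteq> points M \<inter> W"
    unfolding openin_mtop_iff[OF restrict_ok] restrict_points by (rule conjunct1)
  have "open (c ` (U \<inter> T))" if "(U, c) \<in> M" for U c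
  proof -
    have "open (c ` (U \<inter> W \<inter> T))" using openin_chart_image[OF restrict_ok T restrict_charts[OF that]] .
    moreover have "U \<inter> W \<inter> T = U \<inter> T" using TW by blast
    ultimately show ?thesis by simp
  qed
  then show "openin (mtop M) T \<and> T \<subseteq> W" using TW openin_mtop_iff[OF M] by blast
next
  assume T: "openin (mtop M) T \<and> T \<subseteq> W"
  then have TW: "T \<subseteq> points M \<inter> W" using openin_mtop_iff[OF M] by blast
  show "openin (mtop (restrict_atlas M W)) T" unfolding openin_mtop_iff[OF restrict_ok] restrict_points
  proof (intro conjI TW ballI, clarify)
    fix U' c assume "(U', c) \<in> restrict_atlas M W"
    then obtain U where U: "(U, c) \<in> M" "U' = U \<inter> W" by (rule restrict_chartE)
    have "U' \<inter> T = U \<inter> T" using TW U by blast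
    then show "open (c ` (U' \<inter> T))" using openin_chart_image[OF M _ U(1)] T by simp
  qed
qed

lemma hol_at_restrict:
  assumes p: "p \<in> W" shows "hol_at (restrict_atlas M W) g p \<longleftrightarrow> hol_at M g p"
proof -
  have "p \<in> points M" using W p openin_mtop_iff[OF M] by blast
  then obtain U c where C: "(U, c) \<in> M" "p \<in> U" using chart_point[OF M] by blast
  have eq: "cdf (\<lambda>x. g (inv_into (U \<inter> W) c x)) (c p) \<longleftrightarrow> cdf (\<lambda>x. g (inv_into U c x)) (c p)"
    by (rule cdf_cong_open[OF openin_chart_image[OF M W C(1)]]) (use p C restrict_inv[OF C(1)] in auto)
  have Cr: "(U \<inter> W, c) \<in> restrict_atlas M W" "p \<in> U \<inter> W" using restrict_charts C p by auto
  show ?thesis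
    using hol_atI[OF M C, of g] hol_atI[OF restrict_ok Cr, of g] eq C Cr unfolding hol_at_def by fast
qed

lemma holomorphic_map_into_restrict:
  assumes A: "atlas_ok A" and f: "holomorphic_map A (restrict_atlas M W) f"
  shows "holomorphic_map A M f"
proof -
  have fc: "continuous_map (mtop A) (mtop (restrict_atlas M W)) f"
    and fh: "\<And>p. p \<in> points A \<Longrightarrow> hmap_at A (restrict_atlas M W) f p"
    using f unfolding holomorphic_map_iff[OF A restrict_ok] by auto
  have fW: "f p \<in> W" "f p \<in> points M" if "p \<in> points A" for p
    using fc that unfolding continuous_map_def topspace_mtop[OF A] topspace_mtop[OF restrict_ok] restrict_points by auto
  show ?thesis unfolding holomorphic_map_iff[OF A M]
  proof (intro conjI ballI)
    show "continuous_map (mtop A) (mtop M) f"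
      unfolding continuous_map_def topspace_mtop[OF A] topspace_mtop[OF M]
    proof (intro conjI allI impI)
      show "f \<in> points A \<rightarrow> points M" using fW by blast
      fix T assume T: "openin (mtop M) T"
      have "openin (mtop (restrict_atlas M W)) (T \<inter> W)" using T W openin_restrict by blast
      from continuous_map_openin[OF fc this]
      have "openin (mtop A) {x \<in> points A. f x \<in> T \<inter> W}" unfolding topspace_mtop[OF A] .
      moreover have "{x \<in> points A. f x \<in> T \<inter> W} = {x \<in> points A. f x \<in> T}" using fW by blast
      ultimately show "openin (mtop A) {x \<in> points A. f x \<in> T}" by simp
    qed
    fix p assume p: "p \<in> points A"
    show "hmap_at A M f p" unfolding hmap_at_def
    proof (intro ballI, clarify)
      fix V d j assume D: "(V, d) \<in> M" "f p \<in> V"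
      show "hol_at A (\<lambda>q. d (f q) $ j) p"
        using fh[OF p] restrict_charts[OF D(1), of W] D(2) fW(1)[OF p] unfolding hmap_at_def by fast
    qed
  qed
qed

end

section \<open>Algebra of the curves\<close>

definition f4 :: "real \<Rightarrow> real \<Rightarrow> complex \<Rightarrow> complex \<Rightarrow> complex" where
  "f4 a b u v = u * v * (u + v) * (of_real a * u - of_real b * v)"

text \<open>Selects the factor used over a chart: for \<open>e = 1\<close> it is
  \<open>w + iz\<close> over chart 0 and \<open>w - iz\<close> over chart 1.\<close>

definition sg :: "2 \<Rightarrow> complex" where
  "sg i = (if i = 0 then 1 else -1)"

lemma sg_simps [simp]: "sg 0 = 1" "sg 1 = -1" "sg i * sg i = 1" "sg (i + 1) = - sg i"
  using two_cases[of i 0] unfolding sg_def by auto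

text \<open>\<open>r\<close> and \<open>q\<close> stand for \<open>sqrt f\<close> and \<open>Q\<close> at \<open>la\<close>, \<open>m\<close> and \<open>n\<close> for
  \<open>sqrt (q + r) - sqrt (q - r)\<close> and \<open>sqrt (q + r) + sqrt (q - r)\<close>, \<open>\<gamma>\<close> for \<open>cis (\<theta> / 2)\<close>
  and \<open>\<delta>\<close> for its inverse. The linear forms \<open>ell 0\<close>, \<open>ell 1\<close> restrict to the squares of the
  homogeneous coordinates of the conic, and a sign \<open>e\<close> distinguishes the two lifts of it.\<close>

locale conic_data =
  fixes a b q0 q1 q2 la :: real and r q m n \<gamma> \<delta> :: complex
  assumes r2: "f4 a b (of_real la) 1 = r\<^sup>2"
    and q_eq: "quad q0 q1 q2 (of_real la) (1::complex) = q"
    and mn: "m * n = 2 * r" and mn2: "m\<^sup>2 + n\<^sup>2 = 4 * q" and cd: "\<gamma> * \<delta> = 1"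
    and r0: "r \<noteq> 0" and qr: "q\<^sup>2 \<noteq> r\<^sup>2"
begin

section \<open>Linear forms adapted to the conic and coordinates on the double solid\<close>

definition ell :: "2 \<Rightarrow> complex^4 \<Rightarrow> complex" where
  "ell i y = (if i = 0 then - 2 * (\<gamma> * m * y $ 2 + \<delta> * n * y $ 3) / (n\<^sup>2 - m\<^sup>2)
    else 2 * (\<gamma> * n * y $ 2 + \<delta> * m * y $ 3) / (n\<^sup>2 - m\<^sup>2))"

definition wq :: "complex^4 \<Rightarrow> complex" where
  "wq y = y $ 2 * y $ 3 + quad q0 q1 q2 (y $ 0) (y $ 1)"

text \<open>On the lift of sign \<open>e\<close> this factor is \<open>- r\<close> times the fourth
  power of \<open>s $ i\<close>, so it does not vanish there over chart \<open>i\<close>.\<close>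

definition xi :: "complex \<Rightarrow> 2 \<Rightarrow> complex^4 \<Rightarrow> complex \<Rightarrow> complex" where
  "xi e i y z = wq y + sg i * \<i> * e * z"

definition mk4 :: "complex \<Rightarrow> complex \<Rightarrow> complex \<Rightarrow> complex \<Rightarrow> complex^4" where
  "mk4 u v w x = (\<chi> j. if j = 0 then u else if j = 1 then v else if j = 2 then w else x)"

lemma mk4_nth [simp]: "mk4 u v w x $ 0 = u" "mk4 u v w x $ 1 = v" "mk4 u v w x $ 2 = w" "mk4 u v w x $ 3 = x"
  unfolding mk4_def by simp_all

text \<open>In type \<open>4\<close> the numeral 4 is 0, which reconciles the library's indices 1 to
  4 with the homogeneous coordinates 0 to 3.\<close>

lemma forall_4': "(\<forall>j::4. P j) \<longleftrightarrow> P 0 \<and> P 1 \<and> P 2 \<and> P 3"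
proof -
  have "P 4 \<longleftrightarrow> P 0" by (rule arg_cong[where f=P]) simp
  then show ?thesis unfolding forall_4 by blast
qed

lemma vec4_eq_iff: "x = y \<longleftrightarrow> x $ 0 = y $ 0 \<and> x $ 1 = y $ 1 \<and> x $ 2 = y $ 2 \<and> x $ 3 = y $ 3" for x y :: "complex^4"
  unfolding vec_eq_iff forall_4' ..

lemma cdiff_4I: "cdf (\<lambda>x. g x $ 0) x \<Longrightarrow> cdf (\<lambda>x. g x $ 1) x \<Longrightarrow> cdf (\<lambda>x. g x $ 2) x \<Longrightarrow> cdf (\<lambda>x. g x $ 3) x \<Longrightarrow> cdiff g x"
  for g :: "complex^'k \<Rightarrow> complex^4"
  unfolding cdiff_def forall_4' by blast

text \<open>Four functions on the part where \<open>ell i\<close> is nonzero. They satisfy the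
  single relation \<open>xc_relation\<close>, determine the point by \<open>xc_reconstruct\<close>,
  and turn the lift of sign \<open>e\<close> into the polynomial curve \<open>cpt\<close>, whose
  last entry is constant.\<close>

definition xc :: "complex \<Rightarrow> 2 \<Rightarrow> ((complex^4) \<times> complex) set \<Rightarrow> complex^4" where
  "xc e i E = (let (y, z) = (SOME p. p \<in> E) in
     mk4 (y $ 0 / ell i y) (y $ 1 / ell i y) (ell (i + 1) y / ell i y) (xi e i y z / (ell i y)\<^sup>2))"

lemma ell_scale: "ell i (k *s y) = k * ell i y"
  unfolding ell_def by (simp add: algebra_simps)

lemma wq_scale: "wq (k *s y) = k\<^sup>2 * wq y"
  unfolding wq_def quad_def by (simp add: algebra_simps power2_eq_square)

lemma xi_scale: "xi e i (k *s y) (k\<^sup>2 * z) = k\<^sup>2 * xi e i y z"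
  unfolding xi_def wq_scale by (simp add: algebra_simps)

lemma xc_tw: "xc e i (tw 2 y z) = mk4 (y $ 0 / ell i y) (y $ 1 / ell i y) (ell (i + 1) y / ell i y) (xi e i y z / (ell i y)\<^sup>2)"
proof -
  obtain k where "k \<noteq> 0" "(SOME p. p \<in> tw 2 y z) = (k *s y, k\<^sup>2 * z)" using tw_some by blast
  then show ?thesis unfolding xc_def by (simp add: ell_scale xi_scale power_mult_distrib)
qed

lemma disc: "(n\<^sup>2 - m\<^sup>2)\<^sup>2 = 16 * (q\<^sup>2 - r\<^sup>2)"
proof -
  have "(n\<^sup>2 - m\<^sup>2)\<^sup>2 = (m\<^sup>2 + n\<^sup>2)\<^sup>2 - 4 * (m * n)\<^sup>2" by (simp add: power2_eq_square algebra_simps)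
  then show ?thesis unfolding mn mn2 by (simp add: power2_eq_square algebra_simps)
qed

text \<open>Expresses that \<open>ell 0\<close> and \<open>ell 1\<close> are independent linear
  forms in \<open>y $ 2\<close> and \<open>y $ 3\<close>.\<close>

lemma disc_nz: "n\<^sup>2 - m\<^sup>2 \<noteq> 0"
proof
  assume "n\<^sup>2 - m\<^sup>2 = 0"
  then have "16 * (q\<^sup>2 - r\<^sup>2) = 0" using disc by (metis zero_power2)
  then show False using qr by simp
qed

lemma c0: "\<gamma> \<noteq> 0" "\<delta> \<noteq> 0"
  using cd by auto

lemma y2_ell: "y $ 2 = \<delta> * (m * ell 0 y + n * ell 1 y) / 2"
proof -
  have "m * ell 0 y + n * ell 1 y = (2 * \<gamma> * y $ 2) * (n\<^sup>2 - m\<^sup>2) / (n\<^sup>2 - m\<^sup>2)"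
    unfolding ell_def by (simp add: add_divide_distrib[symmetric] diff_divide_distrib[symmetric] power2_eq_square algebra_simps)
  then have "m * ell 0 y + n * ell 1 y = 2 * \<gamma> * y $ 2" using disc_nz by simp
  then have "\<delta> * (m * ell 0 y + n * ell 1 y) = 2 * (\<gamma> * \<delta>) * y $ 2" by simp
  then show ?thesis unfolding cd by simp
qed

lemma y3_ell: "y $ 3 = - \<gamma> * (n * ell 0 y + m * ell 1 y) / 2"
proof -
  have "n * ell 0 y + m * ell 1 y = (- 2 * \<delta> * y $ 3) * (n\<^sup>2 - m\<^sup>2) / (n\<^sup>2 - m\<^sup>2)"
    unfolding ell_def by (simp add: add_divide_distrib[symmetric] diff_divide_distrib[symmetric] power2_eq_square algebra_simps)
  then have "n * ell 0 y + m * ell 1 y = - 2 * \<delta> * y $ 3" using disc_nz by simp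
  then have "\<gamma> * (n * ell 0 y + m * ell 1 y) = - 2 * (\<gamma> * \<delta>) * y $ 3" by simp
  then show ?thesis unfolding cd by simp
qed

text \<open>On the conic the product \<open>ell 0 y * ell 1 y\<close> is the square of
  \<open>y $ 1\<close>, so the last term cancels the quadratic form in \<open>wq\<close>. What
  remains is a sum of squares of the forms \<open>ell\<close>, that is, of fourth powers of the
  parameters.\<close>

lemma y23_ell: "y $ 2 * y $ 3 = - (r / 2) * ((ell 0 y)\<^sup>2 + (ell 1 y)\<^sup>2) - q * ell 0 y * ell 1 y"
proof -
  have "y $ 2 * y $ 3 = - (\<gamma> * \<delta>) * ((m * n) * ((ell 0 y)\<^sup>2 + (ell 1 y)\<^sup>2) + (m\<^sup>2 + n\<^sup>2) * ell 0 y * ell 1 y) / 4"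
    by (subst y2_ell, subst y3_ell) (simp add: power2_eq_square field_simps)
  then show ?thesis unfolding cd mn mn2 by (simp add: add_divide_distrib diff_divide_distrib)
qed

lemma y23_ell_i: "y $ 2 * y $ 3 = - (r / 2) * ((ell i y)\<^sup>2 + (ell (i + 1) y)\<^sup>2) - q * ell i y * ell (i + 1) y"
  using y23_ell[of y] two_cases[of i 0] by (auto simp: two_eq_0 ac_simps)

definition wx :: "complex^4 \<Rightarrow> complex" where
  "wx x = - (r / 2) * ((x $ 2)\<^sup>2 + 1) - q * x $ 2 + quad q0 q1 q2 (x $ 0) (x $ 1)"

lemma wx_xc:
  assumes "ell i y \<noteq> 0" shows "wx (xc e i (tw 2 y z)) = wq y / (ell i y)\<^sup>2"
  unfolding wx_def xc_tw wq_def y23_ell_i[of y i] quad_def mk4_nth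
  using assms by (simp add: field_simps power2_eq_square)

lemma double_eq_iff: "double_eq a b q0 q1 q2 (y, z) = 0 \<longleftrightarrow> (wq y)\<^sup>2 + z\<^sup>2 = f4 a b (y $ 0) (y $ 1)"
  unfolding double_eq_def branch_quartic_def wq_def f4_def by (auto simp: algebra_simps)

text \<open>The sign \<open>e\<close> merely exchanges the factors \<open>w + iz\<close> and
  \<open>w - iz\<close>. The second factor is written as \<open>2 w - xi\<close> because this form
  can be expressed through the coordinates of a single chart.\<close>

lemma xi_prod: "e\<^sup>2 = 1 \<Longrightarrow> xi e i y z * (2 * wq y - xi e i y z) = (wq y)\<^sup>2 + z\<^sup>2"
proof -
  assume e: "e\<^sup>2 = 1"
  have "xi e i y z * (2 * wq y - xi e i y z) = (wq y)\<^sup>2 - (sg i * sg i) * (\<i> * \<i>) * e\<^sup>2 * z\<^sup>2"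
    unfolding xi_def by algebra
  then show ?thesis using e by simp
qed

lemma xc_relation:
  assumes e: "e\<^sup>2 = 1" and z: "double_eq a b q0 q1 q2 (y, z) = 0" and l: "ell i y \<noteq> 0"
  defines "x \<equiv> xc e i (tw 2 y z)"
  shows "x $ 3 * (2 * wx x - x $ 3) = f4 a b (x $ 0) (x $ 1)"
proof -
  have "x $ 3 * (2 * wx x - x $ 3) = xi e i y z * (2 * wq y - xi e i y z) / (ell i y ^ 4)"
    unfolding x_def wx_xc[OF l] unfolding xc_tw mk4_nth using l by (simp add: field_simps power2_eq_square power4_eq_xxxx)
  also have "\<dots> = f4 a b (y $ 0) (y $ 1) / (ell i y ^ 4)" using xi_prod[OF e] z double_eq_iff by simp
  also have "\<dots> = f4 a b (x $ 0) (x $ 1)" unfolding x_def xc_tw mk4_nth f4_def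
    using l by (simp add: field_simps power4_eq_xxxx)
  finally show ?thesis .
qed

text \<open>The other chart uses the complementary factor, which is why its fourth coordinate comes
  from \<open>2 * wx x - x $ 3\<close>.\<close>

lemma xc_transition:
  fixes e z
  assumes l: "ell i y \<noteq> 0" "ell (i + 1) y \<noteq> 0"
  defines "x \<equiv> xc e i (tw 2 y z)" and "x' \<equiv> xc e (i + 1) (tw 2 y z)"
  shows "x' $ 0 * x $ 2 = x $ 0" "x' $ 1 * x $ 2 = x $ 1" "x' $ 2 * x $ 2 = 1" "x' $ 3 * (x $ 2)\<^sup>2 = 2 * wx x - x $ 3"
proof -
  show "x' $ 0 * x $ 2 = x $ 0" "x' $ 1 * x $ 2 = x $ 1" "x' $ 2 * x $ 2 = 1"
    unfolding x_def x'_def xc_tw mk4_nth two_add using l by simp_all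
  have "xi e (i + 1) y z = 2 * wq y - xi e i y z" unfolding xi_def sg_simps by simp
  then show "x' $ 3 * (x $ 2)\<^sup>2 = 2 * wx x - x $ 3"
    unfolding x_def x'_def wx_xc[OF l(1)] unfolding xc_tw mk4_nth two_add using l by (simp add: field_simps power2_eq_square)
qed

text \<open>Together with \<open>Zx\<close> this inverts \<open>xc\<close>; the representative is
  normalised so that the form \<open>ell i\<close> takes the value 1.\<close>

definition Yx :: "2 \<Rightarrow> complex^4 \<Rightarrow> complex^4" where
  "Yx i x = (let u = (if i = 0 then 1 else x $ 2); v = (if i = 0 then x $ 2 else 1) in
     mk4 (x $ 0) (x $ 1) (\<delta> * (m * u + n * v) / 2) (- \<gamma> * (n * u + m * v) / 2))"

definition Zx :: "complex \<Rightarrow> 2 \<Rightarrow> complex^4 \<Rightarrow> complex" where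
  "Zx e i x = - sg i * \<i> * e * (x $ 3 - wx x)"

lemma xc_reconstruct:
  assumes e: "e\<^sup>2 = 1" and l: "ell i y \<noteq> 0"
  shows "Yx i (xc e i (tw 2 y z)) = (1 / ell i y) *s y" "Zx e i (xc e i (tw 2 y z)) = z / (ell i y)\<^sup>2"
    "tw 2 (Yx i (xc e i (tw 2 y z))) (Zx e i (xc e i (tw 2 y z))) = tw 2 y z"
proof -
  have i: "i = 0 \<or> i = 1" using two_cases[of i 0] by auto
  show 1: "Yx i (xc e i (tw 2 y z)) = (1 / ell i y) *s y"
    unfolding vec4_eq_iff xc_tw Yx_def Let_def
    using y2_ell[of y] y3_ell[of y] l i by (auto simp: two_eq_0 field_simps)
  have "Zx e i (xc e i (tw 2 y z)) = - sg i * \<i> * e * (xi e i y z - wq y) / (ell i y)\<^sup>2"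
    unfolding Zx_def wx_xc[OF l] unfolding xc_tw mk4_nth by (simp add: diff_divide_distrib[symmetric])
  also have "- sg i * \<i> * e * (xi e i y z - wq y) = - (sg i * sg i) * (\<i> * \<i>) * e\<^sup>2 * z"
    unfolding xi_def by algebra
  also have "\<dots> = z" using e by simp
  finally show 2: "Zx e i (xc e i (tw 2 y z)) = z / (ell i y)\<^sup>2" .
  show "tw 2 (Yx i (xc e i (tw 2 y z))) (Zx e i (xc e i (tw 2 y z))) = tw 2 y z"
    unfolding 1 2 using tw_scale[of "1 / ell i y" 2 y z] l by (simp add: power_divide)
qed

section \<open>Parametrisation of the conic and of its two lifts\<close>

definition Yc :: "complex^2 \<Rightarrow> complex^4" where
  "Yc s = mk4 (of_real la * s $ 0 * s $ 1) (s $ 0 * s $ 1)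
     (\<delta> * (m * (s $ 0)\<^sup>2 + n * (s $ 1)\<^sup>2) / 2) (- \<gamma> * (n * (s $ 0)\<^sup>2 + m * (s $ 1)\<^sup>2) / 2)"

definition Zc :: "complex \<Rightarrow> complex^2 \<Rightarrow> complex" where
  "Zc e s = e * \<i> * (r / 2) * ((s $ 0) ^ 4 - (s $ 1) ^ 4)"

lemma ell_Yc: "ell i (Yc s) = (s $ i)\<^sup>2"
proof -
  have "- 2 * (\<gamma> * m * Yc s $ 2 + \<delta> * n * Yc s $ 3) = - (\<gamma> * \<delta>) * (m * (m * (s $ 0)\<^sup>2 + n * (s $ 1)\<^sup>2) - n * (n * (s $ 0)\<^sup>2 + m * (s $ 1)\<^sup>2))"
    "2 * (\<gamma> * n * Yc s $ 2 + \<delta> * m * Yc s $ 3) = (\<gamma> * \<delta>) * (n * (m * (s $ 0)\<^sup>2 + n * (s $ 1)\<^sup>2) - m * (n * (s $ 0)\<^sup>2 + m * (s $ 1)\<^sup>2))"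
    unfolding Yc_def mk4_nth by (simp_all add: field_simps)
  then have "- 2 * (\<gamma> * m * Yc s $ 2 + \<delta> * n * Yc s $ 3) = (s $ 0)\<^sup>2 * (n\<^sup>2 - m\<^sup>2)"
    "2 * (\<gamma> * n * Yc s $ 2 + \<delta> * m * Yc s $ 3) = (s $ 1)\<^sup>2 * (n\<^sup>2 - m\<^sup>2)"
    unfolding cd by (simp_all add: algebra_simps power2_eq_square)
  then have "ell 0 (Yc s) = (s $ 0)\<^sup>2 * (n\<^sup>2 - m\<^sup>2) / (n\<^sup>2 - m\<^sup>2)" "ell 1 (Yc s) = (s $ 1)\<^sup>2 * (n\<^sup>2 - m\<^sup>2) / (n\<^sup>2 - m\<^sup>2)"
    unfolding ell_def by simp_all
  then have "ell 0 (Yc s) = (s $ 0)\<^sup>2" "ell 1 (Yc s) = (s $ 1)\<^sup>2" using disc_nz by simp_all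
  then show ?thesis using two_cases[of i 0] by auto
qed

lemma Yc_scale: "Yc (k *s s) = k\<^sup>2 *s Yc s"
  unfolding vec4_eq_iff Yc_def by (simp add: algebra_simps power2_eq_square)

lemma Zc_scale: "Zc e (k *s s) = (k\<^sup>2)\<^sup>2 * Zc e s"
  unfolding Zc_def by (simp add: algebra_simps power4_eq_xxxx power2_eq_square)

lemma quad_la: "quad q0 q1 q2 (of_real la * u) u = q * u\<^sup>2" for u :: complex
  unfolding q_eq[symmetric] quad_def by (simp add: algebra_simps power2_eq_square)

lemma f4_la: "f4 a b (of_real la * u) u = r\<^sup>2 * u ^ 4"
  unfolding r2[symmetric] f4_def by (simp add: algebra_simps power4_eq_xxxx)

lemma wq_Yc: "wq (Yc s) = - (r / 2) * ((s $ 0) ^ 4 + (s $ 1) ^ 4)"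
proof -
  have "quad q0 q1 q2 (Yc s $ 0) (Yc s $ 1) = q * (s $ 0 * s $ 1)\<^sup>2"
    using quad_la[of "s $ 0 * s $ 1"] unfolding Yc_def by (simp add: mult.assoc)
  then show ?thesis unfolding wq_def y23_ell ell_Yc by (simp add: algebra_simps power4_eq_xxxx power2_eq_square)
qed

lemma double_eq_curve: "e\<^sup>2 = 1 \<Longrightarrow> double_eq a b q0 q1 q2 (Yc s, Zc e s) = 0"
proof -
  assume e: "e\<^sup>2 = 1"
  have f: "f4 a b (Yc s $ 0) (Yc s $ 1) = r\<^sup>2 * (s $ 0 * s $ 1) ^ 4"
    using f4_la[of "s $ 0 * s $ 1"] unfolding Yc_def by (simp add: mult.assoc)
  have "(Zc e s)\<^sup>2 = e\<^sup>2 * (\<i> * \<i>) * ((r / 2) * ((s $ 0) ^ 4 - (s $ 1) ^ 4))\<^sup>2"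
    unfolding Zc_def by (simp only: power2_eq_square ac_simps)
  then have "(Zc e s)\<^sup>2 = - ((r / 2) * ((s $ 0) ^ 4 - (s $ 1) ^ 4))\<^sup>2" using e by simp
  then show ?thesis unfolding double_eq_iff f wq_Yc
    by (simp add: field_simps power4_eq_xxxx power2_eq_square)
qed

lemma xc_curve:
  assumes e: "e\<^sup>2 = 1" and s: "s $ i \<noteq> 0"
  defines "w \<equiv> s $ (i + 1) / s $ i"
  shows "xc e i (tw 2 (Yc s) (Zc e s)) = mk4 (of_real la * w) w (w\<^sup>2) (- r)"
proof -
  have i: "i = 0 \<or> i = 1" using two_cases[of i 0] by auto
  have "\<i> * e * Zc e s = e\<^sup>2 * (\<i> * \<i>) * (r / 2) * ((s $ 0) ^ 4 - (s $ 1) ^ 4)"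
    unfolding Zc_def by (simp only: power2_eq_square ac_simps)
  then have "\<i> * e * Zc e s = - (r / 2) * ((s $ 0) ^ 4 - (s $ 1) ^ 4)" using e by simp
  then have "xi e i (Yc s) (Zc e s) = - r * (s $ i) ^ 4"
    unfolding xi_def wq_Yc using i by (auto simp: mult.assoc field_simps)
  then show ?thesis unfolding vec4_eq_iff xc_tw ell_Yc w_def using s i
    by (auto simp: Yc_def two_eq_0 field_simps power4_eq_xxxx power2_eq_square)
qed

definition on_conic :: "complex^4 \<Rightarrow> bool" where
  "on_conic y \<longleftrightarrow> y $ 0 = of_real la * y $ 1 \<and> ell 0 y * ell 1 y = (y $ 1)\<^sup>2"

text \<open>By \<open>mn\<close> and \<open>mn2\<close> the product \<open>(\<gamma> m y2 + \<delta>
  n y3) (\<gamma> n y2 + \<delta> m y3)\<close> is twice the part of the equation in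
  \<open>y2\<close> and \<open>y3\<close>, where these stand for \<open>y $ 2\<close> and
  \<open>y $ 3\<close>. The square of the denominator, computed in \<open>disc\<close>, matches the
  coefficient of \<open>(y $ 1)\<^sup>2\<close>.\<close>

lemma conic_ell:
  assumes "2 * (q\<^sup>2 - r\<^sup>2) * (y $ 1)\<^sup>2 + r * \<gamma>\<^sup>2 * (y $ 2)\<^sup>2 + 2 * q * y $ 2 * y $ 3 + r * \<delta>\<^sup>2 * (y $ 3)\<^sup>2 = 0"
  shows "ell 0 y * ell 1 y = (y $ 1)\<^sup>2"
proof -
  have "ell 0 y * ell 1 y = - 4 * ((\<gamma> * m * y $ 2 + \<delta> * n * y $ 3) * (\<gamma> * n * y $ 2 + \<delta> * m * y $ 3)) / (n\<^sup>2 - m\<^sup>2)\<^sup>2"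
  proof -
    have "(- 2 * X / D) * (2 * Y / D) = - 4 * (X * Y) / D\<^sup>2" for X Y D :: complex by (simp add: power2_eq_square)
    moreover have "ell 0 y = - 2 * (\<gamma> * m * y $ 2 + \<delta> * n * y $ 3) / (n\<^sup>2 - m\<^sup>2)"
      unfolding ell_def by (rule if_P) simp
    moreover have "ell 1 y = 2 * (\<gamma> * n * y $ 2 + \<delta> * m * y $ 3) / (n\<^sup>2 - m\<^sup>2)"
      unfolding ell_def by (rule if_not_P) simp
    ultimately show ?thesis by (simp only:)
  qed
  also have "(\<gamma> * m * y $ 2 + \<delta> * n * y $ 3) * (\<gamma> * n * y $ 2 + \<delta> * m * y $ 3) =
      (m * n) * (\<gamma>\<^sup>2 * (y $ 2)\<^sup>2 + \<delta>\<^sup>2 * (y $ 3)\<^sup>2) + (m\<^sup>2 + n\<^sup>2) * (\<gamma> * \<delta>) * (y $ 2 * y $ 3)"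
    by algebra
  also have "\<dots> = - 4 * (q\<^sup>2 - r\<^sup>2) * (y $ 1)\<^sup>2" using assms unfolding mn mn2 cd by algebra
  also have "- 4 * (- 4 * (q\<^sup>2 - r\<^sup>2) * (y $ 1)\<^sup>2) / (n\<^sup>2 - m\<^sup>2)\<^sup>2 = (n\<^sup>2 - m\<^sup>2)\<^sup>2 * (y $ 1)\<^sup>2 / (n\<^sup>2 - m\<^sup>2)\<^sup>2"
    by (rule arg_cong[where f="\<lambda>t. t / (n\<^sup>2 - m\<^sup>2)\<^sup>2"]) (unfold disc, algebra)
  also have "\<dots> = (y $ 1)\<^sup>2" using disc_nz by simp
  finally show ?thesis .
qed

lemma on_conic_scale: "k \<noteq> 0 \<Longrightarrow> on_conic (k *s y) \<longleftrightarrow> on_conic y"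
  unfolding on_conic_def by (auto simp: ell_scale power2_eq_square)

lemma m0: "m \<noteq> 0" "n \<noteq> 0"
  using mn r0 by auto

text \<open>Differentiating along \<open>y $ 3\<close>, \<open>y $ 2\<close> and \<open>z\<close>
  shows that \<open>wq y\<close> annihilates both \<open>y $ 2\<close> and \<open>y $ 3\<close>, and
  that \<open>z = 0\<close>. If \<open>wq y = 0\<close>, the equation forces
  \<open>y $ 1 = 0\<close>; otherwise both coordinates vanish and the conic forces the same. Then
  \<open>y $ 2 * y $ 3 = 0\<close> and \<open>ell 0 y * ell 1 y = 0\<close> leave only the zero
  vector.\<close>

lemma smooth_on_conic:
  assumes y: "on_conic y" "y \<noteq> 0" and F: "double_eq a b q0 q1 q2 (y, z) = 0"
    and D: "(double_eq a b q0 q1 q2 has_derivative (\<lambda>_. 0)) (at (y, z))"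
  shows False
proof -
  have deq: "double_eq a b q0 q1 q2 = (\<lambda>(y, z). z\<^sup>2 + (wq y)\<^sup>2 - f4 a b (y $ 0) (y $ 1))"
    unfolding double_eq_def branch_quartic_def wq_def f4_def by (auto simp: fun_eq_iff algebra_simps)
  have mult_0: "(*) (0::complex) = (\<lambda>_. 0)" by (simp add: fun_eq_iff)
  have line: "((\<lambda>t. double_eq a b q0 q1 q2 (y + t *s v, z)) has_field_derivative 0) (at 0)" for v
  proof -
    have bl: "bounded_linear (\<lambda>t::complex. t *s v)"
      by (intro linear_conv_bounded_linear[THEN iffD1] linearI) (auto simp: vec_eq_iff algebra_simps)
    have "((\<lambda>t. (y + t *s v, z)) has_derivative (\<lambda>t. (t *s v, 0))) (at 0)"
      using has_derivative_add[OF has_derivative_const bounded_linear_imp_has_derivative[OF bl]]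
      by (intro has_derivative_Pair) auto
    from has_derivative_compose[OF this, of "double_eq a b q0 q1 q2" "\<lambda>_. 0"] D
    have "((\<lambda>t. double_eq a b q0 q1 q2 (y + t *s v, z)) has_derivative (\<lambda>_. 0)) (at 0)" by simp
    then show ?thesis unfolding has_field_derivative_def mult_0 .
  qed
  have e2: "(axis 2 1 :: complex^4) $ 0 = 0" "(axis 2 1 :: complex^4) $ 1 = 0" "(axis 2 1 :: complex^4) $ 2 = 1" "(axis 2 1 :: complex^4) $ 3 = 0"
    and e3: "(axis 3 1 :: complex^4) $ 0 = 0" "(axis 3 1 :: complex^4) $ 1 = 0" "(axis 3 1 :: complex^4) $ 2 = 0" "(axis 3 1 :: complex^4) $ 3 = 1"
    by (simp_all add: axis_def)
  have "((\<lambda>t. z\<^sup>2 + (wq (y + t *s axis 2 1))\<^sup>2 - f4 a b (y $ 0) (y $ 1)) has_field_derivative 2 * wq y * y $ 3) (at 0)"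
    unfolding wq_def quad_def
    by (auto intro!: derivative_eq_intros simp: e2)
  moreover have "((\<lambda>t. z\<^sup>2 + (wq (y + t *s axis 2 1))\<^sup>2 - f4 a b (y $ 0) (y $ 1)) has_field_derivative 0) (at 0)"
    using line[of "axis 2 1"] unfolding deq by (simp add: e2)
  ultimately have A: "2 * wq y * y $ 3 = 0" by (rule DERIV_unique)
  have "((\<lambda>t. z\<^sup>2 + (wq (y + t *s axis 3 1))\<^sup>2 - f4 a b (y $ 0) (y $ 1)) has_field_derivative 2 * wq y * y $ 2) (at 0)"
    unfolding wq_def quad_def
    by (auto intro!: derivative_eq_intros simp: e3)
  moreover have "((\<lambda>t. z\<^sup>2 + (wq (y + t *s axis 3 1))\<^sup>2 - f4 a b (y $ 0) (y $ 1)) has_field_derivative 0) (at 0)"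
    using line[of "axis 3 1"] unfolding deq by (simp add: e3)
  ultimately have B: "2 * wq y * y $ 2 = 0" by (rule DERIV_unique)
  have zl: "((\<lambda>t. double_eq a b q0 q1 q2 (y, z + t)) has_field_derivative 0) (at 0)"
  proof -
    have "((\<lambda>t. (y, z + t)) has_derivative (\<lambda>t. (0, t))) (at 0)"
      by (auto intro!: derivative_eq_intros)
    from has_derivative_compose[OF this, of "double_eq a b q0 q1 q2" "\<lambda>_. 0"] D
    have "((\<lambda>t. double_eq a b q0 q1 q2 (y, z + t)) has_derivative (\<lambda>_. 0)) (at 0)" by simp
    then show ?thesis unfolding has_field_derivative_def mult_0 .
  qed
  have "((\<lambda>t. (z + t)\<^sup>2 + (wq y)\<^sup>2 - f4 a b (y $ 0) (y $ 1)) has_field_derivative 2 * z) (at 0)"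
    by (auto intro!: derivative_eq_intros)
  moreover have "((\<lambda>t. (z + t)\<^sup>2 + (wq y)\<^sup>2 - f4 a b (y $ 0) (y $ 1)) has_field_derivative 0) (at 0)"
    using zl unfolding deq by simp
  ultimately have z0: "2 * z = 0" by (rule DERIV_unique)
  have y0: "y $ 0 = of_real la * y $ 1" and l: "ell 0 y * ell 1 y = (y $ 1)\<^sup>2" using y(1) unfolding on_conic_def by auto
  have w: "(wq y)\<^sup>2 = r\<^sup>2 * (y $ 1) ^ 4" using F z0 unfolding double_eq_iff y0 f4_la by simp
  have y1: "y $ 1 = 0"
  proof (cases "wq y = 0")
    case True then show ?thesis using w r0 by simp
  next
    case False
    then have "y $ 2 = 0" "y $ 3 = 0" using A B by auto
    then have "ell 0 y = 0" unfolding ell_def by simp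
    then show ?thesis using l by simp
  qed
  then have "wq y = 0" using w by simp
  then have "y $ 2 * y $ 3 = 0" using y1 y0 unfolding wq_def quad_def by simp
  moreover have "ell 0 y * ell 1 y = 0" using l y1 by simp
  ultimately have "y $ 2 = 0 \<and> y $ 3 = 0"
    using m0 c0 disc_nz unfolding ell_def by auto
  then have "y = 0" unfolding vec4_eq_iff using y1 y0 by simp
  then show False using y(2) by simp
qed

lemma conic_param:
  assumes y: "on_conic y" "y \<noteq> 0" and F: "double_eq a b q0 q1 q2 (y, z) = 0"
  shows "\<exists>s. s \<noteq> 0 \<and> y = Yc s \<and> (z = Zc 1 s \<or> z = Zc (- 1) s)"
proof -
  have y0: "y $ 0 = of_real la * y $ 1" and l: "ell 0 y * ell 1 y = (y $ 1)\<^sup>2" using y(1) unfolding on_conic_def by auto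
  define u where "u = csqrt (ell 0 y)"
  \<comment> \<open>The sign of the second root is dictated by \<open>u * v = y $ 1\<close>. If
    \<open>u = 0\<close>, either sign works, since the conic then gives
    \<open>y $ 1 = 0\<close>.\<close>
  define v where "v = (if ell 0 y = 0 then csqrt (ell 1 y) else y $ 1 / u)"
  have u2: "u\<^sup>2 = ell 0 y" unfolding u_def by simp
  have uv: "u * v = y $ 1 \<and> v\<^sup>2 = ell 1 y"
  proof (cases "ell 0 y = 0")
    case True
    then show ?thesis using l unfolding u_def v_def by simp
  next
    case False
    then have "u \<noteq> 0" using u2 by auto
    then show ?thesis using False l u2 unfolding v_def by (simp add: power_divide field_simps)
  qed
  define s :: "complex^2" where "s = (\<chi> j. if j = 0 then u else v)"
  have s: "s $ 0 = u" "s $ 1 = v" unfolding s_def by simp_all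
  have Y: "y = Yc s" unfolding vec4_eq_iff Yc_def mk4_nth s
    using y0 uv u2 y2_ell[of y] y3_ell[of y] by (auto simp: mult.assoc)
  have "s \<noteq> 0"
  proof
    assume "s = 0"
    then have "y = 0" unfolding Y Yc_def vec4_eq_iff by simp
    then show False using y(2) by simp
  qed
  moreover have "z\<^sup>2 = (Zc 1 s)\<^sup>2"
  proof -
    have "(wq (Yc s))\<^sup>2 + z\<^sup>2 = (wq (Yc s))\<^sup>2 + (Zc 1 s)\<^sup>2"
      using F double_eq_curve[of 1 s] unfolding Y double_eq_iff by simp
    then show ?thesis by simp
  qed
  then have "z = Zc 1 s \<or> z = - Zc 1 s" by (simp add: power2_eq_iff)
  then have "z = Zc 1 s \<or> z = Zc (- 1) s" unfolding Zc_def by simp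
  ultimately show ?thesis using Y by blast
qed

section \<open>First-order data along a lift\<close>

definition f' :: complex where
  "f' = of_real (3 * a * la\<^sup>2 + 2 * (a - b) * la - b)"

definition Q' :: complex where
  "Q' = of_real (2 * q0 * la + q1)"

definition crit :: complex where
  "crit = 2 * Q' - q * f' / r\<^sup>2"

text \<open>The differential of \<open>wx\<close> at \<open>cpt w\<close>. By Euler's relation the
  quadratic form has second partial derivative \<open>2 q - la Q'\<close> at
  \<open>(la, 1)\<close>.\<close>

definition dw :: "complex \<Rightarrow> complex^4 \<Rightarrow> complex" where
  "dw w v = - (r * w\<^sup>2 + q) * v $ 2 + w * (Q' * v $ 0 + (2 * q - of_real la * Q') * v $ 1)"

text \<open>Modulo the tangent direction, the relation \<open>lin_rel\<close> below reads
  \<open>2 r (r w\<^sup>2 + q) x + r (1 - w^4) v\<^sub>3 = (\<dots>) eta\<close> with \<open>x = v\<^sub>2 - 2 w v\<^sub>1\<close>. The coefficients \<open>2 r\<close> and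
  \<open>q / r - w\<^sup>2\<close> of \<open>x\<close> and \<open>v\<^sub>3\<close> in \<open>kappa\<close> complete those of the relation to a matrix of constant determinant.
  The multiple of \<open>eta\<close> makes the transition function a multiple of \<open>1 / w\<close>.\<close>

definition kappa :: "complex \<Rightarrow> complex^4 \<Rightarrow> complex" where
  "kappa w v = 2 * r * v $ 2 - 4 * r * w * v $ 1 + (q / r - w\<^sup>2) * v $ 3 - w * (f' / r) * (v $ 0 - of_real la * v $ 1)"

definition eta :: "complex^4 \<Rightarrow> complex" where
  "eta v = v $ 0 - of_real la * v $ 1"

definition lin_rel :: "complex \<Rightarrow> complex^4 \<Rightarrow> complex" where
  "lin_rel w v = - r * w ^ 4 * v $ 3 - r * (2 * dw w v - v $ 3) - w ^ 3 * (f' * eta v + 4 * r\<^sup>2 * v $ 1)"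

abbreviation cpt :: "complex \<Rightarrow> complex^4" where
  "cpt w \<equiv> mk4 (of_real la * w) w (w\<^sup>2) (- r)"

lemma wx_derivative: "(wx has_derivative dw w) (at (cpt w))"
proof -
  have q: "q = of_real (q0 * la\<^sup>2 + q1 * la + q2)" unfolding q_eq[symmetric] quad_def by simp
  have "(wx has_derivative (\<lambda>v. - (r / 2) * (2 * w\<^sup>2 * v $ 2) - q * v $ 2 +
      (of_real q0 * (2 * (of_real la * w) * v $ 0) + of_real q1 * (of_real la * w * v $ 1 + v $ 0 * w) + of_real q2 * (2 * w * v $ 1)))) (at (cpt w))"
    unfolding wx_def quad_def
    by (auto intro!: derivative_eq_intros bounded_linear.has_derivative[OF bounded_linear_vec_nth] simp: algebra_simps)
  moreover have "(\<lambda>v. - (r / 2) * (2 * w\<^sup>2 * v $ 2) - q * v $ 2 +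
      (of_real q0 * (2 * (of_real la * w) * v $ 0) + of_real q1 * (of_real la * w * v $ 1 + v $ 0 * w) + of_real q2 * (2 * w * v $ 1))) = dw w"
    unfolding dw_def Q'_def unfolding q by (rule ext) (simp add: algebra_simps power2_eq_square)
  ultimately show ?thesis by simp
qed

lemma wx_cpt: "wx (cpt w) = - (r / 2) * (w ^ 4 + 1)"
  unfolding wx_def mk4_nth quad_la by (simp add: algebra_simps power4_eq_xxxx power2_eq_square)

text \<open>Euler's relation for the quartic gives its second partial derivative at
  \<open>(la, 1)\<close> as \<open>4 r^2 - la f'\<close>, so its differential is a combination of
  \<open>eta v\<close> and \<open>v $ 1\<close>. On the curve the complementary factor
  \<open>2 * wx x - x $ 3\<close> has the value \<open>- r * w ^ 4\<close>.\<close>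

lemma relation_derivative:
  "((\<lambda>x. x $ 3 * (2 * wx x - x $ 3) - f4 a b (x $ 0) (x $ 1)) has_derivative lin_rel w) (at (cpt w))"
proof -
  have r2': "r\<^sup>2 = of_real (la * (la + 1) * (a * la - b))" unfolding r2[symmetric] f4_def by simp
  have n: "((\<lambda>x::complex^4. x $ i) has_derivative (\<lambda>v. v $ i)) F" for i F
    by (rule bounded_linear_imp_has_derivative) blast
  have f: "((\<lambda>x::complex^4. f4 a b (x $ 0) (x $ 1)) has_derivative (\<lambda>v. w ^ 3 * (f' * eta v + 4 * r\<^sup>2 * v $ 1))) (at (cpt w))"
  proof -
    have "((\<lambda>x::complex^4. f4 a b (x $ 0) (x $ 1)) has_derivative (\<lambda>v.
       (of_real la * w * w * (of_real la * w + w)) * (of_real a * v $ 0 - of_real b * v $ 1) +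
       (of_real la * w * w * (v $ 0 + v $ 1) + (of_real la * w * v $ 1 + v $ 0 * w) * (of_real la * w + w)) * (of_real a * (of_real la * w) - of_real b * w))) (at (cpt w))"
      unfolding f4_def by (rule derivative_eq_intros n refl)+ simp
    moreover have "(of_real la * w * w * (of_real la * w + w)) * (of_real a * v $ 0 - of_real b * v $ 1) +
       (of_real la * w * w * (v $ 0 + v $ 1) + (of_real la * w * v $ 1 + v $ 0 * w) * (of_real la * w + w)) * (of_real a * (of_real la * w) - of_real b * w)
       = w ^ 3 * (f' * eta v + 4 * r\<^sup>2 * v $ 1)" for v
      unfolding r2' f'_def eta_def by (simp add: algebra_simps power2_eq_square power3_eq_cube)
    ultimately show ?thesis by simp
  qed
  have "((\<lambda>x. x $ 3 * (2 * wx x - x $ 3) - f4 a b (x $ 0) (x $ 1)) has_derivative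
     (\<lambda>v. (cpt w $ 3 * (2 * dw w v - v $ 3) + v $ 3 * (2 * wx (cpt w) - cpt w $ 3)) - w ^ 3 * (f' * eta v + 4 * r\<^sup>2 * v $ 1))) (at (cpt w))"
    by (intro has_derivative_diff f has_derivative_mult n has_derivative_mult_right wx_derivative)
  moreover have "(cpt w $ 3 * (2 * dw w v - v $ 3) + v $ 3 * (2 * wx (cpt w) - cpt w $ 3)) - w ^ 3 * (f' * eta v + 4 * r\<^sup>2 * v $ 1) = lin_rel w v" for v
    unfolding wx_cpt mk4_nth lin_rel_def by (simp add: algebra_simps)
  ultimately show ?thesis by simp
qed

text \<open>With \<open>eta v = 0\<close> only \<open>x\<close> and \<open>v $ 3\<close> are left.
  Eliminating \<open>x\<close> yields \<open>q\<^sup>2 - r\<^sup>2\<close> times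
  \<open>v $ 3\<close> for every \<open>w\<close>, so \<open>v\<close> is tangent to the curve at
  each point of the chart, including \<open>w = 0\<close>.\<close>

lemma kernel_lin:
  assumes "lin_rel w v = 0" "kappa w v = 0" "eta v = 0"
  shows "v = v $ 1 *s mk4 (of_real la) 1 (2 * w) 0"
proof -
  have v0: "v $ 0 = of_real la * v $ 1" using assms(3) unfolding eta_def by simp
  define x where "x = v $ 2 - 2 * w * v $ 1"
  have k: "2 * r\<^sup>2 * x + (q - r * w\<^sup>2) * v $ 3 = 0"
    using assms(2) r0 unfolding kappa_def v0 x_def by (simp add: field_simps power2_eq_square)
  have rl: "2 * (r * w\<^sup>2 + q) * x + (1 - w ^ 4) * v $ 3 = 0"
  proof -
    have "lin_rel w v = r * (2 * (r * w\<^sup>2 + q) * x + (1 - w ^ 4) * v $ 3)"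
      unfolding lin_rel_def dw_def eta_def v0 x_def by (simp add: algebra_simps power2_eq_square power3_eq_cube power4_eq_xxxx)
    then show ?thesis using assms(1) r0 by simp
  qed
  have "(q\<^sup>2 - r\<^sup>2) * v $ 3 = 0"
  proof -
    have "2 * (q\<^sup>2 - r\<^sup>2) * v $ 3 = 2 * (r * w\<^sup>2 + q) * (2 * r\<^sup>2 * x + (q - r * w\<^sup>2) * v $ 3)
       - 2 * r\<^sup>2 * (2 * (r * w\<^sup>2 + q) * x + (1 - w ^ 4) * v $ 3)"
      by (simp add: algebra_simps power2_eq_square power4_eq_xxxx)
    then show ?thesis unfolding k rl by simp
  qed
  then have v3: "v $ 3 = 0" using qr by simp
  then have "x = 0" using k r0 by simp
  then show ?thesis unfolding vec4_eq_iff using v0 v3 by (simp add: x_def algebra_simps)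
qed

lemma kappa_tangent: "kappa w (h *s mk4 (of_real la) 1 (2 * w) 0) = 0" "eta (h *s mk4 (of_real la) 1 (2 * w) 0) = 0"
  unfolding kappa_def eta_def by (simp_all add: algebra_simps)

text \<open>The overlap relation holds modulo \<open>lin_rel\<close>, whose multiple is read off the
  coefficients of \<open>v $ 3\<close>.\<close>

lemma kappa_transition:
  assumes w: "w \<noteq> 0" and rel: "lin_rel w v = 0"
    and 0: "v' $ 0 * w\<^sup>2 + (of_real la / w) * v $ 2 = v $ 0"
    and 1: "v' $ 1 * w\<^sup>2 + (1 / w) * v $ 2 = v $ 1"
    and 2: "v' $ 2 * w\<^sup>2 + (1 / w\<^sup>2) * v $ 2 = 0"
    and 3: "v' $ 3 * w ^ 4 - 2 * r * w\<^sup>2 * v $ 2 = 2 * dw w v - v $ 3"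
  shows "eta v' = eta v / w\<^sup>2" "kappa (1 / w) v' = (crit / w) * eta v - kappa w v"
proof -
  have v0: "v' $ 0 = (v $ 0 - (of_real la / w) * v $ 2) / w\<^sup>2" using 0 w by (simp add: field_simps)
  have v1: "v' $ 1 = (v $ 1 - v $ 2 / w) / w\<^sup>2" using 1 w by (simp add: field_simps)
  have v2: "v' $ 2 = - v $ 2 / w ^ 4" using 2 w by (simp add: field_simps power2_eq_square power4_eq_xxxx eq_neg_iff_add_eq_0)
  have v3: "v' $ 3 = (2 * dw w v - v $ 3 + 2 * r * w\<^sup>2 * v $ 2) / w ^ 4" using 3 w by (simp add: field_simps)
  show e: "eta v' = eta v / w\<^sup>2" unfolding eta_def v0 v1 using w by (simp add: field_simps)
  have v0': "v $ 0 = eta v + of_real la * v $ 1" unfolding eta_def by simp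
  have k: "kappa w v = 2 * r * v $ 2 - 4 * r * w * v $ 1 + (q / r - w\<^sup>2) * v $ 3 - w * (f' / r) * eta v" for w v
    unfolding kappa_def eta_def ..
  have dw: "dw w v = - (r * w\<^sup>2 + q) * v $ 2 + w * (Q' * eta v + 2 * q * v $ 1)"
    unfolding dw_def v0' by (simp add: algebra_simps)
  define \<mu> where "\<mu> = (- (q / r) * w\<^sup>2 + 1 + w ^ 4) / (r * w ^ 6)"
  have "kappa (1 / w) v' + kappa w v - (crit / w) * eta v = \<mu> * lin_rel w v"
    unfolding k e v1 v2 v3 lin_rel_def dw crit_def \<mu>_def using w r0
    by (simp add: field_simps) (simp add: algebra_simps power2_eq_square power3_eq_cube eval_nat_numeral)
  then show "kappa (1 / w) v' = (crit / w) * eta v - kappa w v" using rel by (simp add: algebra_simps eq_diff_eq)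
qed

end

section \<open>The small resolution over the regular locus\<close>

locale double_solid = conic_data +
  fixes Z :: "('z, 3) atlas" and \<mu> :: "'z \<Rightarrow> ((complex^4) \<times> complex) set"
  assumes res: "small_resolution Z TW (Z0 a b q0 q1 q2) (Z0_sing a b q0 q1 q2) \<mu>"
begin

definition V0 :: "'z set" where
  "V0 = points Z \<inter> \<mu> -` (Z0 a b q0 q1 q2 - Z0_sing a b q0 q1 q2)"

abbreviation R :: "('z, 3) atlas" where
  "R \<equiv> restrict_atlas Z V0"

lemma Z_ok: "atlas_ok Z"
  using res complex_manifold_atlas_ok unfolding small_resolution_def by blast

lemma Z_Hausdorff: "Hausdorff_space (mtop Z)"
  using res unfolding small_resolution_def complex_manifold_def by blast

lemma mu_emb: "holomorphic_embedding R TW \<mu>"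
  using res unfolding small_resolution_def V0_def by blast

lemma Z0_TW: "Z0 a b q0 q1 q2 \<subseteq> points TW"
  unfolding Z0_def TW_points by blast

lemma V0_points: "V0 \<subseteq> points Z"
  unfolding V0_def by blast

text \<open>The openness is hidden in the holomorphy of \<open>\<mu>\<close> on the restricted
  atlas: \<open>holo_on\<close> demands open domains, and the charts \<open>tU k\<close> cover the
  image.\<close>

lemma V0_open: "openin (mtop Z) V0"
  unfolding openin_mtop_iff[OF Z_ok]
proof (intro conjI V0_points ballI, clarify)
  fix U c assume C: "(U, c) \<in> Z"
  have "\<mu> p \<in> (\<Union>k. tU k)" if "p \<in> V0" for p
  proof -
    have "\<mu> p \<in> points TW" using that Z0_TW unfolding V0_def by blast
    then show ?thesis unfolding points_def TW_charts by auto
  qed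
  then have "c ` (U \<inter> V0) = (\<Union>k. c ` (U \<inter> V0 \<inter> \<mu> -` tU k))" by blast
  moreover have "open (c ` (U \<inter> V0 \<inter> \<mu> -` tU k))" for k
  proof -
    have h: "holomorphic_map R TW \<mu>" using mu_emb unfolding holomorphic_embedding_def by blast
    have "holo_on (tc k \<circ> \<mu> \<circ> inv_into (U \<inter> V0) c) (c ` (U \<inter> V0 \<inter> \<mu> -` tU k))"
      using h restrict_charts[OF C, of V0] TW_chart[of k] unfolding holomorphic_map_def by fast
    then show ?thesis unfolding holo_on_def by blast
  qed
  ultimately show "open (c ` (U \<inter> V0))" by auto
qed

lemmas R_ok = restrict_ok[OF Z_ok V0_open]

lemma R_points: "points R = V0"
  unfolding restrict_points using V0_points by blast

lemma mu_cont: "continuous_map (mtop R) (mtop TW) \<mu>"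
  and mu_hol: "p \<in> V0 \<Longrightarrow> hmap_at R TW \<mu> p"
  using mu_emb unfolding holomorphic_embedding_def holomorphic_map_iff[OF R_ok TW_ok] R_points by auto

lemma mu_inj: "inj_on \<mu> V0"
  using mu_emb R_points unfolding holomorphic_embedding_def embedding_map_def homeomorphic_map_def
  by (simp add: topspace_mtop[OF R_ok])

definition LU :: "2 \<Rightarrow> ((complex^4) \<times> complex) set set" where
  "LU i = {tw 2 y z | y z. ell i y \<noteq> 0}"

lemma tw_in_LU [simp]: "tw 2 y z \<in> LU i \<longleftrightarrow> ell i y \<noteq> 0"
  unfolding LU_def by (auto simp: tw_eq_iff ell_scale)

lemma cdf_ell: "cdf (\<lambda>x. ell i (yv k x)) x"
proof (cases "i = 0")
  case True
  show ?thesis unfolding ell_def if_P[OF True]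
    by (intro cdf_divide cdf_mult cdf_add cdf_yv cdf_const disc_nz)
next
  case False
  show ?thesis unfolding ell_def if_not_P[OF False]
    by (intro cdf_divide cdf_mult cdf_add cdf_yv cdf_const disc_nz)
qed

lemma LU_open: "openin (mtop TW) (LU i)"
proof -
  have "LU i \<subseteq> points TW" unfolding LU_def TW_points by (auto simp: ell_def)
  moreover have "open (tc k ` (tU k \<inter> LU i))" for k
    unfolding tc_preimage tw_in_LU
    by (intro open_Collect_neq continuous_on_const cdf_continuous cdf_ell)
  ultimately show ?thesis unfolding openin_mtop_iff[OF TW_ok] unfolding TW_charts by auto
qed

definition Os :: "2 \<Rightarrow> 'z set" where
  "Os i = V0 \<inter> \<mu> -` LU i"

lemma Os_open: "openin (mtop Z) (Os i)"
proof -
  have "openin (mtop R) (points R)" using openin_topspace topspace_mtop[OF R_ok] by metis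
  then have "openin (mtop R) (V0 \<inter> \<mu> -` LU i)" using openin_preimage[OF R_ok mu_cont _ LU_open] R_points by simp
  then show ?thesis unfolding Os_def using openin_restrict[OF Z_ok V0_open] by blast
qed

lemma cdf_wq: "cdf (\<lambda>x. wq (yv k x)) x"
  unfolding wq_def quad_def by (intro cdf_add cdf_mult cdf_power cdf_yv cdf_const)

lemma ell_zero: "ell i 0 = 0"
  unfolding ell_def by simp

lemma xc_hol: "E \<in> LU i \<Longrightarrow> hol_at TW (\<lambda>E. xc e i E $ j) E"
proof -
  assume "E \<in> LU i"
  then obtain y z where E: "E = tw 2 y z" "ell i y \<noteq> 0" unfolding LU_def by blast
  then have "y \<noteq> 0" using ell_zero by auto
  then obtain k where k: "y $ k \<noteq> 0" by (auto simp: vec_eq_iff)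
  have "tw 2 (yv k (tc k E)) (tc k E $ k) \<in> LU i" unfolding E(1) lift_tc[OF k] using E(2) by simp
  then have l: "ell i (yv k (tc k E)) \<noteq> 0" by simp
  have "cdiff (\<lambda>x. xc e i (tw 2 (yv k x) (x $ k))) (tc k E)"
    unfolding xc_tw
  proof (rule cdiff_4I; unfold mk4_nth)
    show "cdf (\<lambda>x. yv k x $ 0 / ell i (yv k x)) (tc k E)" "cdf (\<lambda>x. yv k x $ 1 / ell i (yv k x)) (tc k E)"
      "cdf (\<lambda>x. ell (i + 1) (yv k x) / ell i (yv k x)) (tc k E)"
      by (intro cdf_divide cdf_yv cdf_ell l)+
    show "cdf (\<lambda>x. xi e i (yv k x) (x $ k) / (ell i (yv k x))\<^sup>2) (tc k E)"
      unfolding xi_def using l by (intro cdf_divide cdf_add cdf_wq cdf_mult cdf_const cdf_nth cdf_power cdf_ell) simp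
  qed
  then show ?thesis unfolding E(1) cdiff_def by (intro hol_at_TWI[OF k]) blast
qed

definition xz :: "complex \<Rightarrow> 2 \<Rightarrow> 'z \<Rightarrow> complex^4" where
  "xz e i p = xc e i (\<mu> p)"

lemma xz_hol:
  assumes "p \<in> Os i" shows "hol_at Z (\<lambda>p. xz e i p $ j) p"
proof -
  have p: "p \<in> V0" "\<mu> p \<in> LU i" using assms unfolding Os_def by auto
  have "hol_at R (\<lambda>p. xc e i (\<mu> p) $ j) p"
    using hol_at_comp[OF R_ok TW_ok mu_cont mu_hol[OF p(1)] _ xc_hol[OF p(2), of e j]] p(1) R_points by simp
  then show ?thesis unfolding xz_def using hol_at_restrict[OF Z_ok V0_open p(1)] by blast
qed

abbreviation xrep :: "complex \<Rightarrow> 2 \<Rightarrow> 'z set \<Rightarrow> ('z \<Rightarrow> complex^3) \<Rightarrow> complex^3 \<Rightarrow> complex^4" where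
  "xrep e i V d \<equiv> (\<lambda>y. xz e i (inv_into V d y))"

lemma xrep_cdiff:
  assumes "p \<in> Os i" "(V, d) \<in> Z" "p \<in> V" shows "cdiff (xrep e i V d) (d p)"
  using xz_hol[OF assms(1)] assms(2,3) unfolding cdiff_def hol_at_def by fast

lemma Os_rep:
  assumes "p \<in> Os i"
  obtains y z where "\<mu> p = tw 2 y z" "double_eq a b q0 q1 q2 (y, z) = 0" "ell i y \<noteq> 0"
proof -
  have "\<mu> p \<in> Z0 a b q0 q1 q2" "\<mu> p \<in> LU i" using assms unfolding Os_def V0_def by auto
  then obtain y z where "\<mu> p = tw 2 y z" "double_eq a b q0 q1 q2 (y, z) = 0" unfolding Z0_def by blast
  then show ?thesis using that \<open>\<mu> p \<in> LU i\<close> by simp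
qed

text \<open>By \<open>xc_reconstruct\<close>, an expression of \<open>\<mu>\<close> in charts
  factors as \<open>H\<close> after the functions \<open>xz\<close>. Since \<open>\<mu>\<close> is
  an immersion on \<open>V0\<close>, the inner factor has an injective Jacobian.\<close>

lemma xrep_jac_inj:
  assumes e: "e\<^sup>2 = 1" and p: "p \<in> Os i" and D: "(V, d) \<in> Z" "p \<in> V"
    and v: "jac (xrep e i V d) (d p) *v v = 0"
  shows "v = 0"
proof -
  obtain y z where yz: "\<mu> p = tw 2 y z" "ell i y \<noteq> 0" using Os_rep[OF p] by metis
  then have "y \<noteq> 0" using ell_zero by auto
  then obtain k where k: "y $ k \<noteq> 0" by (auto simp: vec_eq_iff)
  define H where "H = (\<lambda>x. tc k (tw 2 (Yx i x) (Zx e i x)))"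
  have Yc: "cdf (\<lambda>x. Yx i x $ j) x" for j x
    unfolding Yx_def Let_def
    by (cases "i = 0"; rule cdiff_4I[unfolded cdiff_def, rule_format]) (auto intro!: cdf_divide cdf_mult cdf_add cdf_minus)
  have wc: "cdf wx x" for x
    unfolding wx_def quad_def by (intro cdf_add cdf_mult cdf_power cdf_diff cdf_nth cdf_const)
  have Zc: "cdf (\<lambda>x. Zx e i x) x" for x
    unfolding Zx_def by (intro cdf_mult cdf_diff cdf_nth cdf_const wc)
  have Yk: "Yx i (xz e i p) $ k \<noteq> 0" unfolding xz_def yz(1) xc_reconstruct(1)[OF e yz(2)] using k yz(2) by simp
  have H: "cdiff H (xz e i p)" unfolding H_def cdiff_def tc_tw
  proof
    fix j show "cdf (\<lambda>x. (\<chi> j. if j = k then Zx e i x / (Yx i x $ k)\<^sup>2 else Yx i x $ j / Yx i x $ k) $ j) (xz e i p)"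
      using Yk by (cases "j = k") (auto intro!: cdf_divide cdf_power Yc Zc)
  qed
  have pV: "p \<in> V0" using p unfolding Os_def by blast
  have DR: "(V \<inter> V0, d) \<in> R" "p \<in> V \<inter> V0" using restrict_charts[OF D(1)] D(2) pV by auto
  have "jac (crep (V \<inter> V0) d \<mu> (tc k)) (d p) = jac (\<lambda>y. H (xrep e i V d y)) (d p)"
  proof (rule jac_cong_open[OF openin_chart_image[OF Z_ok Os_open D(1)]])
    show "d p \<in> d ` (V \<inter> Os i)" using D(2) p by blast
    fix x assume "x \<in> d ` (V \<inter> Os i)"
    then obtain p' where p': "p' \<in> V" "p' \<in> Os i" "x = d p'" by blast
    obtain y z where yz: "\<mu> p' = tw 2 y z" "ell i y \<noteq> 0" using Os_rep[OF p'(2)] by metis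
    have i1: "inv_into V d x = p'" using chart_inv[OF Z_ok D(1) p'(1)] p'(3) by simp
    have "p' \<in> V0" using p'(2) unfolding Os_def by blast
    then have "inv_into (V \<inter> V0) d x = p'" using restrict_inv[OF Z_ok V0_open D(1), of x] p' i1 by auto
    then show "crep (V \<inter> V0) d \<mu> (tc k) x = H (xrep e i V d x)"
      unfolding H_def i1 xz_def yz(1) using yz(1) xc_reconstruct(3)[OF e yz(2)] by simp
  qed
  also have "\<dots> = jac H (xz e i p) ** jac (xrep e i V d) (d p)"
    using jac_comp[of H "xrep e i V d" "d p"] H xrep_cdiff[OF p D] chart_inv[OF Z_ok D] by simp
  finally have "jac (crep (V \<inter> V0) d \<mu> (tc k)) (d p) *v v = 0"
    using v by (simp add: matrix_vector_mul_assoc[symmetric])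
  then show ?thesis
    using embedding_jac_inj[OF R_ok TW_ok mu_emb DR TW_chart[of k]] yz(1) k by simp
qed

section \<open>The lifted conics\<close>

definition psi :: "complex \<Rightarrow> (complex^2) set \<Rightarrow> ((complex^4) \<times> complex) set" where
  "psi e p = (let s = (SOME s. s \<in> p) in tw 2 (Yc s) (Zc e s))"

lemma psi_pt: "psi e (pt s) = tw 2 (Yc s) (Zc e s)"
proof -
  obtain k where k: "k \<noteq> 0" "(SOME x. x \<in> pt s) = k *s s" using pt_some by blast
  have "psi e (pt s) = tw 2 (k\<^sup>2 *s Yc s) ((k\<^sup>2)\<^sup>2 * Zc e s)"
    unfolding psi_def Let_def k(2) Yc_scale Zc_scale ..
  then show ?thesis using k(1) tw_scale[of "k\<^sup>2" 2 "Yc s" "Zc e s"] by simp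
qed

lemma Yc_nonzero: "s \<noteq> 0 \<Longrightarrow> Yc s \<noteq> 0"
proof
  assume s: "s \<noteq> 0" and "Yc s = 0"
  then have "ell i (Yc s) = 0" for i unfolding ell_def by simp
  then have "s $ i = 0" for i unfolding ell_Yc by simp
  then show False using s by (simp add: vec_eq_iff)
qed

lemma Yc_on_conic: "on_conic (Yc s)"
  unfolding on_conic_def ell_Yc by (simp add: Yc_def power_mult_distrib)

lemma psi_in:
  assumes e: "e\<^sup>2 = 1" and p: "p \<in> points CP1"
  shows "psi e p \<in> Z0 a b q0 q1 q2 - Z0_sing a b q0 q1 q2"
proof -
  obtain s where s: "p = pt s" "s \<noteq> 0" using p unfolding CP1_points by blast
  have "psi e p \<in> Z0 a b q0 q1 q2"
    unfolding s(1) psi_pt Z0_def using Yc_nonzero[OF s(2)] double_eq_curve[OF e] by blast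
  moreover have "psi e p \<notin> Z0_sing a b q0 q1 q2"
  proof
    assume "psi e p \<in> Z0_sing a b q0 q1 q2"
    then obtain y z where yz: "tw 2 (Yc s) (Zc e s) = tw 2 y z" "y \<noteq> 0" "double_eq a b q0 q1 q2 (y, z) = 0"
      "(double_eq a b q0 q1 q2 has_derivative (\<lambda>_. 0)) (at (y, z))"
      unfolding s(1) psi_pt Z0_sing_def by blast
    obtain k where "k \<noteq> 0" "y = k *s Yc s" using yz(1) unfolding tw_eq_iff by blast
    then have "on_conic y" using on_conic_scale Yc_on_conic by blast
    then show False using smooth_on_conic yz by blast
  qed
  ultimately show ?thesis by blast
qed

lemma cdf_aff_Yc: "cdf (\<lambda>x::complex^1. Yc (aff i (x $ 1)) $ j) x"
proof -
  have "cdiff (\<lambda>x::complex^1. Yc (aff i (x $ 1))) x"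
    unfolding Yc_def by (rule cdiff_4I; unfold mk4_nth) (intro cdf_divide cdf_mult cdf_add cdf_power cdf_aff cdf_const; simp)+
  then show ?thesis unfolding cdiff_def by blast
qed

lemma cdf_aff_Zc: "cdf (\<lambda>x::complex^1. Zc e (aff i (x $ 1))) x"
  unfolding Zc_def by (intro cdf_mult cdf_diff cdf_power cdf_aff cdf_const)

lemma psi_hol:
  assumes e: "e\<^sup>2 = 1" shows "holomorphic_map CP1 TW (psi e)"
proof (rule holomorphic_mapI[OF CP1_ok TW_ok])
  show "psi e ` points CP1 \<subseteq> points TW" using psi_in[OF e] Z0_TW by blast
  fix U c V d assume "(U, c) \<in> CP1" "(V, d) \<in> TW"
  then obtain i k where *: "U = cpU i" "c = cpc i" "V = tU k" "d = tc k" unfolding CP1_charts TW_charts by blast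
  have S: "cpc i ` (cpU i \<inter> psi e -` tU k) = {x. Yc (aff i (x $ 1)) $ k \<noteq> 0}"
    unfolding cpc_preimage by (simp add: psi_pt)
  show "holo_on (\<lambda>x. d (psi e (inv_into U c x))) (c ` (U \<inter> psi e -` V))"
    unfolding * S holo_on_iff cdiff_def cpc_inv psi_pt tc_tw
  proof (intro conjI ballI allI)
    show "open {x::complex^1. Yc (aff i (x $ 1)) $ k \<noteq> 0}"
      by (intro open_Collect_neq continuous_on_const cdf_continuous cdf_aff_Yc)
    fix x :: "complex^1" and j assume "x \<in> {x. Yc (aff i (x $ 1)) $ k \<noteq> 0}"
    then show "cdf (\<lambda>x. (\<chi> j. if j = k then Zc e (aff i (x $ 1)) / (Yc (aff i (x $ 1)) $ k)\<^sup>2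
        else Yc (aff i (x $ 1)) $ j / Yc (aff i (x $ 1)) $ k) $ j) x"
      by (cases "j = k") (auto intro!: cdf_divide cdf_power cdf_aff_Yc cdf_aff_Zc)
  qed
qed

lemma xc_psi:
  assumes e: "e\<^sup>2 = 1" and p: "p \<in> cpU i"
  shows "psi e p \<in> LU i" "xc e i (psi e p) = cpt (rho (i + 1) i p)"
proof -
  obtain s where s: "p = pt s" "s $ i \<noteq> 0" using p by (rule cpU_E)
  show "psi e p \<in> LU i" "xc e i (psi e p) = cpt (rho (i + 1) i p)"
    unfolding s(1) psi_pt using s(2) xc_curve[OF e s(2)] by (simp_all add: ell_Yc)
qed

text \<open>The second coordinate of \<open>xc\<close> is the affine parameter. Both points lie in
  the same affine chart because \<open>ell i\<close> takes the value \<open>(s $ i)\<^sup>2\<close>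
  on the curve.\<close>

lemma psi_inj:
  assumes e: "e\<^sup>2 = 1" shows "inj_on (psi e) (points CP1)"
proof (rule inj_onI)
  fix p p' assume p: "p \<in> points CP1" and p': "p' \<in> points CP1" and eq: "psi e p = psi e p'"
  obtain i where i: "p \<in> cpU i" using p points_cpU by blast
  obtain s where s: "p' = pt s" using p' unfolding CP1_points by blast
  have "psi e p' \<in> LU i" using xc_psi(1)[OF e i] eq by simp
  then have "p' \<in> cpU i" unfolding s psi_pt by (simp add: ell_Yc)
  note i' = this
  have "xc e i (psi e p) $ 1 = xc e i (psi e p') $ 1" using eq by simp
  then have rr: "rho (i + 1) i p = rho (i + 1) i p'" unfolding xc_psi(2)[OF e i] xc_psi(2)[OF e i'] by simp
  obtain u v where uv: "p = pt u" "u $ i \<noteq> 0" "p' = pt v" "v $ i \<noteq> 0" using i i' by (metis cpU_E)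
  show "p = p'" using pt_aff[OF uv(2)] pt_aff[OF uv(4)] rr unfolding uv by simp
qed

definition phi :: "complex \<Rightarrow> (complex^2) set \<Rightarrow> 'z" where
  "phi e p = inv_into V0 \<mu> (psi e p)"

text \<open>The lifted conic avoids the singular points, so it lies in the image of
  \<open>V0\<close>, where \<open>\<mu>\<close> is an embedding through which it can be
  lifted.\<close>

lemma phi_hol:
  assumes e: "e\<^sup>2 = 1"
  shows "holomorphic_map CP1 Z (phi e)" "\<And>p. p \<in> points CP1 \<Longrightarrow> phi e p \<in> V0"
    "\<And>p. p \<in> points CP1 \<Longrightarrow> \<mu> (phi e p) = psi e p"
proof -
  have "\<mu> ` points Z = Z0 a b q0 q1 q2" using res unfolding small_resolution_def by blast
  have "Z0 a b q0 q1 q2 - Z0_sing a b q0 q1 q2 \<subseteq> \<mu> ` V0"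
  proof
    fix E assume E: "E \<in> Z0 a b q0 q1 q2 - Z0_sing a b q0 q1 q2"
    then have "E \<in> \<mu> ` points Z" using \<open>\<mu> ` points Z = _\<close> by simp
    then obtain p where "p \<in> points Z" "E = \<mu> p" by blast
    then show "E \<in> \<mu> ` V0" using E unfolding V0_def by blast
  qed
  then have sub: "psi e ` points CP1 \<subseteq> \<mu> ` points R" unfolding R_points using psi_in[OF e] by blast
  note L = embedding_lift[OF CP1_ok R_ok TW_ok mu_emb psi_hol[OF e] sub, unfolded R_points]
  have p: "phi e = (\<lambda>p. inv_into V0 \<mu> (psi e p))" unfolding phi_def ..
  show "holomorphic_map CP1 Z (phi e)"
    unfolding p by (rule holomorphic_map_into_restrict[OF Z_ok V0_open CP1_ok L(1)])
  show "phi e p \<in> V0" "\<mu> (phi e p) = psi e p" if "p \<in> points CP1" for p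
    unfolding phi_def using L(2,3)[OF that] by auto
qed

lemma phi_Os:
  assumes e: "e\<^sup>2 = 1" and p: "p \<in> cpU i"
  shows "phi e p \<in> Os i" "xz e i (phi e p) = cpt (rho (i + 1) i p)"
proof -
  have P: "p \<in> points CP1" using p cpU_points by blast
  show "phi e p \<in> Os i" "xz e i (phi e p) = cpt (rho (i + 1) i p)"
    unfolding Os_def xz_def using phi_hol(2,3)[OF e P] xc_psi[OF e p] by auto
qed

lemma phi_cont: "e\<^sup>2 = 1 \<Longrightarrow> continuous_map (mtop CP1) (mtop Z) (phi e)"
  using phi_hol(1) unfolding holomorphic_map_def by blast

lemma phi_hmap: "e\<^sup>2 = 1 \<Longrightarrow> p \<in> points CP1 \<Longrightarrow> hmap_at CP1 Z (phi e) p"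
  using phi_hol(1) unfolding holomorphic_map_iff[OF CP1_ok Z_ok] by blast

lemma phi_inj: "e\<^sup>2 = 1 \<Longrightarrow> inj_on (phi e) (points CP1)"
proof (rule inj_onI)
  fix p p' assume e: "e\<^sup>2 = 1" and p: "p \<in> points CP1" "p' \<in> points CP1" and "phi e p = phi e p'"
  then have "psi e p = psi e p'" using phi_hol(3)[OF e p(1)] phi_hol(3)[OF e p(2)] by simp
  then show "p = p'" using psi_inj[OF e] p by (simp add: inj_onD)
qed

text \<open>In the functions \<open>xz\<close> the curve is \<open>cpt\<close> in its affine
  parameter, and the vector on the right is its velocity.\<close>

lemma phi_tangent:
  assumes e: "e\<^sup>2 = 1" and p: "p \<in> cpU i" and D: "(V, d) \<in> Z" "phi e p \<in> V"
  shows "jac (xrep e i V d) (d (phi e p)) *v (jac (crep (cpU i) (cpc i) (phi e) d) (cpc i p) *v h)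
    = h $ 1 *s mk4 (of_real la) 1 (2 * rho (i + 1) i p) 0"
proof -
  have P: "p \<in> points CP1" using p cpU_points by blast
  have w: "cpc i p $ 1 = rho (i + 1) i p" using p by (elim cpU_E) (simp add: cpc_pt)
  have "jac (\<lambda>x. xz e i (phi e (inv_into (cpU i) (cpc i) x))) (cpc i p)
    = jac (xrep e i V d) (d (phi e p)) ** jac (crep (cpU i) (cpc i) (phi e) d) (cpc i p)"
    by (rule jac_crep_comp[OF CP1_ok Z_ok phi_cont[OF e] phi_hmap[OF e P] CP1_chart p D xrep_cdiff[OF phi_Os(1)[OF e p] D]])
  moreover have "(\<lambda>x. xz e i (phi e (inv_into (cpU i) (cpc i) x))) = (\<lambda>x. cpt (x $ 1))"
    using phi_Os(2)[OF e, of _ i] by (auto simp: cpc_inv)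
  moreover have "jac (\<lambda>x::complex^1. cpt (x $ 1)) (cpc i p) *v h = h $ 1 *s mk4 (of_real la) 1 (2 * rho (i + 1) i p) 0"
  proof -
    have nth: "((\<lambda>x::complex^1. x $ 1) has_derivative (\<lambda>h. h $ 1)) (at (cpc i p))"
      by (rule bounded_linear_imp_has_derivative) blast
    define Dv where "Dv = (\<lambda>j (h::complex^1). (h $ 1 *s mk4 (of_real la) 1 (2 * rho (i + 1) i p) 0) $ j)"
    have "((\<lambda>x. cpt (x $ 1) $ 0) has_derivative Dv 0) (at (cpc i p))"
      "((\<lambda>x. cpt (x $ 1) $ 1) has_derivative Dv 1) (at (cpc i p))"
      "((\<lambda>x. cpt (x $ 1) $ 2) has_derivative Dv 2) (at (cpc i p))"
      "((\<lambda>x. cpt (x $ 1) $ 3) has_derivative Dv 3) (at (cpc i p))"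
      unfolding Dv_def mk4_nth
      by (auto intro!: derivative_eq_intros nth simp: w algebra_simps)
    then have "\<forall>j. ((\<lambda>x. cpt (x $ 1) $ j) has_derivative Dv j) (at (cpc i p))" unfolding forall_4' by blast
    then have h: "((\<lambda>x. cpt (x $ 1)) has_derivative (\<lambda>h. \<chi> j. Dv j h)) (at (cpc i p))"
      by (intro has_derivative_vec) blast
    then have lin: "linear (\<lambda>h. \<chi> j. Dv j h)" by (rule has_derivative_linear)
    have "(\<lambda>h. \<chi> j. Dv j h) = (\<lambda>h. matrix (\<lambda>h. \<chi> j. Dv j h) *v h)"
      by (rule clinear_matrix[OF lin]) (simp add: Dv_def vec_eq_iff)
    then have "jac (\<lambda>x. cpt (x $ 1)) (cpc i p) *v h = (\<chi> j. Dv j h)"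
    proof -
      assume m: "(\<lambda>h. \<chi> j. Dv j h) = (\<lambda>h. matrix (\<lambda>h. \<chi> j. Dv j h) *v h)"
      have "jac (\<lambda>x. cpt (x $ 1)) (cpc i p) = matrix (\<lambda>h. \<chi> j. Dv j h)"
        by (rule jac_unique) (use h in \<open>simp only: m[symmetric]\<close>)
      then show ?thesis using fun_cong[OF m, of h] by (simp only:)
    qed
    then show ?thesis unfolding Dv_def by (simp add: vec_eq_iff)
  qed
  ultimately show ?thesis by (simp add: matrix_vector_mul_assoc)
qed

text \<open>An injective continuous map from a compact space to a Hausdorff space is an embedding;
  the differential is injective because the velocity has entry 1 at index 1.\<close>

lemma phi_emb:
  assumes e: "e\<^sup>2 = 1" shows "holomorphic_embedding CP1 Z (phi e)"
  unfolding holomorphic_embedding_def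
proof (intro conjI ballI)
  show "holomorphic_map CP1 Z (phi e)" by (rule phi_hol(1)[OF e])
  show "embedding_map (mtop CP1) (mtop Z) (phi e)"
    by (rule CP1_embedding[OF Z_Hausdorff phi_cont[OF e] phi_inj[OF e]])
  fix p assume P: "p \<in> points CP1"
  obtain i where i: "p \<in> cpU i" using P points_cpU by blast
  have "phi e p \<in> points Z" using phi_hol(2)[OF e P] V0_points by blast
  then obtain V d where D: "(V, d) \<in> Z" "phi e p \<in> V" using chart_point[OF Z_ok] by blast
  show "inj_on (differential CP1 Z (phi e) p) (tangent_space CP1 p)"
  proof (rule inj_onI)
    fix X Y assume X: "X \<in> tangent_space CP1 p" and Y: "Y \<in> tangent_space CP1 p"
      and eq: "differential CP1 Z (phi e) p X = differential CP1 Z (phi e) p Y"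
    let ?C = "(cpU i, cpc i)"
    have "jac (crep (cpU i) (cpc i) (phi e) d) (cpc i p) *v (X ?C - Y ?C) = 0"
      using differential_eq[OF CP1_ok phi_hmap[OF e P] X CP1_chart i D]
        differential_eq[OF CP1_ok phi_hmap[OF e P] Y CP1_chart i D] eq
      by (simp add: matrix_vector_mult_diff_distrib)
    then have "(X ?C - Y ?C) $ 1 *s mk4 (of_real la) 1 (2 * rho (i + 1) i p) 0 = 0"
      using phi_tangent[OF e i D, of "X ?C - Y ?C"] by simp
    then have "(X ?C - Y ?C) $ 1 = 0" unfolding vec4_eq_iff by simp
    then have "X ?C = Y ?C" by (simp add: vec_eq_iff)
    then show "X = Y" by (rule tangent_eqI[OF CP1_ok X Y CP1_chart i])
  qed
qed

section \<open>Linearised relations along the curve\<close>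

lemma xrep_derivative:
  assumes "p \<in> Os i" "(V, d) \<in> Z" "p \<in> V"
  shows "((\<lambda>y. xrep e i V d y $ j) has_derivative (\<lambda>v. (jac (xrep e i V d) (d p) *v v) $ j)) (at (d p))"
  by (rule bounded_linear.has_derivative[OF bounded_linear_vec_nth cdiff_has_derivative[OF xrep_cdiff[OF assms]]])

lemma derivative_zero:
  fixes g :: "complex^'k \<Rightarrow> complex"
  assumes "(g has_derivative D) (at x)" "open S" "x \<in> S" "\<And>y. y \<in> S \<Longrightarrow> g y = 0"
  shows "D v = 0"
proof -
  have "((\<lambda>_. 0) has_derivative D) (at x)"
    using has_derivative_transform_within_open[OF assms(1-3), of "\<lambda>_. 0"] assms(4) by simp
  then have "D = (\<lambda>_. 0)" using has_derivative_unique has_derivative_const by blast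
  then show ?thesis by simp
qed

text \<open>The relation holds identically on the open set \<open>Os i\<close>, so its differential
  vanishes on every tangent vector of \<open>Z\<close>.\<close>

lemma xrep_lin_rel:
  assumes e: "e\<^sup>2 = 1" and p: "p \<in> cpU i" and D: "(V, d) \<in> Z" "phi e p \<in> V"
  shows "lin_rel (rho (i + 1) i p) (jac (xrep e i V d) (d (phi e p)) *v v) = 0"
proof -
  define w where "w = rho (i + 1) i p"
  have O: "phi e p \<in> Os i" by (rule phi_Os(1)[OF e p])
  have x: "xrep e i V d (d (phi e p)) = cpt w" using chart_inv[OF Z_ok D] phi_Os(2)[OF e p] w_def by simp
  have "((\<lambda>y. (\<lambda>x. x $ 3 * (2 * wx x - x $ 3) - f4 a b (x $ 0) (x $ 1)) (xrep e i V d y)) has_derivative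
     (\<lambda>v. lin_rel w (jac (xrep e i V d) (d (phi e p)) *v v))) (at (d (phi e p)))"
    by (rule has_derivative_compose[OF cdiff_has_derivative[OF xrep_cdiff[OF O D]]]) (unfold x, rule relation_derivative)
  then show ?thesis unfolding w_def[symmetric]
  proof (rule derivative_zero[OF _ openin_chart_image[OF Z_ok Os_open[of i] D(1)]])
    show "d (phi e p) \<in> d ` (V \<inter> Os i)" using O D by blast
    fix y assume "y \<in> d ` (V \<inter> Os i)"
    then obtain p' where p': "p' \<in> V" "p' \<in> Os i" "y = d p'" by blast
    obtain u z where uz: "\<mu> p' = tw 2 u z" "double_eq a b q0 q1 q2 (u, z) = 0" "ell i u \<noteq> 0" by (rule Os_rep[OF p'(2)])
    have "inv_into V d y = p'" using chart_inv[OF Z_ok D(1) p'(1)] p'(3) by simp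
    then show "(\<lambda>x. x $ 3 * (2 * wx x - x $ 3) - f4 a b (x $ 0) (x $ 1)) (xrep e i V d y) = 0"
      using xc_relation[OF e uz(2,3)] unfolding xz_def by (simp add: uz(1))
  qed
qed

text \<open>The four identities of \<open>xc_transition\<close> hold on an open set and are
  differentiated at a point of the curve, where the coordinates are \<open>cpt w\<close> and
  \<open>cpt (1 / w)\<close>. The resulting equations \<open>r\<close> are the hypotheses of
  \<open>kappa_transition\<close>.\<close>

lemma xrep_transition:
  fixes v :: "complex^3"
  assumes e: "e\<^sup>2 = 1" and p: "p \<in> cpU i" "p \<in> cpU (i + 1)" and D: "(V, d) \<in> Z" "phi e p \<in> V"
  defines "w \<equiv> rho (i + 1) i p" and "u \<equiv> jac (xrep e i V d) (d (phi e p)) *v v"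
    and "u' \<equiv> jac (xrep e (i + 1) V d) (d (phi e p)) *v v"
  shows "eta u' = eta u / w\<^sup>2" "kappa (1 / w) u' = (crit / w) * eta u - kappa w u"
proof -
  obtain s where s: "p = pt s" "s $ i \<noteq> 0" using p(1) by (rule cpU_E)
  have s': "s $ (i + 1) \<noteq> 0" using p(2) s(1) by simp
  have w: "w \<noteq> 0" "rho (i + 1 + 1) (i + 1) p = 1 / w" unfolding w_def s(1) two_add using s s' by simp_all
  have O: "phi e p \<in> Os i" "phi e p \<in> Os (i + 1)" using phi_Os(1)[OF e p(1)] phi_Os(1)[OF e p(2)] by auto
  define P where "P = d (phi e p)"
  define X X' where "X = xrep e i V d" and "X' = xrep e (i + 1) V d"
  have x: "X P = cpt w" "X' P = cpt (1 / w)"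
    unfolding X_def X'_def P_def using chart_inv[OF Z_ok D] phi_Os(2)[OF e p(1)] phi_Os(2)[OF e p(2)] w(2) w_def by simp_all
  have d: "((\<lambda>y. X y $ j) has_derivative (\<lambda>v. (jac X P *v v) $ j)) (at P)"
    "((\<lambda>y. X' y $ j) has_derivative (\<lambda>v. (jac X' P *v v) $ j)) (at P)" for j
    unfolding X_def X'_def P_def by (rule xrep_derivative[OF O(1) D] xrep_derivative[OF O(2) D])+
  have dwx: "((\<lambda>y. wx (X y)) has_derivative (\<lambda>v. dw w (jac X P *v v))) (at P)"
    unfolding X_def P_def
    by (rule has_derivative_compose[OF cdiff_has_derivative[OF xrep_cdiff[OF O(1) D]]])
      (use x(1) wx_derivative[of w] in \<open>simp add: X_def P_def\<close>)
  have S: "openin (mtop Z) (Os i \<inter> Os (i + 1))" using Os_open by blast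
  note S = openin_chart_image[OF Z_ok S D(1)]
  have PS: "P \<in> d ` (V \<inter> (Os i \<inter> Os (i + 1)))" unfolding P_def using O D by blast
  have rel: "X' y $ 0 * X y $ 2 - X y $ 0 = 0 \<and> X' y $ 1 * X y $ 2 - X y $ 1 = 0 \<and> X' y $ 2 * X y $ 2 - 1 = 0 \<and>
      X' y $ 3 * (X y $ 2)\<^sup>2 - (2 * wx (X y) - X y $ 3) = 0" if y: "y \<in> d ` (V \<inter> (Os i \<inter> Os (i + 1)))" for y
  proof -
    obtain p' where p': "p' \<in> V" "p' \<in> Os i" "p' \<in> Os (i + 1)" "y = d p'" using y by blast
    obtain t z where t: "\<mu> p' = tw 2 t z" "ell i t \<noteq> 0" using Os_rep[OF p'(2)] by metis
    have "ell (i + 1) t \<noteq> 0" using p'(3) t(1) unfolding Os_def by simp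
    moreover have "inv_into V d y = p'" using chart_inv[OF Z_ok D(1) p'(1)] p'(4) by simp
    ultimately show ?thesis unfolding X_def X'_def xz_def using xc_transition[OF t(2), of e z] t(1) by simp
  qed
  note zero = derivative_zero[OF _ S PS, of _ _ v]
  have "(\<lambda>v. (X' P $ 0 * (jac X P *v v) $ 2 + (jac X' P *v v) $ 0 * X P $ 2) - (jac X P *v v) $ 0) v = 0"
    by (rule zero[of "\<lambda>y. X' y $ 0 * X y $ 2 - X y $ 0"]) (use rel in \<open>auto intro!: has_derivative_diff has_derivative_mult d\<close>)
  moreover have "(\<lambda>v. (X' P $ 1 * (jac X P *v v) $ 2 + (jac X' P *v v) $ 1 * X P $ 2) - (jac X P *v v) $ 1) v = 0"
    by (rule zero[of "\<lambda>y. X' y $ 1 * X y $ 2 - X y $ 1"]) (use rel in \<open>auto intro!: has_derivative_diff has_derivative_mult d\<close>)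
  moreover have "(\<lambda>v. (X' P $ 2 * (jac X P *v v) $ 2 + (jac X' P *v v) $ 2 * X P $ 2) - 0) v = 0"
  proof (rule zero[of "\<lambda>y. X' y $ 2 * X y $ 2 - 1"])
    show "((\<lambda>y. X' y $ 2 * X y $ 2 - 1) has_derivative
        (\<lambda>v. (X' P $ 2 * (jac X P *v v) $ 2 + (jac X' P *v v) $ 2 * X P $ 2) - 0)) (at P)"
      by (intro has_derivative_diff has_derivative_mult d has_derivative_const)
  qed (use rel in blast)
  moreover have "(\<lambda>v. (X' P $ 3 * (2 * X P $ 2 * (jac X P *v v) $ 2) + (jac X' P *v v) $ 3 * (X P $ 2)\<^sup>2)
      - (2 * dw w (jac X P *v v) - (jac X P *v v) $ 3)) v = 0"
  proof (rule zero[of "\<lambda>y. X' y $ 3 * (X y $ 2)\<^sup>2 - (2 * wx (X y) - X y $ 3)"])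
    have "((\<lambda>y. (X y $ 2)\<^sup>2) has_derivative (\<lambda>v. 2 * X P $ 2 * (jac X P *v v) $ 2)) (at P)"
      using has_derivative_mult[OF d(1)[of 2] d(1)[of 2]] by (simp add: power2_eq_square algebra_simps)
    then show "((\<lambda>y. X' y $ 3 * (X y $ 2)\<^sup>2 - (2 * wx (X y) - X y $ 3)) has_derivative
      (\<lambda>v. (X' P $ 3 * (2 * X P $ 2 * (jac X P *v v) $ 2) + (jac X' P *v v) $ 3 * (X P $ 2)\<^sup>2)
      - (2 * dw w (jac X P *v v) - (jac X P *v v) $ 3))) (at P)"
      by (intro has_derivative_diff has_derivative_mult has_derivative_mult_right d dwx)
  qed (use rel in blast)
  moreover have "jac X P *v v = u" "jac X' P *v v = u'" unfolding u_def u'_def X_def X'_def P_def by simp_all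
  ultimately have r: "u' $ 0 * w\<^sup>2 + (of_real la / w) * u $ 2 = u $ 0" "u' $ 1 * w\<^sup>2 + (1 / w) * u $ 2 = u $ 1"
    "u' $ 2 * w\<^sup>2 + (1 / w\<^sup>2) * u $ 2 = 0" "u' $ 3 * w ^ 4 - 2 * r * w\<^sup>2 * u $ 2 = 2 * dw w u - u $ 3"
    unfolding x mk4_nth by (simp_all add: algebra_simps power_divide)
  have "lin_rel w u = 0" unfolding w_def u_def by (rule xrep_lin_rel[OF e p(1) D])
  from kappa_transition[OF w(1) this r]
  show "eta u' = eta u / w\<^sup>2" "kappa (1 / w) u' = (crit / w) * eta u - kappa w u" .
qed

lemma mv_4: "(A *v x) $ i = A $ i $ 0 * x $ 0 + A $ i $ 1 * x $ 1 + A $ i $ 2 * x $ 2 + A $ i $ 3 * x $ 3"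
  for A :: "complex^4^'k"
proof -
  have four: "(4::4) = 0" by simp
  show ?thesis unfolding matrix_vector_mult_def vec_lambda_beta sum_4 four by (simp only: ac_simps)
qed

section \<open>The normal bundle of a lifted conic\<close>

text \<open>\<open>A i w\<close> and \<open>B i w\<close> are the columns of an invertible matrix: the frame of conormal vectors
  over \<open>cpU i\<close> is its product with \<open>(kappa, eta)\<close>.\<close>

definition frame :: "(complex \<Rightarrow> complex^(1+1)) \<Rightarrow> (complex \<Rightarrow> complex^(1+1)) \<Rightarrow> complex \<Rightarrow> complex^4^(1+1)" where
  "frame A B w = (\<chi> k. A w $ k *s mk4 (- w * (f' / r)) (- 4 * r * w + w * (f' / r) * of_real la) (2 * r) (q / r - w\<^sup>2)
     + B w $ k *s mk4 1 (- of_real la) 0 0)"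

lemma frame_mv: "(frame A B w *v v) $ k = A w $ k * kappa w v + B w $ k * eta v"
  unfolding mv_4 frame_def kappa_def eta_def by (simp add: algebra_simps)

definition ctriv where
  "ctriv e A B i = ntriv CP1 Z (phi e) (xz e i) (\<lambda>p. frame (A i) (B i) (rho (i + 1) i p))"

context
  fixes e :: complex and A B :: "2 \<Rightarrow> complex \<Rightarrow> complex^(1+1)"
  assumes e: "e\<^sup>2 = 1"
    and AB: "\<And>i k p. p \<in> cpU i \<Longrightarrow> hol_at CP1 (\<lambda>p. A i (rho (i + 1) i p) $ k) p"
      "\<And>i k p. p \<in> cpU i \<Longrightarrow> hol_at CP1 (\<lambda>p. B i (rho (i + 1) i p) $ k) p"
    and det: "\<And>i w. A i w $ Inl 1 * B i w $ Inr 1 - A i w $ Inr 1 * B i w $ Inl 1 \<noteq> 0"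
begin

interpretation I: immersed_curve CP1 Z "phi e"
  using CP1_ok Z_ok phi_emb[OF e] by unfold_locales

text \<open>The nonzero determinant reduces the condition to the vanishing of \<open>kappa\<close>
  and \<open>eta\<close>. With \<open>lin_rel\<close> this leaves a multiple of the velocity, and
  injectivity of the Jacobian of \<open>xz\<close> carries the conclusion back to
  \<open>Z\<close>.\<close>

lemma frame_kernel:
  assumes p: "p \<in> cpU i" and D: "(V, d) \<in> Z" "phi e p \<in> V"
  shows "frame (A i) (B i) (rho (i + 1) i p) *v (jac (xrep e i V d) (d (phi e p)) *v v) = 0 \<longleftrightarrow>
    (\<exists>h. v = jac (crep (cpU i) (cpc i) (phi e) d) (cpc i p) *v h)"
proof
  define w where "w = rho (i + 1) i p"
  define u where "u = jac (xrep e i V d) (d (phi e p)) *v v"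
  assume "frame (A i) (B i) (rho (i + 1) i p) *v (jac (xrep e i V d) (d (phi e p)) *v v) = 0"
  then have f: "frame (A i) (B i) w *v u = 0" unfolding w_def u_def .
  have f1: "A i w $ k * kappa w u + B i w $ k * eta u = 0" for k
    using frame_mv[of "A i" "B i" w u k] f by simp
  have "(A i w $ Inl 1 * B i w $ Inr 1 - A i w $ Inr 1 * B i w $ Inl 1) * kappa w u =
     B i w $ Inr 1 * (A i w $ Inl 1 * kappa w u + B i w $ Inl 1 * eta u) - B i w $ Inl 1 * (A i w $ Inr 1 * kappa w u + B i w $ Inr 1 * eta u)"
    by (simp add: algebra_simps)
  then have k: "kappa w u = 0" using f1 det[of i w] by simp
  have "(A i w $ Inl 1 * B i w $ Inr 1 - A i w $ Inr 1 * B i w $ Inl 1) * eta u =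
     A i w $ Inl 1 * (A i w $ Inr 1 * kappa w u + B i w $ Inr 1 * eta u) - A i w $ Inr 1 * (A i w $ Inl 1 * kappa w u + B i w $ Inl 1 * eta u)"
    by (simp add: algebra_simps)
  then have et: "eta u = 0" using f1 det[of i w] by simp
  have "lin_rel w u = 0" unfolding w_def u_def by (rule xrep_lin_rel[OF e p D])
  from kernel_lin[OF this k et] have u: "u = u $ 1 *s mk4 (of_real la) 1 (2 * w) 0" .
  define h :: "complex^1" where "h = vec (u $ 1)"
  have "jac (xrep e i V d) (d (phi e p)) *v (v - jac (crep (cpU i) (cpc i) (phi e) d) (cpc i p) *v h) = 0"
    using phi_tangent[OF e p D, of h] u unfolding u_def[symmetric] w_def[symmetric] h_def
    by (simp add: matrix_vector_mult_diff_distrib u_def[symmetric])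
  then have "v - jac (crep (cpU i) (cpc i) (phi e) d) (cpc i p) *v h = 0"
    by (rule xrep_jac_inj[OF e phi_Os(1)[OF e p] D])
  then show "\<exists>h. v = jac (crep (cpU i) (cpc i) (phi e) d) (cpc i p) *v h" by auto
next
  assume "\<exists>h. v = jac (crep (cpU i) (cpc i) (phi e) d) (cpc i p) *v h"
  then obtain h where v: "v = jac (crep (cpU i) (cpc i) (phi e) d) (cpc i p) *v h" by blast
  show "frame (A i) (B i) (rho (i + 1) i p) *v (jac (xrep e i V d) (d (phi e p)) *v v) = 0"
    unfolding v phi_tangent[OF e p D] vec_eq_iff frame_mv kappa_tangent by simp
qed

lemma ctriv_eq:
  assumes p: "p \<in> cpU i" and D: "(V, d) \<in> Z" "phi e p \<in> V" and X: "X \<in> tangent_space Z (phi e p)"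
  shows "ctriv e A B i p (normal_class CP1 Z (phi e) p X) $ k =
    A i (rho (i + 1) i p) $ k * kappa (rho (i + 1) i p) (jac (xrep e i V d) (d (phi e p)) *v X (V, d))
    + B i (rho (i + 1) i p) $ k * eta (jac (xrep e i V d) (d (phi e p)) *v X (V, d))"
proof -
  have "ctriv e A B i p (normal_class CP1 Z (phi e) p X) =
      frame (A i) (B i) (rho (i + 1) i p) *v (jac (xrep e i V d) (d (phi e p)) *v X (V, d))"
    unfolding ctriv_def
    by (rule I.ntriv_eq[OF CP1_chart p D X xz_hol[OF phi_Os(1)[OF e p]]]) (use frame_kernel[OF p] in blast)
  then show ?thesis by (simp add: frame_mv)
qed

lemma ctriv_in_trivs: "(cpU i, ctriv e A B i) \<in> trivs (normal_bundle CP1 Z (phi e))"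
  unfolding ctriv_def
proof (rule I.ntriv_in_trivs[OF cpU_open Os_open _ xz_hol _ CP1_chart])
  show "p \<in> cpU i \<Longrightarrow> phi e p \<in> Os i" for p by (rule phi_Os(1)[OF e])
  show "hol_at CP1 (\<lambda>p. frame (A i) (B i) (rho (i + 1) i p) $ k $ j) p" if p: "p \<in> cpU i" for p k j
  proof -
    have "hol_at CP1 (\<lambda>p. frame (A i) (B i) (rho (i + 1) i p) $ k $ 0) p"
      "hol_at CP1 (\<lambda>p. frame (A i) (B i) (rho (i + 1) i p) $ k $ 1) p"
      "hol_at CP1 (\<lambda>p. frame (A i) (B i) (rho (i + 1) i p) $ k $ 2) p"
      "hol_at CP1 (\<lambda>p. frame (A i) (B i) (rho (i + 1) i p) $ k $ 3) p"
      unfolding frame_def vec_lambda_beta vector_add_component vector_smult_component mk4_nth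
      by (intro hol_at_add hol_at_mult hol_at_diff hol_at_minus hol_at_power hol_at_const AB[OF p] hol_at_rho[OF p])+
    then have "\<forall>j. hol_at CP1 (\<lambda>p. frame (A i) (B i) (rho (i + 1) i p) $ k $ j) p" unfolding forall_4' by blast
    then show ?thesis by blast
  qed
qed (use frame_kernel in auto)

text \<open>Only the overlap of charts 0 and 1 has to be checked. The second conclusion keeps the
  transition rule of the frames themselves, from which \<open>not_split_0_2\<close> starts.\<close>

lemma normal_iso:
  assumes kl: "\<And>y X. y $ 0 \<noteq> 0 \<Longrightarrow> y $ 1 \<noteq> 0 \<Longrightarrow> X \<in> tangent_space Z (phi e (pt y)) \<Longrightarrow>
      (y $ 0) ^ k * ctriv e A B 0 (pt y) (normal_class CP1 Z (phi e) (pt y) X) $ Inl 1 =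
      (y $ 1) ^ k * ctriv e A B 1 (pt y) (normal_class CP1 Z (phi e) (pt y) X) $ Inl 1 \<and>
      (y $ 0) ^ l * ctriv e A B 0 (pt y) (normal_class CP1 Z (phi e) (pt y) X) $ Inr 1 =
      (y $ 1) ^ l * ctriv e A B 1 (pt y) (normal_class CP1 Z (phi e) (pt y) X) $ Inr 1"
  shows "vb_isomorphic CP1 (normal_bundle CP1 Z (phi e)) (OSum k l)"
    "\<And>i j y E. y $ i \<noteq> 0 \<Longrightarrow> y $ j \<noteq> 0 \<Longrightarrow> E \<in> I.nc (pt y) ` tangent_space Z (phi e (pt y)) \<Longrightarrow>
      (y $ i) ^ k * ctriv e A B i (pt y) E $ Inl 1 = (y $ j) ^ k * ctriv e A B j (pt y) E $ Inl 1 \<and>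
      (y $ i) ^ l * ctriv e A B i (pt y) E $ Inr 1 = (y $ j) ^ l * ctriv e A B j (pt y) E $ Inr 1"
proof -
  show tr: "(y $ i) ^ k * ctriv e A B i (pt y) E $ Inl 1 = (y $ j) ^ k * ctriv e A B j (pt y) E $ Inl 1 \<and>
      (y $ i) ^ l * ctriv e A B i (pt y) E $ Inr 1 = (y $ j) ^ l * ctriv e A B j (pt y) E $ Inr 1"
    if y: "y $ i \<noteq> 0" "y $ j \<noteq> 0" and E: "E \<in> I.nc (pt y) ` tangent_space Z (phi e (pt y))" for i j y E
  proof -
    have ij: "(i = 0 \<or> i = 1) \<and> (j = 0 \<or> j = 1)" using two_cases[of i 0] two_cases[of j 0] by auto
    show ?thesis
    proof (cases "i = j")
      case False
      then have "y $ 0 \<noteq> 0" "y $ 1 \<noteq> 0" using ij y by auto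
      from kl[OF this] show ?thesis using ij False E by auto
    qed simp
  qed
  have fib: "fibre I.NB p = I.nc p ` tangent_space Z (phi e p)" for p unfolding normal_bundle_def by simp
  have "vector_bundle CP1 I.NB"
  proof (rule I.normal_bundle_vector_bundle)
    fix p assume "p \<in> points CP1"
    then obtain i where i: "p \<in> cpU i" using points_cpU by blast
    show "\<exists>W t. (W, t) \<in> trivs I.NB \<and> p \<in> W" 
      by (rule exI[of _ "cpU i"], rule exI[of _ "ctriv e A B i"], rule conjI[OF ctriv_in_trivs i])
  qed
  then show "vb_isomorphic CP1 I.NB (OSum k l)"
  proof (rule vb_isomorphic_sumI[OF _ ctriv_in_trivs])
    fix i j :: 2 and y E assume y: "y $ i \<noteq> 0" "y $ j \<noteq> 0" and E: "E \<in> fibre I.NB (pt y)"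
    note tr = tr[OF y E[unfolded fib]]
    show "(y $ i) ^ k * ctriv e A B i (pt y) E $ Inl 1 = (y $ j) ^ k * ctriv e A B j (pt y) E $ Inl 1"
      by (rule conjunct1[OF tr])
    show "(y $ i) ^ l * ctriv e A B i (pt y) E $ Inr 1 = (y $ j) ^ l * ctriv e A B j (pt y) E $ Inr 1"
      by (rule conjunct2[OF tr])
  qed
qed

end

end

section \<open>The curves over the conic and their splitting types\<close>

context double_solid
begin

text \<open>\<open>conic_param\<close> places the image of the point on one of the two lifts, and
  \<open>\<mu>\<close> is injective over the regular locus.\<close>

lemma lift_cases:
  assumes x: "x \<in> points Z" and yz: "\<mu> x = tw 2 y z" "y \<noteq> 0" "double_eq a b q0 q1 q2 (y, z) = 0" "on_conic y"
  shows "x \<in> phi 1 ` points CP1 \<union> phi (- 1) ` points CP1"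
proof -
  obtain s where s: "s \<noteq> 0" "y = Yc s" "z = Zc 1 s \<or> z = Zc (- 1) s" using conic_param[OF yz(4,2,3)] by blast
  then obtain e where e: "e = 1 \<or> e = - 1" "z = Zc e s" by blast
  have e2: "e\<^sup>2 = 1" using e(1) by auto
  have P: "pt s \<in> points CP1" using s(1) unfolding CP1_points by blast
  have mx: "\<mu> x = psi e (pt s)" unfolding psi_pt yz(1) s(2) e(2) ..
  then have "x \<in> V0" using psi_in[OF e2 P] x unfolding V0_def by simp
  then have "x = phi e (pt s)" using mu_inj phi_hol(2,3)[OF e2 P] mx by (simp add: inj_onD)
  then show ?thesis using e(1) P by blast
qed

text \<open>At a common point the fourth powers of the two parameters have the ratio
  \<open>k\<^sup>2\<close>, whereas \<open>Zc\<close> changes sign with \<open>e\<close>; hence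
  \<open>(s $ 0) ^ 4 = (s $ 1) ^ 4\<close>.\<close>

lemma lift_finite: "finite (phi 1 ` points CP1 \<inter> phi (- 1) ` points CP1)"
proof (rule finite_subset)
  show "phi 1 ` points CP1 \<inter> phi (- 1) ` points CP1 \<subseteq> (\<lambda>w. phi 1 (pt (aff 0 w))) ` {w. w ^ 4 = 1}"
  proof
    fix x assume "x \<in> phi 1 ` points CP1 \<inter> phi (- 1) ` points CP1"
    then obtain p p' where p: "p \<in> points CP1" "p' \<in> points CP1" and xp: "x = phi 1 p" and x: "phi 1 p = phi (- 1) p'"
      by auto
    obtain s s' where s: "p = pt s" "s \<noteq> 0" "p' = pt s'" using p unfolding CP1_points by blast
    have "psi 1 p = psi (- 1) p'" using x phi_hol(3)[OF _ p(1), of 1] phi_hol(3)[OF _ p(2), of "- 1"] by simp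
    then obtain k where k: "k \<noteq> 0" "Yc s' = k *s Yc s" "Zc (- 1) s' = k\<^sup>2 * Zc 1 s"
      unfolding s psi_pt tw_eq_iff by blast
    have "(s' $ i)\<^sup>2 = k * (s $ i)\<^sup>2" for i
      using arg_cong[OF k(2), of "ell i"] unfolding ell_scale ell_Yc .
    then have "((s' $ i)\<^sup>2)\<^sup>2 = (k * (s $ i)\<^sup>2)\<^sup>2" for i by simp
    then have s4: "(s' $ i) ^ 4 = k\<^sup>2 * (s $ i) ^ 4" for i by (simp add: power_mult_distrib flip: power_mult)
    have "k\<^sup>2 * \<i> * r * ((s $ 0) ^ 4 - (s $ 1) ^ 4) = 0"
      using k(3) unfolding Zc_def s4 by (auto simp: algebra_simps)
    then have eq: "(s $ 0) ^ 4 = (s $ 1) ^ 4" using k(1) r0 by simp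
    have s0: "s $ 0 \<noteq> 0"
    proof
      assume "s $ 0 = 0"
      then have "s $ 1 = 0" using eq by simp
      then show False using s(2) \<open>s $ 0 = 0\<close> vec2_eq_iff[of s 0 0] by simp
    qed
    then have "(s $ 1 / s $ 0) ^ 4 = 1" unfolding power_divide eq[symmetric] by simp
    moreover have "p = pt (aff 0 (s $ 1 / s $ 0))" unfolding s(1) using pt_aff[OF s0] by simp
    ultimately show "x \<in> (\<lambda>w. phi 1 (pt (aff 0 w))) ` {w. w ^ 4 = 1}"
      unfolding xp by (intro image_eqI[of _ _ "s $ 1 / s $ 0"]) auto
  qed
  have "finite {w::complex. w ^ 4 = 1}" by (rule finite_roots_unity) simp
  then show "finite ((\<lambda>w. phi 1 (pt (aff 0 w))) ` {w. w ^ 4 = 1})" by blast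
qed

lemma rational_curve_is_lift:
  assumes f: "holomorphic_embedding CP1 Z f"
    and sub: "f ` points CP1 \<subseteq> phi 1 ` points CP1 \<union> phi (- 1) ` points CP1"
  shows "\<exists>e. e\<^sup>2 = 1 \<and> f ` points CP1 = phi e ` points CP1"
proof -
  have fc: "continuous_map (mtop CP1) (mtop Z) f" using f unfolding holomorphic_embedding_def holomorphic_map_def by blast
  have fi: "inj_on f (points CP1)"
    using f unfolding holomorphic_embedding_def embedding_map_def homeomorphic_map_def by (simp add: topspace_mtop[OF CP1_ok])
  have "f ` points CP1 = phi 1 ` points CP1 \<or> f ` points CP1 = phi (- 1) ` points CP1"
    by (rule CP1_image_in_union[OF Z_Hausdorff fc fi phi_cont phi_inj phi_cont phi_inj sub lift_finite]) simp_all
  then show ?thesis by (metis one_power2 power2_minus)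
qed

definition pair :: "complex \<Rightarrow> complex \<Rightarrow> complex^(1+1)" where
  "pair u v = (\<chi> k. case k of Inl _ \<Rightarrow> u | Inr _ \<Rightarrow> v)"

lemma pair_nth [simp]: "pair u v $ Inl j = u" "pair u v $ Inr j = v"
  unfolding pair_def by simp_all

lemma hol_at_pair: "hol_at M u p \<Longrightarrow> hol_at M v p \<Longrightarrow> hol_at M (\<lambda>p. pair (u p) (v p) $ k) p"
  by (cases k) simp_all

lemma transition_01:
  assumes e: "e\<^sup>2 = 1" and y: "y $ 0 \<noteq> 0" "y $ 1 \<noteq> 0" and X: "X \<in> tangent_space Z (phi e (pt y))"
  obtains V d u u' where "(V, d) \<in> Z" "phi e (pt y) \<in> V"
    "u = jac (xrep e 0 V d) (d (phi e (pt y))) *v X (V, d)" "u' = jac (xrep e 1 V d) (d (phi e (pt y))) *v X (V, d)"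
    "eta u' = eta u / (y $ 1 / y $ 0)\<^sup>2"
    "kappa (y $ 0 / y $ 1) u' = (crit / (y $ 1 / y $ 0)) * eta u - kappa (y $ 1 / y $ 0) u"
proof -
  have y0: "y \<noteq> 0" using y by auto
  then have "phi e (pt y) \<in> points Z" using phi_hol(2)[OF e] V0_points unfolding CP1_points by blast
  then obtain V d where D: "(V, d) \<in> Z" "phi e (pt y) \<in> V" using chart_point[OF Z_ok] by blast
  show thesis
    by (rule that[OF D refl refl])
      (use xrep_transition[OF e, of "pt y" 0 V d "X (V, d)"] y D in simp_all)
qed

lemma splitting_critical:
  assumes e: "e\<^sup>2 = 1" and C: "crit = 0"
  shows "normal_bundle_iso Z (phi e ` points CP1) 0 2"
proof -
  \<comment> \<open>For \<open>crit = 0\<close> the form \<open>kappa\<close> only changes sign on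
    the overlap, which \<open>sg i\<close> repairs, and \<open>eta\<close> is divided by
    \<open>w\<^sup>2\<close>, as \<open>O(2)\<close> requires.\<close>
  define A B :: "2 \<Rightarrow> complex \<Rightarrow> complex^(1+1)" where "A = (\<lambda>i w. pair (sg i) 0)" and "B = (\<lambda>i w. pair 0 1)"
  have h: "hol_at CP1 (\<lambda>p. A i (rho (i + 1) i p) $ k) p" "hol_at CP1 (\<lambda>p. B i (rho (i + 1) i p) $ k) p" for i k p
    unfolding A_def B_def by (intro hol_at_pair hol_at_const)+
  have det: "A i w $ Inl 1 * B i w $ Inr 1 - A i w $ Inr 1 * B i w $ Inl 1 \<noteq> 0" for i w
    unfolding A_def B_def by (simp add: sg_def)
  have "vb_isomorphic CP1 (normal_bundle CP1 Z (phi e)) (OSum 0 2)"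
  proof (rule normal_iso(1)[OF e h det])
    fix y X assume y: "y $ 0 \<noteq> 0" "y $ 1 \<noteq> 0" and X: "X \<in> tangent_space Z (phi e (pt y))"
    obtain V d u u' where D: "(V, d) \<in> Z" "phi e (pt y) \<in> V"
      and u: "u = jac (xrep e 0 V d) (d (phi e (pt y))) *v X (V, d)" "u' = jac (xrep e 1 V d) (d (phi e (pt y))) *v X (V, d)"
      and t: "eta u' = eta u / (y $ 1 / y $ 0)\<^sup>2"
        "kappa (y $ 0 / y $ 1) u' = (crit / (y $ 1 / y $ 0)) * eta u - kappa (y $ 1 / y $ 0) u"
      by (rule transition_01[OF e y X])
    have p: "pt y \<in> cpU 0" "pt y \<in> cpU 1" using y by auto
    have 0: "ctriv e A B 0 (pt y) (normal_class CP1 Z (phi e) (pt y) X) $ k =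
        A 0 (y $ 1 / y $ 0) $ k * kappa (y $ 1 / y $ 0) u + B 0 (y $ 1 / y $ 0) $ k * eta u" for k
      using ctriv_eq[OF e h det p(1) D X, of k] unfolding u by simp
    have 1: "ctriv e A B 1 (pt y) (normal_class CP1 Z (phi e) (pt y) X) $ k =
        A 1 (y $ 0 / y $ 1) $ k * kappa (y $ 0 / y $ 1) u' + B 1 (y $ 0 / y $ 1) $ k * eta u'" for k
      using ctriv_eq[OF e h det p(2) D X, of k] unfolding u by (simp add: two_eq_0)
    show "(y $ 0) ^ 0 * ctriv e A B 0 (pt y) (normal_class CP1 Z (phi e) (pt y) X) $ Inl 1 =
      (y $ 1) ^ 0 * ctriv e A B 1 (pt y) (normal_class CP1 Z (phi e) (pt y) X) $ Inl 1 \<and>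
      (y $ 0) ^ 2 * ctriv e A B 0 (pt y) (normal_class CP1 Z (phi e) (pt y) X) $ Inr 1 =
      (y $ 1) ^ 2 * ctriv e A B 1 (pt y) (normal_class CP1 Z (phi e) (pt y) X) $ Inr 1"
      unfolding 0 1 unfolding A_def B_def t C using y by (simp add: power_divide)
  qed
  then show ?thesis unfolding normal_bundle_iso_def using phi_emb[OF e] by blast
qed

lemma splitting_noncritical:
  assumes e: "e\<^sup>2 = 1" and C: "crit \<noteq> 0"
  shows "normal_bundle_iso Z (phi e ` points CP1) 1 1" "\<not> normal_bundle_iso Z (phi e ` points CP1) 0 2"
proof -
  \<comment> \<open>The determinants are \<open>crit\<close> and \<open>- crit\<close>, so these are
    frames because \<open>crit\<close> is nonzero. The overlap relations of \<open>kappa\<close> and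
    \<open>eta\<close> then give both coordinates the transition factor of
    \<open>O(1)\<close>.\<close>
  define A B :: "2 \<Rightarrow> complex \<Rightarrow> complex^(1+1)" where
    "A = (\<lambda>i w. if i = 0 then pair w 1 else pair (- 1) (- w))" and
    "B = (\<lambda>i w. if i = 0 then pair (- crit) 0 else pair 0 crit)"
  have h: "hol_at CP1 (\<lambda>p. A i (rho (i + 1) i p) $ k) p" "hol_at CP1 (\<lambda>p. B i (rho (i + 1) i p) $ k) p"
    if p: "p \<in> cpU i" for i k p
    using p unfolding A_def B_def
    by (cases "i = 0"; auto intro!: hol_at_pair hol_at_const hol_at_minus hol_at_rho)+
  have det: "A i w $ Inl 1 * B i w $ Inr 1 - A i w $ Inr 1 * B i w $ Inl 1 \<noteq> 0" for i w
    using C unfolding A_def B_def by auto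
  have rel: "(y $ 0) ^ 1 * ctriv e A B 0 (pt y) (normal_class CP1 Z (phi e) (pt y) X) $ Inl 1 =
      (y $ 1) ^ 1 * ctriv e A B 1 (pt y) (normal_class CP1 Z (phi e) (pt y) X) $ Inl 1 \<and>
      (y $ 0) ^ 1 * ctriv e A B 0 (pt y) (normal_class CP1 Z (phi e) (pt y) X) $ Inr 1 =
      (y $ 1) ^ 1 * ctriv e A B 1 (pt y) (normal_class CP1 Z (phi e) (pt y) X) $ Inr 1"
    if y: "y $ 0 \<noteq> 0" "y $ 1 \<noteq> 0" and X: "X \<in> tangent_space Z (phi e (pt y))" for y X
  proof -
    obtain V d u u' where D: "(V, d) \<in> Z" "phi e (pt y) \<in> V"
      and u: "u = jac (xrep e 0 V d) (d (phi e (pt y))) *v X (V, d)" "u' = jac (xrep e 1 V d) (d (phi e (pt y))) *v X (V, d)"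
      and t: "eta u' = eta u / (y $ 1 / y $ 0)\<^sup>2"
        "kappa (y $ 0 / y $ 1) u' = (crit / (y $ 1 / y $ 0)) * eta u - kappa (y $ 1 / y $ 0) u"
      by (rule transition_01[OF e y X])
    have p: "pt y \<in> cpU 0" "pt y \<in> cpU 1" using y by auto
    have 0: "ctriv e A B 0 (pt y) (normal_class CP1 Z (phi e) (pt y) X) $ k =
        A 0 (y $ 1 / y $ 0) $ k * kappa (y $ 1 / y $ 0) u + B 0 (y $ 1 / y $ 0) $ k * eta u" for k
      using ctriv_eq[OF e h det p(1) D X, of k] unfolding u by simp
    have 1: "ctriv e A B 1 (pt y) (normal_class CP1 Z (phi e) (pt y) X) $ k =
        A 1 (y $ 0 / y $ 1) $ k * kappa (y $ 0 / y $ 1) u' + B 1 (y $ 0 / y $ 1) $ k * eta u'" for k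
      using ctriv_eq[OF e h det p(2) D X, of k] unfolding u by (simp add: two_eq_0)
    show ?thesis
      unfolding 0 1 unfolding A_def B_def t using y by (simp add: field_simps power2_eq_square)
  qed
  have "vb_isomorphic CP1 (normal_bundle CP1 Z (phi e)) (OSum 1 1)"
    by (rule normal_iso(1)[OF e h det rel])
  then show "normal_bundle_iso Z (phi e ` points CP1) 1 1" unfolding normal_bundle_iso_def using phi_emb[OF e] by blast
  show "\<not> normal_bundle_iso Z (phi e ` points CP1) 0 2"
  proof
    assume "normal_bundle_iso Z (phi e ` points CP1) 0 2"
    \<comment> \<open>The definition lets the parametrisation vary, so \<open>f\<close> shares only
      its image with \<open>phi e\<close>.\<close>
    then obtain f where f: "holomorphic_embedding CP1 Z f" "f ` points CP1 = phi e ` points CP1"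
      "vb_isomorphic CP1 (normal_bundle CP1 Z f) (OSum 0 2)" unfolding normal_bundle_iso_def by blast
    have "\<not> vb_isomorphic CP1 (normal_bundle CP1 Z f) (OSum 0 2)"
    proof (rule not_split_0_2[OF Z_ok phi_emb[OF e] f(1) f(2)[symmetric] ctriv_in_trivs[OF e h det]])
      fix i j y E and k :: "1 + 1" assume y: "y $ i \<noteq> 0" "y $ j \<noteq> 0"
        and E: "E \<in> normal_class CP1 Z (phi e) (pt y) ` tangent_space Z (phi e (pt y))"
      have "\<forall>k::1+1. y $ i * ctriv e A B i (pt y) E $ k = y $ j * ctriv e A B j (pt y) E $ k"
        using normal_iso(2)[OF e h det rel y E] unfolding forall_Plus_1 by simp
      then show "y $ i * ctriv e A B i (pt y) E $ k = y $ j * ctriv e A B j (pt y) E $ k" by blast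
    qed
    then show False using f(3) by blast
  qed
qed

end

text \<open>With \<open>s\<close> and \<open>t\<close> for the two square roots, the derivative is
  \<open>2 * dQ * f - Q * df\<close> times the positive factor
  \<open>(Q + s) / (2 * s * t * f)\<close>.\<close>

lemma h0_critical:
  fixes a b q0 q1 q2 x :: real
  defines "Q \<equiv> quad q0 q1 q2 x 1" and "f \<equiv> cubic a b x"
    and "dQ \<equiv> 2 * q0 * x + q1" and "df \<equiv> 3 * a * x\<^sup>2 + 2 * (a - b) * x - b"
  assumes f: "f > 0" and Q: "Q > sqrt f"
  shows "(h0 a b q0 q1 q2 has_real_derivative 0) (at x) \<longleftrightarrow> 2 * dQ * f = Q * df"
proof -
  define t where "t = sqrt f"
  have t: "t > 0" "t\<^sup>2 = f" using f unfolding t_def by auto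
  have "Q\<^sup>2 > t\<^sup>2" using Q t(1) unfolding t_def[symmetric] by (intro power_strict_mono) auto
  then have D: "Q\<^sup>2 - f > 0" using t(2) by simp
  define s where "s = sqrt (Q\<^sup>2 - f)"
  have s: "s > 0" "s\<^sup>2 = Q\<^sup>2 - f" using D unfolding s_def by auto
  have Qd: "((\<lambda>x. quad q0 q1 q2 x (1::real)) has_real_derivative dQ) (at x)"
    unfolding quad_def dQ_def by (auto intro!: derivative_eq_intros)
  have fd: "(cubic a b has_real_derivative df) (at x)"
    unfolding cubic_def[abs_def] df_def by (auto intro!: derivative_eq_intros simp: algebra_simps power2_eq_square)
  have rt: "((\<lambda>x. sqrt ((quad q0 q1 q2 x 1)\<^sup>2 - cubic a b x)) has_real_derivative (2 * Q * dQ - df) / (2 * s)) (at x)"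
    using D unfolding s_def Q_def f_def
    by (auto intro!: derivative_eq_intros Qd[unfolded Q_def] fd simp: divide_simps)
  have rf: "((\<lambda>x. sqrt (cubic a b x)) has_real_derivative df / (2 * t)) (at x)"
    using f unfolding t_def f_def by (auto intro!: derivative_eq_intros fd simp: divide_simps)
  have "(h0 a b q0 q1 q2 has_real_derivative
      ((dQ + (2 * Q * dQ - df) / (2 * s)) * t - (Q + s) * (df / (2 * t))) / (t * t)) (at x)"
    unfolding h0_def[abs_def]
    using DERIV_divide[OF DERIV_add[OF Qd rt] rf] t(1)
    unfolding Q_def[symmetric] f_def[symmetric] s_def[symmetric] t_def[symmetric] by simp
  moreover have "((dQ + (2 * Q * dQ - df) / (2 * s)) * t - (Q + s) * (df / (2 * t))) / (t * t) = (Q + s) * (2 * dQ * f - Q * df) / (2 * s * t * f)"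
  proof -
    have "2 * s * t * ((dQ + (2 * Q * dQ - df) / (2 * s)) * t - (Q + s) * (df / (2 * t)))
      = (2 * s * dQ + 2 * Q * dQ - df) * t\<^sup>2 - (Q + s) * s * df"
      using s(1) t(1) by (simp add: field_simps power2_eq_square)
    also have "\<dots> = (Q + s) * (2 * dQ * f - Q * df)"
    proof -
      have "(2 * s * dQ + 2 * Q * dQ - df) * f - (Q + s) * s * df - (Q + s) * (2 * dQ * f - Q * df)
        = df * (Q\<^sup>2 - f - s\<^sup>2)"
        by (simp add: algebra_simps power2_eq_square)
      then show ?thesis using s(2) unfolding t(2) by simp
    qed
    finally have "((dQ + (2 * Q * dQ - df) / (2 * s)) * t - (Q + s) * (df / (2 * t)))
      = (Q + s) * (2 * dQ * f - Q * df) / (2 * s * t)"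
      using s(1) t(1) by (simp add: eq_divide_eq mult.commute)
    then show ?thesis unfolding t(2)[symmetric] by (simp add: power2_eq_square)
  qed
  ultimately have h: "(h0 a b q0 q1 q2 has_real_derivative (Q + s) * (2 * dQ * f - Q * df) / (2 * s * t * f)) (at x)"
    by simp
  have Qs: "Q + s > 0" using Q s(1) t(1) unfolding t_def by linarith
  have "(h0 a b q0 q1 q2 has_real_derivative 0) (at x) \<longleftrightarrow> (Q + s) * (2 * dQ * f - Q * df) / (2 * s * t * f) = 0"
    using h DERIV_unique by metis
  also have "\<dots> \<longleftrightarrow> 2 * dQ * f = Q * df" using Qs s(1) t(1) f by simp
  finally show ?thesis .
qed

section \<open>Splitting types of the real curves and critical points of \<open>h0\<close>\<close>

theorem proposition5p3:
  fixes a b q0 q1 q2 lam0 lam :: real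
    and Z :: "('z, 3) atlas" and \<mu> :: "'z \<Rightarrow> ((complex^4) \<times> complex) set" and s :: "'z \<Rightarrow> 'z"
    and Lp Lm :: "real \<Rightarrow> 'z set" and L :: "'z set"
  assumes "a > 0" and "b > 0"
    and "\<forall>x::real. (quad q0 q1 q2 x 1)\<^sup>2 - cubic a b x \<ge> 0"
    and "\<forall>x::real. (quad q0 q1 q2 x 1)\<^sup>2 - cubic a b x = 0 \<longleftrightarrow> x = lam0"
    and "order lam0 ([:q2, q1, q0:]\<^sup>2 - [:0, 1:] * [:1, 1:] * [:- b, a:]) = 2"
    and "\<forall>x::real. cubic a b x \<ge> 0 \<and> x \<noteq> lam0 \<longrightarrow> quad q0 q1 q2 x 1 > sqrt (cubic a b x)"
    and "lam0 \<in> {b / a<..}"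
    and "small_resolution Z (tw_atlas 2) (Z0 a b q0 q1 q2) (Z0_sing a b q0 q1 q2) \<mu>"
    and "real_structure Z s" and "\<forall>x\<in>points Z. \<mu> (s x) = sigma_Z0 (\<mu> x)"
    and "lam \<in> {-1<..<0} \<union> {b / a<..<lam0} \<union> {lam0<..}"
    and "labelled_families a b q0 q1 q2 Z \<mu> s lam Lp Lm"
    and "L \<in> range Lp \<union> range Lm"
  shows "(normal_bundle_iso Z L 1 1 \<or> normal_bundle_iso Z L 0 2) \<and>
    (normal_bundle_iso Z L 0 2 \<longleftrightarrow> (h0 a b q0 q1 q2 has_real_derivative 0) (at lam))"
proof -
  define f where "f = cubic a b lam"
  define Q where "Q = quad q0 q1 q2 lam (1::real)"
  have ba: "b / a > 0" using assms(1,2) by simp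
  \<comment> \<open>A negative \<open>lam\<close> lies between -1 and 0; any other exceeds
    \<open>b / a\<close>, because \<open>lam0\<close> does. The cubic is positive in both
    cases.\<close>
  have f0: "f > 0"
  proof (cases "lam < 0")
    case True
    then have "lam + 1 > 0" "a * lam - b < 0" using assms(1,2,7,11) ba by (auto simp: mult_less_0_iff intro!: add_neg_neg[of "a * lam" "- b", simplified])
    then show ?thesis unfolding f_def cubic_def using True by (simp add: mult_neg_neg mult_neg_pos mult.assoc mult_pos_neg)
  next
    case False
    then have l: "lam > b / a" using assms(7,11) by auto
    then have "lam > 0" "a * lam - b > 0" using less_trans[OF ba l] assms(1) by (auto simp: field_simps)
    then show ?thesis unfolding f_def cubic_def by simp
  qed
  have "lam \<noteq> lam0" using assms(7,11) ba by auto
  then have Qf: "Q > sqrt f" using assms(6) f0 unfolding Q_def f_def by auto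
  define r where "r = sqrt f"
  have r: "r > 0" "r\<^sup>2 = f" "Q > r" using f0 Qf unfolding r_def by auto
  \<comment> \<open>For \<open>m = u - v\<close> and \<open>n = u + v\<close> one gets
    \<open>m n = u^2 - v^2 = 2 r\<close> and \<open>m^2 + n^2 = 2 (u^2 + v^2) = 4 Q\<close>; the
    inequality \<open>Q > r\<close> makes both radicands positive.\<close>
  define u v where "u = sqrt (Q + r)" and "v = sqrt (Q - r)"
  have uv: "u\<^sup>2 = Q + r" "v\<^sup>2 = Q - r" using r unfolding u_def v_def by auto
  obtain \<theta> where th: "L = Lp \<theta> \<or> L = Lm \<theta>" using assms(13) by blast
  have lab: "L \<subseteq> {x \<in> points Z. Phi \<mu> x \<in> conic a b q0 q1 q2 lam \<theta>}" "smooth_rational_curve Z L"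
    using assms(12) th unfolding labelled_families_def by auto
  \<comment> \<open>The half angle is used because the conic contains \<open>cis \<theta>\<close>
    and \<open>cis (- \<theta>)\<close> as the squares of \<open>\<gamma>\<close> and
    \<open>\<delta>\<close>.\<close>
  interpret double_solid a b q0 q1 q2 lam "of_real r" "of_real Q" "of_real (u - v)" "of_real (u + v)"
    "cis (\<theta> / 2)" "cis (- (\<theta> / 2))" Z \<mu>
  proof unfold_locales
    show "f4 a b (of_real lam) 1 = (of_real r)\<^sup>2"
      unfolding of_real_power[symmetric] r(2) f_def f4_def cubic_def by simp
    show "quad q0 q1 q2 (of_real lam) (1::complex) = of_real Q" unfolding Q_def quad_def by simp
    have "(u - v) * (u + v) = 2 * r" using uv by (simp add: algebra_simps power2_eq_square)
    then show "of_real (u - v) * of_real (u + v) = 2 * (of_real r :: complex)"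
      by (metis of_real_mult of_real_numeral)
    have "(u - v)\<^sup>2 + (u + v)\<^sup>2 = 4 * Q" using uv by (simp add: algebra_simps power2_eq_square)
    then show "(of_real (u - v))\<^sup>2 + (of_real (u + v))\<^sup>2 = 4 * (of_real Q :: complex)"
      by (metis of_real_add of_real_power of_real_mult of_real_numeral)
    show "cis (\<theta> / 2) * cis (- (\<theta> / 2)) = 1" by (simp add: cis_mult)
    show "of_real r \<noteq> (0::complex)" using r(1) by simp
    have "Q\<^sup>2 \<noteq> r\<^sup>2" using r by (auto simp: power2_eq_iff)
    then show "(of_real Q)\<^sup>2 \<noteq> (of_real r :: complex)\<^sup>2" by (metis of_real_eq_iff of_real_power)
    show "small_resolution Z (tw_atlas 2) (Z0 a b q0 q1 q2) (Z0_sing a b q0 q1 q2) \<mu>" by (rule assms(8))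
  qed
  obtain \<phi> where \<phi>: "holomorphic_embedding CP1 Z \<phi>" "\<phi> ` points CP1 = L"
    using lab(2) unfolding smooth_rational_curve_def by blast
  have "x \<in> phi 1 ` points CP1 \<union> phi (- 1) ` points CP1" if x: "x \<in> L" for x
  proof -
    have xZ: "x \<in> points Z" "Phi \<mu> x \<in> conic a b q0 q1 q2 lam \<theta>" using x lab(1) by auto
    have "\<mu> x \<in> Z0 a b q0 q1 q2" using assms(8) xZ(1) unfolding small_resolution_def by blast
    then obtain y z where yz: "\<mu> x = tw 2 y z" "y \<noteq> 0" "double_eq a b q0 q1 q2 (y, z) = 0" unfolding Z0_def by blast
    have "Phi \<mu> x = pt y" unfolding Phi_def yz(1) tw_def pt_def by force
    then obtain y' where y': "pt y = pt y'" "y' $ 0 = of_real lam * y' $ 1"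
       "of_real (2 * (Q\<^sup>2 - f)) * (y' $ 1)\<^sup>2 + of_real (sqrt f) * cis \<theta> * (y' $ 2)\<^sup>2
       + of_real (2 * Q) * y' $ 2 * y' $ 3 + of_real (sqrt f) * cis (- \<theta>) * (y' $ 3)\<^sup>2 = 0"
      using xZ(2) unfolding conic_def Let_def Q_def f_def by auto
    have c2: "(cis (\<theta> / 2))\<^sup>2 = cis \<theta>" "(cis (- (\<theta> / 2)))\<^sup>2 = cis (- \<theta>)"
      by (simp_all add: power2_eq_square cis_mult)
    have "ell 0 y' * ell 1 y' = (y' $ 1)\<^sup>2"
      by (rule conic_ell) (use y'(3) in \<open>simp add: c2 r_def[symmetric] r(2)[symmetric] abs_of_pos[OF r(1)]\<close>)
    then have "on_conic y'" unfolding on_conic_def using y'(2) by blast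
    moreover obtain k where "k \<noteq> 0" "y' = k *s y" using y'(1) pt_eq_iff by blast
    ultimately have "on_conic y" using on_conic_scale by blast
    then show ?thesis using lift_cases[OF xZ(1) yz] by blast
  qed
  then obtain e where e: "e\<^sup>2 = 1" "L = phi e ` points CP1"
    using rational_curve_is_lift[OF \<phi>(1)] unfolding \<phi>(2) by blast
  have "crit = 0 \<longleftrightarrow> 2 * (2 * q0 * lam + q1) * f = Q * (3 * a * lam\<^sup>2 + 2 * (a - b) * lam - b)"
  proof -
    \<comment> \<open>All data are real, so the vanishing of the extension class is the real
      equation supplied by \<open>h0_critical\<close>.\<close>
    have "crit = of_real (2 * (2 * q0 * lam + q1) - Q * (3 * a * lam\<^sup>2 + 2 * (a - b) * lam - b) / r\<^sup>2)"
      unfolding crit_def Q'_def f'_def by simp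
    then have "crit = 0 \<longleftrightarrow> 2 * (2 * q0 * lam + q1) - Q * (3 * a * lam\<^sup>2 + 2 * (a - b) * lam - b) / r\<^sup>2 = 0"
      using of_real_eq_0_iff by metis
    then show ?thesis unfolding r(2) using f0 by (simp add: field_simps)
  qed
  also have "\<dots> \<longleftrightarrow> (h0 a b q0 q1 q2 has_real_derivative 0) (at lam)"
    using h0_critical[of a b lam q0 q1 q2] f0 Qf unfolding f_def Q_def by blast
  finally have "crit = 0 \<longleftrightarrow> (h0 a b q0 q1 q2 has_real_derivative 0) (at lam)" .
  then show ?thesis using splitting_critical[OF e(1)] splitting_noncritical[OF e(1)] unfolding e(2) by blast
qed

end
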